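(* Let $B=\mathbb{C}^n$ ($n\geq 1$), let $A$ be a unital finitely generated $\mathrm{C}^*$-algebra with a coassociative unital $*$-homomorphism $\Delta_A\colon A\to A\otimes A$ (so that $\mathscr{QS}(A)$ is a compact quantum semigroup), and let $C=A^{\star n}$ be the $\mathrm{C}^*$-algebra corresponding to the quantum space of all maps $\mathscr{QS}(B)\to\mathscr{QS}(A)$, equipped with its natural comultiplication $\Delta\colon C\to C\otimes C$, i.e. the unital $*$-homomorphism determined by $\Delta\circ\iota_k=(\iota_k\otimes\iota_k)\circ\Delta_A$ for $k=1,\dots,n$, where $\iota_1,\dots,\iota_n\colon A\hookrightarrow C$ are the canonical inclusions. Then: (1) if $\mathscr{QS}(A)$ is a compact quantum group (with comultiplication $\Delta_A$), then $\mathscr{QS}(C)$ is a compact quantum group (with comultiplication $\Delta$); (2) if $A$ admits a continuous counit, then so does $C$; (3) if $C$ admits a continuous counit, then so does $A$; (4) if $\mathscr{QS}(C)$ is a compact quantum group (with comultiplication $\Delta$), then $\mathscr{QS}(A)$ is a compact quantum group (with comultiplication $\Delta_A$).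
   Context: For a $\mathrm{C}^*$-algebra $A$, $\mathscr{QS}(A)$ denotes the corresponding quantum space (a formal object dual to $A$); $\otimes$ is the minimal tensor product. Coassociative means $(\Delta_A\otimes\mathrm{id})\circ\Delta_A=(\mathrm{id}\otimes\Delta_A)\circ\Delta_A$; a compact quantum semigroup is a unital $\mathrm{C}^*$-algebra with a coassociative unital $*$-homomorphism $A\to A\otimes A$. It is a compact quantum group if in addition the linear spans of $\Delta_A(A)(\mathbb{1}\otimes A)$ and $\Delta_A(A)(A\otimes\mathbb{1})$ are dense in $A\otimes A$. A continuous counit for $(A,\Delta_A)$ is a unital $*$-homomorphism $\varepsilon\colon A\to\mathbb{C}$ with $(\varepsilon\otimes\mathrm{id})\circ\Delta_A=\mathrm{id}=(\mathrm{id}\otimes\varepsilon)\circ\Delta_A$. $A^{\star n}$ is the universal (full) unital free product of $n$ copies of $A$, amalgamated over the multiples of the unit. The quantum space of all maps $\mathscr{QS}(B)\to\mathscr{QS}(A)$ is $\mathscr{QS}(C)$, where $C$ is a unital $\mathrm{C}^*$-algebra with a unital $*$-homomorphism $\Phi\colon A\to B\otimes C$ such that for every unital $\mathrm{C}^*$-algebra $D$ and every unital $*$-homomorphism $\Psi\colon A\to B\otimes D$ there is a unique unital $*$-homomorphism $\Lambda\colon C\to D$ with $(\mathrm{id}\otimes\Lambda)\circ\Phi=\Psi$; for $B=\mathbb{C}^n$ one has $C=A^{\star n}$ with $\Phi(a)=\sum_{i=1}^n e_i\otimes\iota_i(a)$, $e_1,\dots,e_n$ being the standard basis of $\mathbb{C}^n$.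 *)

theory Defs
  imports "HOL-Analysis.Analysis" "HOL-Library.Poly_Mapping"
begin

section \<open>Complex star-algebras and unital C*-algebras\<close>

class scaleC = scaleR +
  fixes scaleC :: "complex \<Rightarrow> 'a \<Rightarrow> 'a" (infixr "*\<^sub>C" 75)

class complex_vector = scaleC + ab_group_add +
  assumes scaleC_add_right: "c *\<^sub>C (x + y) = c *\<^sub>C x + c *\<^sub>C y"
    and scaleC_add_left: "(c + d) *\<^sub>C x = c *\<^sub>C x + d *\<^sub>C x"
    and scaleC_scaleC [simp]: "c *\<^sub>C d *\<^sub>C x = (c * d) *\<^sub>C x"
    and scaleC_one [simp]: "1 *\<^sub>C x = x"
    and scaleR_scaleC: "scaleR r x = complex_of_real r *\<^sub>C x"
begin

subclass real_vector
  by standard (simp_all add: scaleR_scaleC scaleC_add_right scaleC_add_left)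

end

class involution =
  fixes star :: "'a \<Rightarrow> 'a"
  assumes star_star [simp]: "star (star a) = a"

text \<open>The sort \<open>monoid_mult\<close> rather than \<open>ring_1\<close> is used for the unit, so that \<open>0 = 1\<close> is not
  excluded: the zero algebra is a unital C*-algebra.\<close>

class star_algebra = complex_vector + ring + monoid_mult + involution +
  assumes scaleC_mult_left [simp]: "(c *\<^sub>C a) * b = c *\<^sub>C (a * b)"
    and scaleC_mult_right [simp]: "a * (c *\<^sub>C b) = c *\<^sub>C (a * b)"
    and star_add: "star (a + b) = star a + star b"
    and star_scaleC: "star (c *\<^sub>C a) = cnj c *\<^sub>C star a"
    and star_mult: "star (a * b) = star b * star a"

class unital_cstar_algebra = star_algebra + real_normed_algebra + banach +
  assumes norm_scaleC: "norm (c *\<^sub>C a) = cmod c * norm a"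
    and norm_star_mult_self: "norm (star a * a) = (norm a)\<^sup>2"

instantiation complex :: unital_cstar_algebra
begin
definition "c *\<^sub>C (z::complex) = c * z"
definition "star (z::complex) = cnj z"
instance
  by standard (simp_all add: scaleC_complex_def star_complex_def algebra_simps norm_mult
      scaleR_conv_of_real power2_eq_square)
end

lemma scaleC_zero_left [simp]: "0 *\<^sub>C x = (0::'a::complex_vector)"
  using scaleC_add_left[of 0 0 x] by simp

lemma scaleC_zero_right [simp]: "c *\<^sub>C 0 = (0::'a::complex_vector)"
  using scaleC_add_right[of c 0 "0::'a"] by simp

lemma scaleC_minus_left: "(- c) *\<^sub>C x = - (c *\<^sub>C (x::'a::complex_vector))"
  using scaleC_add_left[of c "-c" x] by (simp add: eq_neg_iff_add_eq_0 add.commute)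

lemma scaleC_minus1 [simp]: "(- 1) *\<^sub>C x = - (x::'a::complex_vector)"
  by (simp add: scaleC_minus_left)

lemma scaleC_minus_right: "c *\<^sub>C (- x) = - (c *\<^sub>C (x::'a::complex_vector))"
  using scaleC_add_right[of c x "-x"] by (simp add: eq_neg_iff_add_eq_0 add.commute)

lemma scaleC_diff_right: "c *\<^sub>C (x - y) = c *\<^sub>C x - c *\<^sub>C (y::'a::complex_vector)"
  using scaleC_add_right[of c x "-y"] by (simp add: scaleC_minus_right)

lemma scaleC_sum_right: "c *\<^sub>C (\<Sum>i\<in>I. f i) = (\<Sum>i\<in>I. c *\<^sub>C (f i::'a::complex_vector))"
  by (induction I rule: infinite_finite_induct) (simp_all add: scaleC_add_right)

lemma star_zero [simp]: "star 0 = (0::'a::star_algebra)"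
  using star_add[of 0 "0::'a"] by simp

lemma star_one [simp]: "star 1 = (1::'a::star_algebra)"
  by (metis mult.left_neutral mult.right_neutral star_mult star_star)

lemma star_minus: "star (- a) = - star (a::'a::star_algebra)"
  using star_add[of a "-a"] by (simp add: eq_neg_iff_add_eq_0 add.commute)

lemma star_diff: "star (a - b) = star a - star (b::'a::star_algebra)"
  using star_add[of a "-b"] by (simp add: star_minus)

lemma star_scaleR: "star (r *\<^sub>R a) = r *\<^sub>R star (a::'a::star_algebra)"
  by (simp add: scaleR_scaleC star_scaleC)

lemma star_sum: "star (\<Sum>i\<in>I. f i) = (\<Sum>i\<in>I. star (f i::'a::star_algebra))"
  by (induction I rule: infinite_finite_induct) (simp_all add: star_add)

definition unital_star_hom :: "('a::star_algebra \<Rightarrow> 'b::star_algebra) \<Rightarrow> bool" where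
  "unital_star_hom f \<longleftrightarrow>
     (\<forall>x y. f (x + y) = f x + f y) \<and> (\<forall>c x. f (c *\<^sub>C x) = c *\<^sub>C f x) \<and>
     (\<forall>x y. f (x * y) = f x * f y) \<and> f 1 = 1 \<and> (\<forall>x. f (star x) = star (f x))"

definition cstar_seminorm :: "('a::star_algebra \<Rightarrow> real) \<Rightarrow> bool" where
  "cstar_seminorm q \<longleftrightarrow>
     (\<forall>x y. q (x + y) \<le> q x + q y) \<and> (\<forall>c x. q (c *\<^sub>C x) = cmod c * q x) \<and>
     (\<forall>x y. q (x * y) \<le> q x * q y) \<and> (\<forall>x. q (star x * x) = (q x)\<^sup>2)"

lemma cstar_seminormD:
  assumes "cstar_seminorm q"
  shows "q (x + y) \<le> q x + q y" "q (c *\<^sub>C x) = cmod c * q x"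
    "q (x * y) \<le> q x * q y" "q (star x * x) = (q x)\<^sup>2"
    "q 0 = 0" "q (- x) = q x" "0 \<le> q x" "q (x - y) \<le> q x + q y" "q (x - y) = q (y - x)"
    "q (star x) = q x" "q 1 \<le> 1" "\<bar>q x - q y\<bar> \<le> q (x - y)"
proof -
  show a: "q (x + y) \<le> q x + q y" for x y using assms by (simp add: cstar_seminorm_def)
  show s: "q (c *\<^sub>C x) = cmod c * q x" for c x using assms by (simp add: cstar_seminorm_def)
  show m: "q (x * y) \<le> q x * q y" for x y using assms by (simp add: cstar_seminorm_def)
  show c: "q (star x * x) = (q x)\<^sup>2" for x using assms by (simp add: cstar_seminorm_def)
  show z: "q 0 = 0" using s[of 0 0] by simp
  show mi: "q (- x) = q x" for x using s[of "-1" x] by simp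
  show nn: "0 \<le> q x" for x using a[of x "-x"] z mi by simp
  show "q (x - y) \<le> q x + q y" using a[of x "-y"] mi by simp
  show sy: "q (x - y) = q (y - x)" for x y using mi[of "x - y"] by simp
  have le: "q x \<le> q (star x)" for x
  proof (cases "q x = 0")
    case False
    have "q x * q x \<le> q (star x) * q x" using c[of x] m[of "star x" x] by (simp add: power2_eq_square)
    with False nn[of x] show ?thesis by (simp add: mult_le_cancel_right)
  qed (simp add: nn)
  show "q (star x) = q x" using le[of x] le[of "star x"] by simp
  have "q 1 = q 1 * q 1" using c[of 1] by (simp add: power2_eq_square)
  then show "q 1 \<le> 1" by (cases "q 1 = 0") auto
  show "\<bar>q x - q y\<bar> \<le> q (x - y)" using a[of "x - y" y] a[of "y - x" x] sy[of x y] by simp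
qed

lemma cstar_seminorm_sum:
  assumes "cstar_seminorm q"
  shows "q (\<Sum>i\<in>I. f i) \<le> (\<Sum>i\<in>I. q (f i))"
proof (induction I rule: infinite_finite_induct)
  case (insert x F)
  then show ?case using cstar_seminormD(1)[OF assms, of "f x" "sum f F"] by simp
qed (simp_all add: cstar_seminormD[OF assms])

lemma cstar_seminorm_norm: "cstar_seminorm (norm :: 'a::unital_cstar_algebra \<Rightarrow> real)"
  by (simp add: cstar_seminorm_def norm_triangle_ineq norm_scaleC norm_mult_ineq norm_star_mult_self)

lemmas norm_star = cstar_seminormD(10)[OF cstar_seminorm_norm]
lemmas norm_one_le = cstar_seminormD(11)[OF cstar_seminorm_norm]

lemma bounded_linear_star: "bounded_linear (star :: 'a::unital_cstar_algebra \<Rightarrow> 'a)"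
  by (rule bounded_linear_intro[of _ 1]) (simp_all add: star_add star_scaleR norm_star)

lemma norm_power_le: "norm ((a::'a::unital_cstar_algebra) ^ n) \<le> norm a ^ n"
proof (induction n)
  case (Suc n)
  have "norm (a ^ Suc n) \<le> norm a * norm (a ^ n)" by (simp add: norm_mult_ineq)
  also have "\<dots> \<le> norm a * norm a ^ n" by (intro mult_left_mono Suc.IH) simp
  finally show ?case by simp
qed (simp add: norm_one_le)

subsection \<open>C*-seminorms on a C*-algebra are dominated by the norm\<close>

lemma selfadjoint_sqrt_ex:
  fixes y :: "'a::unital_cstar_algebra"
  assumes y: "norm y < 1" "star y = y"
  shows "\<exists>k. star k = k \<and> k * k = 1 - y \<and> (\<forall>h. h * y = y * h \<longrightarrow> h * k = k * h)"
proof -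
  define c :: "nat \<Rightarrow> real" where "c n = (-1) ^ n * ((1/2) gchoose n)" for n
  have sc: "summable (\<lambda>n. norm (((1/2::real) gchoose n) * norm y ^ n))"
    using y(1) by (intro abs_summable_in_conv_radius) (auto simp: conv_radius_gchoose Nats_def)
  have sn: "summable (\<lambda>n. norm (c n *\<^sub>R y ^ n))"
  proof (rule summable_comparison_test[OF _ sc], intro exI allI impI)
    fix n
    show "norm (norm (c n *\<^sub>R y ^ n)) \<le> norm (((1/2::real) gchoose n) * norm y ^ n)"
      using norm_power_le[of y n] by (auto simp: c_def abs_mult power_abs intro!: mult_left_mono)
  qed
  define k where "k = suminf (\<lambda>n. c n *\<^sub>R y ^ n)"
  have sm: "summable (\<lambda>n. c n *\<^sub>R y ^ n)" using sn by (rule summable_norm_cancel)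
  have "star (y ^ n) = y ^ n" for n
    by (induction n) (simp_all add: star_mult y power_commutes)
  then have "star k = k"
    unfolding k_def using bounded_linear.suminf[OF bounded_linear_star sm]
    by (simp add: star_scaleR)
  moreover have "k * k = 1 - y"
  proof -
    have "k * k = suminf (\<lambda>n. \<Sum>i\<le>n. (c i *\<^sub>R y ^ i) * (c (n - i) *\<^sub>R y ^ (n - i)))"
      unfolding k_def by (rule Cauchy_product[OF sn sn])
    also have "(\<lambda>n. \<Sum>i\<le>n. (c i *\<^sub>R y ^ i) * (c (n - i) *\<^sub>R y ^ (n - i))) =
               (\<lambda>n. ((-1) ^ n * (1 gchoose n)) *\<^sub>R y ^ n)"
    proof
      fix n
      have "(\<Sum>i\<le>n. (c i *\<^sub>R y ^ i) * (c (n - i) *\<^sub>R y ^ (n - i))) = (\<Sum>i\<le>n. c i * c (n - i)) *\<^sub>R y ^ n"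
        by (auto simp: scaleR_sum_left power_add[symmetric] intro!: sum.cong)
      also have "(\<Sum>i\<le>n. c i * c (n - i)) =
                 (-1) ^ n * (\<Sum>i\<in>{0..n}. ((1/2) gchoose i) * ((1/2) gchoose (n - i)))"
        unfolding sum_distrib_left
      proof (intro sum.cong)
        fix i assume "i \<in> {0..n}"
        then have "(-1::real) ^ n = (-1) ^ i * (-1) ^ (n - i)" by (simp add: power_add[symmetric])
        then show "c i * c (n - i) = (-1) ^ n * (((1/2) gchoose i) * ((1/2) gchoose (n - i)))"
          by (simp add: c_def)
      qed auto
      also have "(\<Sum>i\<in>{0..n}. ((1/2::real) gchoose i) * ((1/2) gchoose (n - i))) = 1 gchoose n"
        using gbinomial_Vandermonde[of "1/2::real" "1/2" n] by simp
      finally show "(\<Sum>i\<le>n. (c i *\<^sub>R y ^ i) * (c (n - i) *\<^sub>R y ^ (n - i))) =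
          ((-1) ^ n * (1 gchoose n)) *\<^sub>R y ^ n" .
    qed
    also have "suminf (\<lambda>n. ((-1) ^ n * (1 gchoose n)) *\<^sub>R y ^ n) =
               (\<Sum>n\<in>{0,1}. ((-1) ^ n * (1 gchoose n :: real)) *\<^sub>R y ^ n)"
    proof (rule suminf_finite)
      fix n :: nat assume "n \<notin> {0, 1}"
      then have "1 < n" by auto
      then have "(1::nat) choose n = 0" by (simp add: binomial_eq_0)
      then have "(1::real) gchoose n = 0" using binomial_gbinomial[of 1 n, where ?'a=real] by (metis of_nat_0 of_nat_1)
      then show "((-1) ^ n * (1 gchoose n :: real)) *\<^sub>R y ^ n = 0" by simp
    qed simp
    also have "\<dots> = 1 - y" by simp
    finally show ?thesis .
  qed
  moreover have "h * k = k * h" if h: "h * y = y * h" for h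
  proof -
    have "h * y ^ n = y ^ n * h" for n
      by (induction n) (simp_all add: h mult.assoc[symmetric], metis h mult.assoc)
    then show ?thesis
      unfolding k_def using suminf_mult[OF sm, of h] suminf_mult2[OF sm, of h] by simp
  qed
  ultimately show ?thesis by blast
qed

lemma cstar_seminorm_le_norm:
  fixes a :: "'a::unital_cstar_algebra"
  assumes q: "cstar_seminorm q"
  shows "q a \<le> norm a"
proof -
  note Q = cstar_seminormD[OF q]
  have lt: "q h \<le> 1" if h: "star h = h" "norm h < 1" for h :: 'a
  proof -
    have "norm (h * h) < 1"
      using norm_star_mult_self[of h] h by (simp add: power_less_one_iff)
    moreover have "star (h * h) = h * h" by (simp add: star_mult h)
    ultimately obtain k where k: "star k = k" "k * k = 1 - h * h"
      and "\<forall>g. g * (h * h) = (h * h) * g \<longrightarrow> g * k = k * g"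
      using selfadjoint_sqrt_ex[of "h * h"] by blast
    then have hk: "h * k = k * h" by (simp add: mult.assoc)
    define u where "u = h + \<i> *\<^sub>C k"
    have su: "star u = h - \<i> *\<^sub>C k" by (simp add: u_def star_add star_scaleC h k scaleC_minus_left)
    have "star u * u = h * h + k * k"
      unfolding su unfolding u_def by (simp add: algebra_simps hk scaleC_diff_right scaleC_add_right)
    then have "star u * u = 1" by (simp add: k)
    then have "(q u)\<^sup>2 \<le> 1" using Q(4)[of u] Q(11) by simp
    then have qu: "q u \<le> 1" using Q(7)[of u] by (simp add: power_le_one_iff)
    have "u + star u = 2 *\<^sub>C h" unfolding su unfolding u_def
      by (simp add: scaleC_add_left[of 1 1, simplified])
    then have "2 * q h = q (u + star u)" by (simp add: Q)
    also have "\<dots> \<le> q u + q (star u)" by (rule Q)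
    finally show ?thesis using qu by (simp add: Q)
  qed
  have sa: "q h \<le> norm h" if h: "star h = h" for h :: 'a
  proof (rule dense_ge)
    fix r assume r: "norm h < r"
    then have r0: "0 < r" using norm_ge_zero[of h] by linarith
    have "q (inverse r *\<^sub>R h) \<le> 1"
      using r r0 by (intro lt) (simp_all add: star_scaleR h field_simps)
    then show "q h \<le> r" using r0 by (simp add: scaleR_scaleC Q norm_inverse field_simps norm_divide)
  qed
  have "(q a)\<^sup>2 \<le> (norm a)\<^sup>2"
    using sa[of "star a * a"] by (simp add: star_mult Q norm_star_mult_self)
  then show ?thesis using power2_le_imp_le[OF _ norm_ge_zero] by blast
qed

lemma unital_star_homD:
  assumes "unital_star_hom f"
  shows "f (x + y) = f x + f y" "f (c *\<^sub>C x) = c *\<^sub>C f x" "f (x * y) = f x * f y"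
    "f 1 = 1" "f (star x) = star (f x)" "f 0 = 0" "f (- x) = - f x" "f (x - y) = f x - f y"
    "f (r *\<^sub>R x) = r *\<^sub>R f x"
proof -
  show a: "f (x + y) = f x + f y" and s: "f (c *\<^sub>C x) = c *\<^sub>C f x" and "f (x * y) = f x * f y"
    "f 1 = 1" "f (star x) = star (f x)" for x y c using assms by (simp_all add: unital_star_hom_def)
  show "f 0 = 0" using s[of 0 0] by simp
  show m: "f (- x) = - f x" for x using s[of "-1" x] by simp
  show "f (x - y) = f x - f y" using a[of x "-y"] by (simp add: m)
  show "f (r *\<^sub>R x) = r *\<^sub>R f x" by (simp add: scaleR_scaleC s)
qed

lemma unital_star_hom_sum:
  assumes "unital_star_hom f"
  shows "f (\<Sum>i\<in>I. g i) = (\<Sum>i\<in>I. f (g i))"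
  by (induction I rule: infinite_finite_induct) (simp_all add: unital_star_homD[OF assms])

lemma unital_star_hom_id: "unital_star_hom id" "unital_star_hom (\<lambda>x. x)"
  by (simp_all add: unital_star_hom_def)

lemma unital_star_hom_comp:
  "unital_star_hom g \<Longrightarrow> unital_star_hom f \<Longrightarrow> unital_star_hom (g \<circ> f)"
  by (simp add: unital_star_hom_def)

lemma cstar_seminorm_pullback:
  assumes "unital_star_hom f" "cstar_seminorm q"
  shows "cstar_seminorm (\<lambda>x. q (f x))"
  unfolding cstar_seminorm_def
  by (simp add: unital_star_homD[OF assms(1)] cstar_seminormD[OF assms(2)])

lemma unital_star_hom_contractive:
  fixes f :: "'a::unital_cstar_algebra \<Rightarrow> 'b::unital_cstar_algebra"
  assumes "unital_star_hom f"
  shows "norm (f x) \<le> norm x"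
  by (rule cstar_seminorm_le_norm[OF cstar_seminorm_pullback[OF assms cstar_seminorm_norm]])

lemma unital_star_hom_bounded_linear:
  fixes f :: "'a::unital_cstar_algebra \<Rightarrow> 'b::unital_cstar_algebra"
  assumes "unital_star_hom f"
  shows "bounded_linear f"
  by (rule bounded_linear_intro[of _ 1])
     (simp_all add: unital_star_homD[OF assms] unital_star_hom_contractive[OF assms])

section \<open>Separated completion of a star-algebra with a C*-seminorm\<close>

class cstar_seminormed = star_algebra +
  fixes snorm :: "'a \<Rightarrow> real"
  assumes snorm_add: "snorm (x + y) \<le> snorm x + snorm y"
    and snorm_scaleC: "snorm (c *\<^sub>C x) = cmod c * snorm x"
    and snorm_mult: "snorm (x * y) \<le> snorm x * snorm y"
    and snorm_star_mult_self: "snorm (star x * x) = (snorm x)\<^sup>2"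

class separable_cstar_seminormed = cstar_seminormed +
  assumes countable_dense_snorm: "\<exists>K. countable K \<and> (\<forall>x e. 0 < e \<longrightarrow> (\<exists>k\<in>K. snorm (x - k) < e))"

lemma cstar_seminorm_snorm: "cstar_seminorm snorm"
  by (simp add: cstar_seminorm_def snorm_add snorm_scaleC snorm_mult snorm_star_mult_self)

lemmas snormD = cstar_seminormD[OF cstar_seminorm_snorm]

definition snorm_Cauchy :: "(nat \<Rightarrow> 'a::cstar_seminormed) \<Rightarrow> bool" where
  "snorm_Cauchy X \<longleftrightarrow> (\<forall>e>0. \<exists>N. \<forall>m\<ge>N. \<forall>n\<ge>N. snorm (X m - X n) < e)"

definition completion_rel :: "(nat \<Rightarrow> 'a::cstar_seminormed) \<Rightarrow> (nat \<Rightarrow> 'a) \<Rightarrow> bool" where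
  "completion_rel X Y \<longleftrightarrow>
     snorm_Cauchy X \<and> snorm_Cauchy Y \<and> (\<lambda>n. snorm (X n - Y n)) \<longlonglongrightarrow> 0"

lemma snorm_lim0:
  assumes "\<And>n. snorm (Z n) \<le> f n" "f \<longlonglongrightarrow> 0"
  shows "(\<lambda>n. snorm (Z n)) \<longlonglongrightarrow> 0"
  by (rule tendsto_sandwich[OF _ _ tendsto_const assms(2)]) (auto simp: snormD assms(1))

lemma snorm_Cauchy_const: "snorm_Cauchy (\<lambda>n. x)"
  by (simp add: snorm_Cauchy_def snormD)

lemma snorm_Cauchy_lipschitz:
  assumes "snorm_Cauchy X" "\<And>m n. snorm (Y m - Y n) \<le> C * snorm (X m - X n)"
  shows "snorm_Cauchy Y"
  unfolding snorm_Cauchy_def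
proof (intro allI impI)
  fix e :: real assume e: "0 < e"
  then have "0 < e / (\<bar>C\<bar> + 1)" by (simp add: divide_pos_pos)
  then obtain N where N: "\<And>m n. m \<ge> N \<Longrightarrow> n \<ge> N \<Longrightarrow> snorm (X m - X n) < e / (\<bar>C\<bar> + 1)"
    using assms(1) unfolding snorm_Cauchy_def by meson
  show "\<exists>N. \<forall>m\<ge>N. \<forall>n\<ge>N. snorm (Y m - Y n) < e"
  proof (intro exI allI impI)
    fix m n assume mn: "N \<le> m" "N \<le> n"
    have "snorm (Y m - Y n) \<le> C * snorm (X m - X n)" by (rule assms)
    also have "\<dots> \<le> (\<bar>C\<bar> + 1) * snorm (X m - X n)" by (intro mult_right_mono) (auto simp: snormD)
    also have "\<dots> < e" using N[OF mn] by (simp add: field_simps)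
    finally show "snorm (Y m - Y n) < e" .
  qed
qed

lemma snorm_Cauchy_add:
  assumes "snorm_Cauchy X" "snorm_Cauchy Y"
  shows "snorm_Cauchy (\<lambda>n. X n + Y n)"
  unfolding snorm_Cauchy_def
proof (intro allI impI)
  fix e :: real assume e: "0 < e"
  obtain N M where N: "\<And>m n. m \<ge> N \<Longrightarrow> n \<ge> N \<Longrightarrow> snorm (X m - X n) < e/2"
    and M: "\<And>m n. m \<ge> M \<Longrightarrow> n \<ge> M \<Longrightarrow> snorm (Y m - Y n) < e/2"
    using assms e unfolding snorm_Cauchy_def by (meson half_gt_zero)
  show "\<exists>N. \<forall>m\<ge>N. \<forall>n\<ge>N. snorm (X m + Y m - (X n + Y n)) < e"
  proof (intro exI allI impI)
    fix m n assume mn: "max N M \<le> m" "max N M \<le> n"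
    have "snorm ((X m - X n) + (Y m - Y n)) \<le> snorm (X m - X n) + snorm (Y m - Y n)" by (rule snormD)
    also have "\<dots> < e" using N[of m n] M[of m n] mn by simp
    finally show "snorm (X m + Y m - (X n + Y n)) < e" by (simp add: algebra_simps)
  qed
qed

lemma snorm_Cauchy_bounded:
  assumes "snorm_Cauchy X"
  shows "\<exists>B>0. \<forall>n. snorm (X n) \<le> B"
proof -
  have "Cauchy (\<lambda>n. snorm (X n))"
    unfolding Cauchy_def dist_real_def
    using assms unfolding snorm_Cauchy_def by (meson snormD(12) le_less_trans)
  then have "Bseq (\<lambda>n. snorm (X n))" by (rule Cauchy_Bseq)
  then obtain K where "0 < K" "\<And>n. norm (snorm (X n)) \<le> K" by (auto elim: BseqE)
  then show ?thesis by (auto intro!: exI[of _ K] simp: snormD)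
qed

lemma snorm_Cauchy_convergent:
  assumes "snorm_Cauchy X"
  shows "convergent (\<lambda>n. snorm (X n))"
proof -
  have "Cauchy (\<lambda>n. snorm (X n))"
    unfolding Cauchy_def dist_real_def
    using assms unfolding snorm_Cauchy_def by (meson snormD(12) le_less_trans)
  then show ?thesis by (rule Cauchy_convergent)
qed

lemma snorm_mult_diff_le:
  assumes "snorm x' \<le> B" "snorm y \<le> B"
  shows "snorm (x * y - x' * y') \<le> B * snorm (x - x') + B * snorm (y - y')"
proof -
  have "x * y - x' * y' = (x - x') * y + x' * (y - y')" by (simp add: algebra_simps)
  then have "snorm (x * y - x' * y') \<le> snorm ((x - x') * y) + snorm (x' * (y - y'))"
    by (metis snormD(1))
  also have "\<dots> \<le> snorm (x - x') * snorm y + snorm x' * snorm (y - y')"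
    by (intro add_mono snormD)
  also have "\<dots> \<le> snorm (x - x') * B + B * snorm (y - y')"
    by (intro add_mono mult_left_mono mult_right_mono assms snormD)
  finally show ?thesis by (simp add: mult.commute)
qed

lemma snorm_Cauchy_mult:
  assumes X: "snorm_Cauchy X" and Y: "snorm_Cauchy Y"
  shows "snorm_Cauchy (\<lambda>n. X n * Y n)"
proof -
  obtain B1 where B1: "\<And>n. snorm (X n) \<le> B1" "0 < B1" using snorm_Cauchy_bounded[OF X] by blast
  obtain B2 where B2: "\<And>n. snorm (Y n) \<le> B2" "0 < B2" using snorm_Cauchy_bounded[OF Y] by blast
  define B where "B = max B1 B2"
  have B: "snorm (X n) \<le> B" "snorm (Y n) \<le> B" "0 < B" for n
    using B1 B2 by (auto simp: B_def max.coboundedI1 max.coboundedI2)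
  show ?thesis
    unfolding snorm_Cauchy_def
  proof (intro allI impI)
    fix e :: real assume "0 < e"
    then have e: "0 < e / (2 * B)" using B by simp
    obtain N M where N: "\<And>m n. m \<ge> N \<Longrightarrow> n \<ge> N \<Longrightarrow> snorm (X m - X n) < e / (2 * B)"
      and M: "\<And>m n. m \<ge> M \<Longrightarrow> n \<ge> M \<Longrightarrow> snorm (Y m - Y n) < e / (2 * B)"
      using X Y e unfolding snorm_Cauchy_def by meson
    show "\<exists>N. \<forall>m\<ge>N. \<forall>n\<ge>N. snorm (X m * Y m - X n * Y n) < e"
    proof (intro exI allI impI)
      fix m n assume mn: "max N M \<le> m" "max N M \<le> n"
      have "snorm (X m * Y m - X n * Y n) \<le> B * snorm (X m - X n) + B * snorm (Y m - Y n)"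
        by (intro snorm_mult_diff_le B)
      also have "\<dots> < B * (e / (2 * B)) + B * (e / (2 * B))"
        using N[of m n] M[of m n] mn B by (intro add_strict_mono mult_strict_left_mono) auto
      also have "\<dots> = e" using B by (simp add: field_simps)
      finally show "snorm (X m * Y m - X n * Y n) < e" .
    qed
  qed
qed

lemma completion_rel_mult:
  assumes "completion_rel X X'" "completion_rel Y Y'"
  shows "completion_rel (\<lambda>n. X n * Y n) (\<lambda>n. X' n * Y' n)"
proof -
  obtain B1 where B1: "\<And>n. snorm (X' n) \<le> B1" "0 < B1"
    using snorm_Cauchy_bounded assms unfolding completion_rel_def by metis
  obtain B2 where B2: "\<And>n. snorm (Y n) \<le> B2" "0 < B2"
    using snorm_Cauchy_bounded assms unfolding completion_rel_def by metis
  define B where "B = max B1 B2"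
  have B: "snorm (X' n) \<le> B" "snorm (Y n) \<le> B" for n
    using B1 B2 by (auto simp: B_def max.coboundedI1 max.coboundedI2)
  have "(\<lambda>n. snorm (X n * Y n - X' n * Y' n)) \<longlonglongrightarrow> 0"
  proof (rule snorm_lim0)
    show "snorm (X n * Y n - X' n * Y' n) \<le> B * snorm (X n - X' n) + B * snorm (Y n - Y' n)" for n
      by (intro snorm_mult_diff_le B)
    have "(\<lambda>n. B * snorm (X n - X' n) + B * snorm (Y n - Y' n)) \<longlonglongrightarrow> B * 0 + B * 0"
      using assms unfolding completion_rel_def by (intro tendsto_intros) auto
    then show "(\<lambda>n. B * snorm (X n - X' n) + B * snorm (Y n - Y' n)) \<longlonglongrightarrow> 0" by simp
  qed
  then show ?thesis using assms by (simp add: completion_rel_def snorm_Cauchy_mult)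
qed

lemma completion_rel_add:
  assumes "completion_rel X X'" "completion_rel Y Y'"
  shows "completion_rel (\<lambda>n. X n + Y n) (\<lambda>n. X' n + Y' n)"
proof -
  have "(\<lambda>n. snorm ((X n + Y n) - (X' n + Y' n))) \<longlonglongrightarrow> 0"
  proof (rule snorm_lim0)
    show "snorm ((X n + Y n) - (X' n + Y' n)) \<le> snorm (X n - X' n) + snorm (Y n - Y' n)" for n
      using snormD(1)[of "X n - X' n" "Y n - Y' n"] by (simp add: algebra_simps)
    have "(\<lambda>n. snorm (X n - X' n) + snorm (Y n - Y' n)) \<longlonglongrightarrow> 0 + 0"
      using assms unfolding completion_rel_def by (intro tendsto_intros) auto
    then show "(\<lambda>n. snorm (X n - X' n) + snorm (Y n - Y' n)) \<longlonglongrightarrow> 0" by simp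
  qed
  then show ?thesis using assms by (simp add: completion_rel_def snorm_Cauchy_add)
qed

lemma completion_rel_lipschitz:
  assumes r: "completion_rel X X'" and F: "\<And>x y. snorm (F x - F y) \<le> C * snorm (x - y)"
  shows "completion_rel (\<lambda>n. F (X n)) (\<lambda>n. F (X' n))"
proof -
  have "(\<lambda>n. snorm (F (X n) - F (X' n))) \<longlonglongrightarrow> 0"
  proof (rule snorm_lim0[OF F])
    have "(\<lambda>n. C * snorm (X n - X' n)) \<longlonglongrightarrow> C * 0"
      using r unfolding completion_rel_def by (intro tendsto_intros) auto
    then show "(\<lambda>n. C * snorm (X n - X' n)) \<longlonglongrightarrow> 0" by simp
  qed
  then show ?thesis
    using r snorm_Cauchy_lipschitz[OF _ F] unfolding completion_rel_def by blast
qed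

lemma completion_rel_refl: "snorm_Cauchy X \<Longrightarrow> completion_rel X X"
  by (simp add: completion_rel_def snormD)

quotient_type (overloaded) 'a cstar_completion = "nat \<Rightarrow> 'a::cstar_seminormed" / partial: completion_rel
proof (rule part_equivpI)
  show "\<exists>X::nat \<Rightarrow> 'a. completion_rel X X"
    using completion_rel_refl snorm_Cauchy_const by blast
  show "symp (completion_rel :: (nat \<Rightarrow> 'a) \<Rightarrow> _)"
    by (auto simp: symp_def completion_rel_def snormD(9))
  show "transp (completion_rel :: (nat \<Rightarrow> 'a) \<Rightarrow> _)"
  proof (rule transpI)
    fix X Y Z :: "nat \<Rightarrow> 'a" assume r: "completion_rel X Y" "completion_rel Y Z"
    have "(\<lambda>n. snorm (X n - Z n)) \<longlonglongrightarrow> 0"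
    proof (rule snorm_lim0)
      show "snorm (X n - Z n) \<le> snorm (X n - Y n) + snorm (Y n - Z n)" for n
        using snormD(1)[of "X n - Y n" "Y n - Z n"] by simp
      have "(\<lambda>n. snorm (X n - Y n) + snorm (Y n - Z n)) \<longlonglongrightarrow> 0 + 0"
        using r unfolding completion_rel_def by (intro tendsto_intros) auto
      then show "(\<lambda>n. snorm (X n - Y n) + snorm (Y n - Z n)) \<longlonglongrightarrow> 0" by simp
    qed
    then show "completion_rel X Z" using r by (simp add: completion_rel_def)
  qed
qed

lemma completion_rel_const: "completion_rel (\<lambda>n. x) (\<lambda>n. x)"
  by (simp add: completion_rel_refl snorm_Cauchy_const)

lemma completion_rel_uminus:
  "completion_rel X Y \<Longrightarrow> completion_rel (\<lambda>n. - X n) (\<lambda>n. - Y n)"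
  by (rule completion_rel_lipschitz[where C = 1], assumption)
     (metis snormD(9) dual_order.refl minus_diff_minus mult_1 snormD(6))

lemma completion_rel_scaleC:
  "completion_rel X Y \<Longrightarrow> completion_rel (\<lambda>n. c *\<^sub>C X n) (\<lambda>n. c *\<^sub>C Y n)"
  by (rule completion_rel_lipschitz[where C = "cmod c"])
     (simp_all add: scaleC_diff_right[symmetric] snormD)

lemma completion_rel_star:
  "completion_rel X Y \<Longrightarrow> completion_rel (\<lambda>n. star (X n)) (\<lambda>n. star (Y n))"
  by (rule completion_rel_lipschitz[where C = 1], assumption)
     (simp add: star_diff[symmetric] snormD)

lemmas completion_rel_intros =
  completion_rel_add completion_rel_mult completion_rel_scaleC completion_rel_star
  completion_rel_uminus completion_rel_const

instantiation cstar_completion :: (cstar_seminormed) star_algebra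
begin

lift_definition zero_cstar_completion :: "'a cstar_completion" is "\<lambda>n. 0"
  by (rule completion_rel_const)

lift_definition one_cstar_completion :: "'a cstar_completion" is "\<lambda>n. 1"
  by (rule completion_rel_const)

lift_definition plus_cstar_completion :: "'a cstar_completion \<Rightarrow> 'a cstar_completion \<Rightarrow> 'a cstar_completion"
  is "\<lambda>X Y n. X n + Y n"
  by (rule completion_rel_add)

lift_definition uminus_cstar_completion :: "'a cstar_completion \<Rightarrow> 'a cstar_completion"
  is "\<lambda>X n. - X n"
  by (rule completion_rel_uminus)

definition minus_cstar_completion :: "'a cstar_completion \<Rightarrow> 'a cstar_completion \<Rightarrow> 'a cstar_completion"
  where "minus_cstar_completion x y = x + - y"

lift_definition times_cstar_completion :: "'a cstar_completion \<Rightarrow> 'a cstar_completion \<Rightarrow> 'a cstar_completion"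
  is "\<lambda>X Y n. X n * Y n"
  by (rule completion_rel_mult)

lift_definition scaleC_cstar_completion :: "complex \<Rightarrow> 'a cstar_completion \<Rightarrow> 'a cstar_completion"
  is "\<lambda>c X n. c *\<^sub>C X n"
  by (rule completion_rel_scaleC)

definition scaleR_cstar_completion :: "real \<Rightarrow> 'a cstar_completion \<Rightarrow> 'a cstar_completion"
  where "scaleR_cstar_completion r x = complex_of_real r *\<^sub>C x"

lift_definition star_cstar_completion :: "'a cstar_completion \<Rightarrow> 'a cstar_completion"
  is "\<lambda>X n. star (X n)"
  by (rule completion_rel_star)

instance
proof
  fix x y z :: "'a cstar_completion" and c d :: complex and r :: real
  show "x + y + z = x + (y + z)"
    by transfer (simp only: add.assoc, intro completion_rel_intros)
  show "x + y = y + x"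
    by transfer (subst add.commute, intro completion_rel_intros)
  show "0 + x = x"
    by transfer simp
  show "- x + x = 0"
    by transfer (simp add: completion_rel_const)
  show "x - y = x + - y" by (simp add: minus_cstar_completion_def)
  show "c *\<^sub>C (x + y) = c *\<^sub>C x + c *\<^sub>C y"
    by transfer (simp only: scaleC_add_right, intro completion_rel_intros)
  show "(c + d) *\<^sub>C x = c *\<^sub>C x + d *\<^sub>C x"
    by transfer (simp only: scaleC_add_left, intro completion_rel_intros)
  show "c *\<^sub>C d *\<^sub>C x = (c * d) *\<^sub>C x"
    by transfer (simp only: scaleC_scaleC, intro completion_rel_intros)
  show "1 *\<^sub>C x = x"
    by transfer simp
  show "r *\<^sub>R x = complex_of_real r *\<^sub>C x" by (simp add: scaleR_cstar_completion_def)
  show "x * y * z = x * (y * z)"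
    by transfer (simp only: mult.assoc, intro completion_rel_intros)
  show "(x + y) * z = x * z + y * z"
    by transfer (simp only: distrib_right, intro completion_rel_intros)
  show "x * (y + z) = x * y + x * z"
    by transfer (simp only: distrib_left, intro completion_rel_intros)
  show "1 * x = x"
    by transfer simp
  show "x * 1 = x"
    by transfer simp
  show "star (star x) = x"
    by transfer simp
  show "c *\<^sub>C x * y = c *\<^sub>C (x * y)"
    by transfer (simp only: scaleC_mult_left, intro completion_rel_intros)
  show "x * c *\<^sub>C y = c *\<^sub>C (x * y)"
    by transfer (simp only: scaleC_mult_right, intro completion_rel_intros)
  show "star (x + y) = star x + star y"
    by transfer (simp only: star_add, intro completion_rel_intros)
  show "star (c *\<^sub>C x) = cnj c *\<^sub>C star x"
    by transfer (simp only: star_scaleC, intro completion_rel_intros)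
  show "star (x * y) = star y * star x"
    by transfer (simp only: star_mult, intro completion_rel_intros)
qed

end

instantiation cstar_completion :: (cstar_seminormed) real_normed_algebra
begin

lift_definition norm_cstar_completion :: "'a cstar_completion \<Rightarrow> real"
  is "\<lambda>X. lim (\<lambda>n. snorm (X n))"
proof -
  fix X Y :: "nat \<Rightarrow> 'a" assume r: "completion_rel X Y"
  have X: "(\<lambda>n. snorm (X n)) \<longlonglongrightarrow> lim (\<lambda>n. snorm (X n))"
    using r by (simp add: completion_rel_def snorm_Cauchy_convergent convergent_LIMSEQ_iff[symmetric])
  have "(\<lambda>n. snorm (X n) - snorm (Y n)) \<longlonglongrightarrow> 0"
  proof (rule Lim_null_comparison)
    show "\<forall>\<^sub>F n in sequentially. norm (snorm (X n) - snorm (Y n)) \<le> snorm (X n - Y n)"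
      by (simp add: snormD)
    show "(\<lambda>n. snorm (X n - Y n)) \<longlonglongrightarrow> 0" using r by (simp add: completion_rel_def)
  qed
  from tendsto_diff[OF X this] have "(\<lambda>n. snorm (Y n)) \<longlonglongrightarrow> lim (\<lambda>n. snorm (X n))" by simp
  then show "lim (\<lambda>n. snorm (X n)) = lim (\<lambda>n. snorm (Y n))" by (simp add: limI)
qed

definition dist_cstar_completion :: "'a cstar_completion \<Rightarrow> 'a cstar_completion \<Rightarrow> real"
  where "dist_cstar_completion x y = norm (x - y)"

definition sgn_cstar_completion :: "'a cstar_completion \<Rightarrow> 'a cstar_completion"
  where "sgn_cstar_completion x = x /\<^sub>R norm x"

definition uniformity_cstar_completion :: "('a cstar_completion \<times> 'a cstar_completion) filter"
  where "uniformity_cstar_completion = (INF e\<in>{0<..}. principal {(x, y). dist x y < e})"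

definition open_cstar_completion :: "'a cstar_completion set \<Rightarrow> bool"
  where "open_cstar_completion U \<longleftrightarrow> (\<forall>x\<in>U. \<forall>\<^sub>F (x', y) in uniformity. x' = x \<longrightarrow> y \<in> U)"

lemma completion_lim:
  assumes "snorm_Cauchy X"
  shows "(\<lambda>n. snorm (X n)) \<longlonglongrightarrow> lim (\<lambda>n. snorm (X n))"
  using snorm_Cauchy_convergent[OF assms] by (simp add: convergent_LIMSEQ_iff)

lemma completion_norm_aux:
  fixes x y :: "'a cstar_completion"
  shows completion_norm_zero: "norm x = 0 \<longleftrightarrow> x = 0"
    and completion_norm_triangle: "norm (x + y) \<le> norm x + norm y"
    and completion_norm_scaleC: "norm (c *\<^sub>C x) = cmod c * norm x"
    and completion_norm_mult: "norm (x * y) \<le> norm x * norm y"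
    and completion_norm_star_mult: "norm (star x * x) = (norm x)\<^sup>2"
proof -
  show "norm x = 0 \<longleftrightarrow> x = 0"
  proof (transfer, goal_cases)
    case (1 X)
    then have X: "snorm_Cauchy X" by (simp add: completion_rel_def)
    have "lim (\<lambda>n. snorm (X n)) = 0 \<longleftrightarrow> (\<lambda>n. snorm (X n)) \<longlonglongrightarrow> 0"
      using completion_lim[OF X] limI by metis
    then show ?case using X by (simp add: completion_rel_def snorm_Cauchy_const)
  qed
  show "norm (x + y) \<le> norm x + norm y"
  proof (transfer, goal_cases)
    case (1 X Y)
    then have X: "snorm_Cauchy X" and Y: "snorm_Cauchy Y" by (simp_all add: completion_rel_def)
    show ?case
      by (rule LIMSEQ_le[OF completion_lim[OF snorm_Cauchy_add[OF X Y]]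
            tendsto_add[OF completion_lim[OF X] completion_lim[OF Y]]]) (simp add: snormD)
  qed
  show "norm (c *\<^sub>C x) = cmod c * norm x"
  proof (transfer, goal_cases)
    case (1 c X)
    then have X: "snorm_Cauchy X" by (simp add: completion_rel_def)
    show ?case using tendsto_mult_left[OF completion_lim[OF X], of "cmod c"] by (simp add: snormD limI)
  qed
  show "norm (x * y) \<le> norm x * norm y"
  proof (transfer, goal_cases)
    case (1 X Y)
    then have X: "snorm_Cauchy X" and Y: "snorm_Cauchy Y" by (simp_all add: completion_rel_def)
    show ?case
      by (rule LIMSEQ_le[OF completion_lim[OF snorm_Cauchy_mult[OF X Y]]
            tendsto_mult[OF completion_lim[OF X] completion_lim[OF Y]]]) (simp add: snormD)
  qed
  show "norm (star x * x) = (norm x)\<^sup>2"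
  proof (transfer, goal_cases)
    case (1 X)
    then have X: "snorm_Cauchy X" by (simp add: completion_rel_def)
    show ?case using tendsto_power[OF completion_lim[OF X], of 2] by (simp add: snormD limI)
  qed
qed

instance
proof
  fix x y :: "'a cstar_completion" and r :: real and U :: "'a cstar_completion set"
  show "dist x y = norm (x - y)" by (rule dist_cstar_completion_def)
  show "sgn x = x /\<^sub>R norm x" by (rule sgn_cstar_completion_def)
  show "uniformity = (INF e\<in>{0<..}. principal {(x, y :: 'a cstar_completion). dist x y < e})"
    by (rule uniformity_cstar_completion_def)
  show "open U = (\<forall>x\<in>U. \<forall>\<^sub>F (x', y) in uniformity. x' = x \<longrightarrow> y \<in> U)"
    by (rule open_cstar_completion_def)
  show "(norm x = 0) = (x = 0)" by (rule completion_norm_zero)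
  show "norm (x + y) \<le> norm x + norm y" by (rule completion_norm_triangle)
  show "norm (r *\<^sub>R x) = \<bar>r\<bar> * norm x" by (simp add: scaleR_scaleC completion_norm_scaleC)
  show "norm (x * y) \<le> norm x * norm y" by (rule completion_norm_mult)
  show "r *\<^sub>R x * y = r *\<^sub>R (x * y)" by (simp add: scaleR_scaleC)
  show "x * r *\<^sub>R y = r *\<^sub>R (x * y)" by (simp add: scaleR_scaleC)
qed

end

lift_definition compl_embed :: "'a::cstar_seminormed \<Rightarrow> 'a cstar_completion" is "\<lambda>x n. x"
  by (rule completion_rel_const)

lemma norm_compl_embed [simp]: "norm (compl_embed x) = snorm x"
  by transfer simp

lemma compl_embed_simps [simp]:
  "compl_embed (x + y) = compl_embed x + compl_embed y" "compl_embed (x * y) = compl_embed x * compl_embed y"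
  "compl_embed (c *\<^sub>C x) = c *\<^sub>C compl_embed x" "compl_embed (star x) = star (compl_embed x)"
  "compl_embed 1 = 1" "compl_embed 0 = 0" "compl_embed (- x) = - compl_embed x"
  by (transfer, rule completion_rel_const)+

lemma compl_embed_diff [simp]: "compl_embed (x - y) = compl_embed x - compl_embed y"
  using compl_embed_simps(1)[of x "- y"] by simp

lemma compl_embed_limit:
  assumes "snorm_Cauchy X"
  shows "\<exists>x. (\<lambda>n. compl_embed (X n)) \<longlonglongrightarrow> x"
proof -
  define x where "x = abs_cstar_completion X"
  have X: "completion_rel X X" by (rule completion_rel_refl[OF assms])
  have "\<exists>N. \<forall>n\<ge>N. norm (compl_embed (X n) - x) < e" if e: "0 < e" for e
  proof -
    obtain N where N: "\<And>m n. m \<ge> N \<Longrightarrow> n \<ge> N \<Longrightarrow> snorm (X m - X n) < e / 2"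
      using assms e unfolding snorm_Cauchy_def by (meson half_gt_zero)
    have "norm (compl_embed (X n) - x) \<le> e / 2" if n: "n \<ge> N" for n
    proof -
      have d: "completion_rel (\<lambda>m. X n + - X m) (\<lambda>m. X n + - X m)"
        using X by (intro completion_rel_intros)
      have "compl_embed (X n) - x = abs_cstar_completion (\<lambda>m. X n + - X m)"
        unfolding x_def minus_cstar_completion_def compl_embed.abs_eq uminus_cstar_completion.abs_eq[OF X]
        using plus_cstar_completion.abs_eq[OF completion_rel_const completion_rel_uminus[OF X]]
        by simp
      then have eq: "norm (compl_embed (X n) - x) = lim (\<lambda>m. snorm (X n + - X m))"
        using norm_cstar_completion.abs_eq[OF d] by simp
      have "(\<lambda>m. snorm (X n + - X m)) \<longlonglongrightarrow> lim (\<lambda>m. snorm (X n + - X m))"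
        using d by (intro completion_lim) (simp add: completion_rel_def)
      then have "lim (\<lambda>m. snorm (X n + - X m)) \<le> e / 2"
        by (rule LIMSEQ_le_const2) (use N[OF n] in \<open>auto intro!: exI[of _ N] less_imp_le\<close>)
      with eq show ?thesis by simp
    qed
    moreover have "e / 2 < e" using e by simp
    ultimately show ?thesis by (meson le_less_trans)
  qed
  then have "(\<lambda>n. compl_embed (X n)) \<longlonglongrightarrow> x" by (simp add: LIMSEQ_iff)
  then show ?thesis by blast
qed

lemma compl_embed_dense: "0 < e \<Longrightarrow> \<exists>x. norm (z - compl_embed x) < e"
proof -
  assume e: "0 < e"
  obtain X where X: "snorm_Cauchy X" and z: "z = abs_cstar_completion X"
    by (metis Quotient_cstar_completion Quotient_rep_reflp completion_rel_def
        Quotient_abs_rep)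
  have Xr: "completion_rel X X" by (rule completion_rel_refl[OF X])
  obtain N where N: "\<And>m n. m \<ge> N \<Longrightarrow> n \<ge> N \<Longrightarrow> snorm (X m - X n) < e / 2"
    using X e unfolding snorm_Cauchy_def by (meson half_gt_zero)
  have d: "completion_rel (\<lambda>m. X m + - X N) (\<lambda>m. X m + - X N)"
    using Xr by (intro completion_rel_intros)
  have "z - compl_embed (X N) = abs_cstar_completion (\<lambda>m. X m + - X N)"
    unfolding z minus_cstar_completion_def compl_embed.abs_eq uminus_cstar_completion.abs_eq[OF completion_rel_const]
    using plus_cstar_completion.abs_eq[OF Xr completion_rel_uminus[OF completion_rel_const]]
    by simp
  then have eq: "norm (z - compl_embed (X N)) = lim (\<lambda>m. snorm (X m + - X N))"
    using norm_cstar_completion.abs_eq[OF d] by simp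
  have "(\<lambda>m. snorm (X m + - X N)) \<longlonglongrightarrow> lim (\<lambda>m. snorm (X m + - X N))"
    using d by (intro completion_lim) (simp add: completion_rel_def)
  then have "lim (\<lambda>m. snorm (X m + - X N)) \<le> e / 2"
    by (rule LIMSEQ_le_const2) (use N in \<open>auto intro!: exI[of _ N] less_imp_le\<close>)
  with eq e have "norm (z - compl_embed (X N)) < e" by simp
  then show ?thesis by blast
qed

instance cstar_completion :: (cstar_seminormed) unital_cstar_algebra
proof
  fix c :: complex and x :: "'a cstar_completion"
  show "norm (c *\<^sub>C x) = cmod c * norm x" by (rule completion_norm_scaleC)
  show "norm (star x * x) = (norm x)\<^sup>2" by (rule completion_norm_star_mult)
next
  fix Z :: "nat \<Rightarrow> 'a cstar_completion" assume Z: "Cauchy Z"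
  have "\<forall>n. \<exists>x. norm (Z n - compl_embed x) < 1 / Suc n" by (intro allI compl_embed_dense) simp
  then obtain X where X: "\<And>n. norm (Z n - compl_embed (X n)) < 1 / Suc n" by metis
  have d0: "(\<lambda>n. Z n - compl_embed (X n)) \<longlonglongrightarrow> 0"
    by (rule Lim_null_comparison[OF _ LIMSEQ_Suc[OF lim_const_over_n[of 1]]])
       (use X in \<open>auto intro!: always_eventually less_imp_le simp: divide_inverse\<close>)
  have "snorm_Cauchy X"
    unfolding snorm_Cauchy_def
  proof (intro allI impI)
    fix e :: real assume "0 < e"
    then have e: "0 < e / 3" by simp
    obtain N where N: "\<And>m n. m \<ge> N \<Longrightarrow> n \<ge> N \<Longrightarrow> norm (Z m - Z n) < e / 3"
      using Z e unfolding Cauchy_def dist_norm by meson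
    obtain M where M: "\<And>n. n \<ge> M \<Longrightarrow> norm (Z n - compl_embed (X n)) < e / 3"
      using d0 e unfolding LIMSEQ_iff by (metis diff_zero)
    have "snorm (X m - X n) < e" if "m \<ge> max N M" "n \<ge> max N M" for m n
    proof -
      have "compl_embed (X m - X n) = (Z m - Z n) - (Z m - compl_embed (X m)) + (Z n - compl_embed (X n))"
        by simp
      then have "snorm (X m - X n) =
          norm ((Z m - Z n) - (Z m - compl_embed (X m)) + (Z n - compl_embed (X n)))"
        by (simp flip: norm_compl_embed)
      also have "\<dots> \<le> norm (Z m - Z n) + norm (Z m - compl_embed (X m)) + norm (Z n - compl_embed (X n))"
        by (intro order_trans[OF norm_triangle_ineq] add_right_mono norm_triangle_ineq4)
      also have "\<dots> < e" using N[of m n] M[of m] M[of n] that by simp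
      finally show ?thesis .
    qed
    then show "\<exists>N. \<forall>m\<ge>N. \<forall>n\<ge>N. snorm (X m - X n) < e" by blast
  qed
  then obtain x where "(\<lambda>n. compl_embed (X n)) \<longlonglongrightarrow> x" using compl_embed_limit by blast
  then have "(\<lambda>n. (Z n - compl_embed (X n)) + compl_embed (X n)) \<longlonglongrightarrow> 0 + x" using d0 by (intro tendsto_add)
  then show "convergent Z" by (auto simp: convergent_def)
qed

lemma second_countableI:
  fixes K :: "'a::metric_space set"
  assumes "countable K" "\<And>x e. 0 < e \<Longrightarrow> \<exists>k\<in>K. dist x k < e"
  shows "\<exists>B::'a set set. countable B \<and> open = generate_topology B"
proof -
  define B where "B = (\<lambda>(k, r). ball k r) ` (K \<times> (\<rat> \<inter> {0<..}))"
  have "countable B" unfolding B_def using assms(1) countable_rat by auto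
  moreover have "topological_basis B"
  proof (rule topological_basisI)
    fix U and x :: 'a assume U: "open U" "x \<in> U"
    then obtain e where e: "0 < e" "ball x e \<subseteq> U" by (auto simp: open_contains_ball)
    obtain k where k: "k \<in> K" "dist x k < e / 4" using assms(2)[of "e / 4" x] e by auto
    obtain r where r: "r \<in> \<rat>" "e / 4 < r" "r < e / 2" using Rats_dense_in_real[of "e / 4" "e / 2"] e by auto
    have "ball k r \<subseteq> ball x e"
    proof
      fix y assume "y \<in> ball k r"
      then show "y \<in> ball x e" using dist_triangle[of x y k] k r e by simp
    qed
    moreover have "x \<in> ball k r" using k r by (simp add: dist_commute)
    moreover have "ball k r \<in> B" unfolding B_def using k r e by force
    ultimately show "\<exists>B'\<in>B. x \<in> B' \<and> B' \<subseteq> U" using e by blast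
  qed (auto simp: B_def)
  ultimately show ?thesis using topological_basis_imp_subbasis by blast
qed

lemma second_countable_dense:
  "\<exists>K::'a::{metric_space, second_countable_topology} set.
     countable K \<and> (\<forall>x e. 0 < e \<longrightarrow> (\<exists>k\<in>K. dist x k < e))"
proof -
  obtain K :: "'a set" where K: "countable K" "\<And>X. open X \<Longrightarrow> X \<noteq> {} \<Longrightarrow> \<exists>d\<in>K. d \<in> X"
    using countable_dense_setE by blast
  have "\<exists>k\<in>K. dist x k < e" if "0 < e" for x e
    using K(2)[of "ball x e"] that by auto
  with K(1) show ?thesis by blast
qed

instance cstar_completion :: (separable_cstar_seminormed) second_countable_topology
proof
  obtain K :: "'a set" where K: "countable K" "\<And>x e. 0 < e \<Longrightarrow> \<exists>k\<in>K. snorm (x - k) < e"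
    using countable_dense_snorm by blast
  show "\<exists>B::'a cstar_completion set set. countable B \<and> open = generate_topology B"
  proof (rule second_countableI)
    show "countable (compl_embed ` K)" using K(1) by simp
    fix z :: "'a cstar_completion" and e :: real assume "0 < e"
    then have e: "0 < e / 2" by simp
    obtain x where x: "norm (z - compl_embed x) < e / 2" using compl_embed_dense[OF e] by blast
    obtain k where k: "k \<in> K" "snorm (x - k) < e / 2" using K(2)[OF e] by blast
    have "norm (z - compl_embed k) \<le> norm (z - compl_embed x) + snorm (x - k)"
      using norm_triangle_ineq[of "z - compl_embed x" "compl_embed (x - k)"]
      unfolding norm_compl_embed by simp
    then show "\<exists>k\<in>compl_embed ` K. dist z k < e" using x k by (auto simp: dist_norm intro!: bexI[of _ k])
  qed
qed

section \<open>The Hilbert space of square-summable families\<close>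

typedef 'i ell2 = "{x :: 'i \<Rightarrow> complex. (\<lambda>i. (cmod (x i))\<^sup>2) summable_on UNIV}"
  morphisms coord Abs_ell2
  by (rule exI[of _ "\<lambda>i. 0"]) simp

setup_lifting type_definition_ell2

lemma coord_summable: "(\<lambda>i. (cmod (coord x i))\<^sup>2) summable_on UNIV"
  using coord[of x] by simp

lemma square_summable_product:
  assumes "(\<lambda>i. (cmod (x i))\<^sup>2) summable_on UNIV" "(\<lambda>i. (cmod (y i))\<^sup>2) summable_on UNIV"
  shows "(\<lambda>i. cmod (x i * y i)) summable_on UNIV"
proof (rule summable_on_comparison_test)
  show "(\<lambda>i. (cmod (x i))\<^sup>2 + (cmod (y i))\<^sup>2) summable_on UNIV"
    by (intro summable_on_add assms)
  fix i
  have "2 * (cmod (x i) * cmod (y i)) \<le> (cmod (x i))\<^sup>2 + (cmod (y i))\<^sup>2"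
    using sum_squares_bound[of "cmod (x i)" "cmod (y i)"] by simp
  moreover have "0 \<le> cmod (x i) * cmod (y i)" by simp
  ultimately show "norm (x i * y i) \<le> (cmod (x i))\<^sup>2 + (cmod (y i))\<^sup>2"
    unfolding norm_mult by linarith
qed auto

lemma square_summable_add:
  assumes "(\<lambda>i. (cmod (x i))\<^sup>2) summable_on UNIV" "(\<lambda>i. (cmod (y i))\<^sup>2) summable_on UNIV"
  shows "(\<lambda>i. (cmod (x i + y i))\<^sup>2) summable_on UNIV"
proof (rule summable_on_comparison_test)
  show "(\<lambda>i. 2 * (cmod (x i))\<^sup>2 + 2 * (cmod (y i))\<^sup>2) summable_on UNIV"
    by (intro summable_on_add summable_on_cmult_right assms)
  fix i
  have "(cmod (x i + y i))\<^sup>2 \<le> (cmod (x i) + cmod (y i))\<^sup>2"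
    by (intro power_mono norm_triangle_ineq) simp
  also have "\<dots> \<le> 2 * (cmod (x i))\<^sup>2 + 2 * (cmod (y i))\<^sup>2"
    using sum_squares_bound[of "cmod (x i)" "cmod (y i)"] by (simp add: power2_sum)
  finally show "(cmod (x i + y i))\<^sup>2 \<le> 2 * (cmod (x i))\<^sup>2 + 2 * (cmod (y i))\<^sup>2" .
qed auto

lemma square_summable_scale:
  assumes "(\<lambda>i. (cmod (x i))\<^sup>2) summable_on UNIV"
  shows "(\<lambda>i. (cmod (c * x i))\<^sup>2) summable_on UNIV"
  using assms by (simp add: norm_mult power_mult_distrib summable_on_cmult_right)

instantiation ell2 :: (type) complex_vector
begin

lift_definition zero_ell2 :: "'a ell2" is "\<lambda>i. 0" by simp
lift_definition plus_ell2 :: "'a ell2 \<Rightarrow> 'a ell2 \<Rightarrow> 'a ell2" is "\<lambda>x y i. x i + y i"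
  by (rule square_summable_add)
lift_definition uminus_ell2 :: "'a ell2 \<Rightarrow> 'a ell2" is "\<lambda>x i. - x i" by simp
lift_definition minus_ell2 :: "'a ell2 \<Rightarrow> 'a ell2 \<Rightarrow> 'a ell2" is "\<lambda>x y i. x i - y i"
  subgoal for x y using square_summable_add[of x "\<lambda>i. - y i"] by simp
  done
lift_definition scaleC_ell2 :: "complex \<Rightarrow> 'a ell2 \<Rightarrow> 'a ell2" is "\<lambda>c x i. c * x i"
  by (rule square_summable_scale)
definition scaleR_ell2 :: "real \<Rightarrow> 'a ell2 \<Rightarrow> 'a ell2"
  where "scaleR_ell2 r x = complex_of_real r *\<^sub>C x"

instance
proof
  show "r *\<^sub>R x = complex_of_real r *\<^sub>C x" for r and x :: "'a ell2" by (rule scaleR_ell2_def)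
qed (transfer, simp add: fun_eq_iff algebra_simps)+

end

lemma coord_simps [simp]:
  "coord (x + y) i = coord x i + coord y i" "coord (x - y) i = coord x i - coord y i"
  "coord (- x) i = - coord x i" "coord 0 i = 0" "coord (c *\<^sub>C x) i = c * coord x i"
  "coord (r *\<^sub>R x) i = complex_of_real r * coord x i"
  unfolding scaleR_ell2_def by (transfer, simp)+

lemma ell2_eqI: "(\<And>i. coord x i = coord y i) \<Longrightarrow> x = y"
  by transfer auto

text \<open>Inner product, linear in the second argument.\<close>

definition cinner :: "'i ell2 \<Rightarrow> 'i ell2 \<Rightarrow> complex" where
  "cinner x y = (\<Sum>\<^sub>\<infinity>i. cnj (coord x i) * coord y i)"

lemma cinner_abs_summable: "(\<lambda>i. cmod (cnj (coord x i) * coord y i)) summable_on UNIV"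
  by (rule square_summable_product) (simp_all add: coord_summable)

lemma cinner_summable: "(\<lambda>i. cnj (coord x i) * coord y i) summable_on UNIV"
  by (rule abs_summable_summable[OF cinner_abs_summable])

lemma cinner_add_right: "cinner x (y + z) = cinner x y + cinner x z"
  unfolding cinner_def coord_simps distrib_left by (intro infsum_add cinner_summable)

lemma cinner_scaleC_right: "cinner x (c *\<^sub>C y) = c * cinner x y"
  unfolding cinner_def coord_simps
  by (subst infsum_cmult_right'[symmetric]) (simp add: algebra_simps)

lemma cinner_commute: "cinner x y = cnj (cinner y x)"
  unfolding cinner_def by (subst infsum_cnj[symmetric]) (simp add: mult.commute)

lemma cinner_add_left: "cinner (x + y) z = cinner x z + cinner y z"
  by (metis cinner_commute cinner_add_right complex_cnj_add)

lemma cinner_scaleC_left: "cinner (c *\<^sub>C x) y = cnj c * cinner x y"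
  by (metis cinner_commute cinner_scaleC_right complex_cnj_mult)

lemma cinner_self: "cinner x x = complex_of_real (\<Sum>\<^sub>\<infinity>i. (cmod (coord x i))\<^sup>2)"
proof -
  have "cinner x x = (\<Sum>\<^sub>\<infinity>i. complex_of_real ((cmod (coord x i))\<^sup>2))"
    unfolding cinner_def complex_norm_square by (simp add: mult.commute)
  also have "\<dots> = complex_of_real (\<Sum>\<^sub>\<infinity>i. (cmod (coord x i))\<^sup>2)"
    by (intro infsumI has_sum_of_real has_sum_infsum coord_summable)
  finally show ?thesis .
qed

instantiation ell2 :: (type) real_inner
begin

definition inner_ell2 :: "'a ell2 \<Rightarrow> 'a ell2 \<Rightarrow> real" where "inner_ell2 x y = Re (cinner x y)"
definition norm_ell2 :: "'a ell2 \<Rightarrow> real" where "norm_ell2 x = sqrt (inner x x)"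
definition dist_ell2 :: "'a ell2 \<Rightarrow> 'a ell2 \<Rightarrow> real" where "dist_ell2 x y = norm (x - y)"
definition sgn_ell2 :: "'a ell2 \<Rightarrow> 'a ell2" where "sgn_ell2 x = x /\<^sub>R norm x"
definition uniformity_ell2 :: "('a ell2 \<times> 'a ell2) filter"
  where "uniformity_ell2 = (INF e\<in>{0<..}. principal {(x, y). dist x y < e})"
definition open_ell2 :: "'a ell2 set \<Rightarrow> bool"
  where "open_ell2 U \<longleftrightarrow> (\<forall>x\<in>U. \<forall>\<^sub>F (x', y) in uniformity. x' = x \<longrightarrow> y \<in> U)"

instance
proof
  fix x y z :: "'a ell2" and r :: real and U :: "'a ell2 set"
  show "dist x y = norm (x - y)" by (rule dist_ell2_def)
  show "sgn x = x /\<^sub>R norm x" by (rule sgn_ell2_def)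
  show "uniformity = (INF e\<in>{0<..}. principal {(x, y :: 'a ell2). dist x y < e})"
    by (rule uniformity_ell2_def)
  show "open U = (\<forall>x\<in>U. \<forall>\<^sub>F (x', y) in uniformity. x' = x \<longrightarrow> y \<in> U)"
    by (rule open_ell2_def)
  show "inner x y = inner y x"
    unfolding inner_ell2_def by (subst cinner_commute) simp
  show "inner (x + y) z = inner x z + inner y z" by (simp add: inner_ell2_def cinner_add_left)
  show "inner (r *\<^sub>R x) y = r * inner x y"
    by (simp add: inner_ell2_def scaleR_ell2_def cinner_scaleC_left)
  show "0 \<le> inner x x" by (simp add: inner_ell2_def cinner_self infsum_nonneg)
  show "norm x = sqrt (inner x x)" by (rule norm_ell2_def)
  show "(inner x x = 0) = (x = 0)"
  proof
    assume "inner x x = 0"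
    then have 0: "(\<Sum>\<^sub>\<infinity>i. (cmod (coord x i))\<^sup>2) = 0" by (simp add: inner_ell2_def cinner_self)
    have "(cmod (coord x i))\<^sup>2 = 0" for i
      by (rule nonneg_infsum_le_0D[of _ UNIV]) (simp_all add: 0 coord_summable)
    then show "x = 0" by (intro ell2_eqI) simp
  qed (simp add: inner_ell2_def cinner_self)
qed

end

lemma norm_ell2_square: "(norm x)\<^sup>2 = (\<Sum>\<^sub>\<infinity>i. (cmod (coord x i))\<^sup>2)"
  by (simp add: power2_norm_eq_inner inner_ell2_def cinner_self)

lemma cinner_norm: "cinner x x = complex_of_real ((norm x)\<^sup>2)"
  by (simp add: norm_ell2_square cinner_self)

lemma norm_scaleC_ell2: "norm (c *\<^sub>C (x::'i ell2)) = cmod c * norm x"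
proof -
  have "(norm (c *\<^sub>C x))\<^sup>2 = (cmod c * norm x)\<^sup>2"
    by (simp add: norm_ell2_square norm_mult power_mult_distrib infsum_cmult_right')
  then show ?thesis by (simp add: power2_eq_iff_nonneg)
qed

lemma Re_cinner_le: "Re (cinner x y) \<le> norm x * norm y"
  using norm_cauchy_schwarz[of x y] by (simp add: inner_ell2_def)

lemma cinner_eqI: "(\<And>z. cinner z x = cinner z y) \<Longrightarrow> x = y"
proof -
  assume *: "\<And>z. cinner z x = cinner z y"
  have "inner z x = inner z y" for z by (simp add: inner_ell2_def *)
  then show ?thesis by (metis inner_commute vector_eq_rdot)
qed

lift_definition ell2_tensor :: "'i ell2 \<Rightarrow> 'j ell2 \<Rightarrow> ('i \<times> 'j) ell2"
  is "\<lambda>x y (i, j). x i * y j"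
proof -
  fix x :: "'i \<Rightarrow> complex" and y :: "'j \<Rightarrow> complex"
  assume x: "(\<lambda>i. (cmod (x i))\<^sup>2) summable_on UNIV" and y: "(\<lambda>i. (cmod (y i))\<^sup>2) summable_on UNIV"
  have "(\<lambda>p. (cmod (case p of (i, j) \<Rightarrow> x i * y j))\<^sup>2) summable_on (SIGMA i:UNIV. UNIV)"
  proof (rule summable_on_SigmaI)
    show "((\<lambda>j. (cmod (case (i, j) of (i, j) \<Rightarrow> x i * y j))\<^sup>2) has_sum
        (cmod (x i))\<^sup>2 * (\<Sum>\<^sub>\<infinity>j. (cmod (y j))\<^sup>2)) UNIV" for i
      by (simp add: norm_mult power_mult_distrib has_sum_cmult_right y)
    show "(\<lambda>i. (cmod (x i))\<^sup>2 * (\<Sum>\<^sub>\<infinity>j. (cmod (y j))\<^sup>2)) summable_on UNIV"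
      by (intro summable_on_cmult_left x)
  qed simp
  then show "(\<lambda>p. (cmod (case p of (i, j) \<Rightarrow> x i * y j))\<^sup>2) summable_on UNIV" by simp
qed

definition ell2_unit :: "'i \<Rightarrow> 'i ell2" where
  "ell2_unit i = Abs_ell2 (\<lambda>k. if k = i then 1 else 0)"

lemma coord_ell2_unit: "coord (ell2_unit i) k = (if k = i then 1 else 0)"
proof -
  have "(\<lambda>k. (cmod (if k = i then 1 else 0))\<^sup>2) summable_on UNIV"
    by (rule summable_on_cong_neutral[THEN iffD1, of _ "{i}" _ "\<lambda>_. 1"]) auto
  then show ?thesis unfolding ell2_unit_def by (subst Abs_ell2_inverse) auto
qed

lemma cinner_ell2_unit: "cinner (ell2_unit i) x = coord x i"
proof -
  have "cinner (ell2_unit i) x = (\<Sum>\<^sub>\<infinity>k\<in>{i}. coord x i)"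
    unfolding cinner_def by (rule infsum_cong_neutral) (auto simp: coord_ell2_unit)
  then show ?thesis by simp
qed

subsection \<open>Tensor product of operators\<close>

lift_definition ell2_row :: "('i \<times> 'j) ell2 \<Rightarrow> 'i \<Rightarrow> 'j ell2" is "\<lambda>z i j. z (i, j)"
proof -
  fix z :: "'i \<times> 'j \<Rightarrow> complex" and i assume "(\<lambda>p. (cmod (z p))\<^sup>2) summable_on UNIV"
  then have "(\<lambda>p. norm ((cmod (z p))\<^sup>2)) summable_on UNIV \<times> UNIV" by simp
  then show "(\<lambda>j. (cmod (z (i, j)))\<^sup>2) summable_on UNIV"
    unfolding Infinite_Sum.abs_summable_on_Sigma_iff by simp
qed

lift_definition ell2_swap :: "('i \<times> 'j) ell2 \<Rightarrow> ('j \<times> 'i) ell2" is "\<lambda>z (j, i). z (i, j)"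
proof -
  fix z :: "'i \<times> 'j \<Rightarrow> complex" assume "(\<lambda>p. (cmod (z p))\<^sup>2) summable_on UNIV"
  then show "(\<lambda>p. (cmod (case p of (j, i) \<Rightarrow> z (i, j)))\<^sup>2) summable_on UNIV"
    using summable_on_reindex_bij_betw[of prod.swap UNIV UNIV "\<lambda>p. (cmod (z p))\<^sup>2"]
    by (simp add: case_prod_beta prod.swap_def)
qed

text \<open>\<open>1 \<otimes> S\<close> acts on the rows of \<open>z\<close>, and \<open>T \<otimes> 1\<close> on its columns.\<close>

definition amp_right :: "('j ell2 \<Rightarrow> 'j ell2) \<Rightarrow> ('i \<times> 'j) ell2 \<Rightarrow> ('i \<times> 'j) ell2" where
  "amp_right S z = Abs_ell2 (\<lambda>(i, j). coord (S (ell2_row z i)) j)"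

definition amp_left :: "('i ell2 \<Rightarrow> 'i ell2) \<Rightarrow> ('i \<times> 'j) ell2 \<Rightarrow> ('i \<times> 'j) ell2" where
  "amp_left T z = ell2_swap (amp_right T (ell2_swap z))"

definition op_tensor :: "('i ell2 \<Rightarrow> 'i ell2) \<Rightarrow> ('j ell2 \<Rightarrow> 'j ell2) \<Rightarrow> ('i \<times> 'j) ell2 \<Rightarrow> ('i \<times> 'j) ell2" where
  "op_tensor T S z = amp_left T (amp_right S z)"

definition bounded_clinear :: "('i ell2 \<Rightarrow> 'j ell2) \<Rightarrow> bool" where
  "bounded_clinear T \<longleftrightarrow> bounded_linear T \<and> (\<forall>c x. T (c *\<^sub>C x) = c *\<^sub>C T x)"

lemma coord_row [simp]: "coord (ell2_row z i) j = coord z (i, j)"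
  by transfer simp

lemma coord_swap [simp]: "coord (ell2_swap z) (j, i) = coord z (i, j)"
  by transfer simp

lemma coord_tensor [simp]: "coord (ell2_tensor x y) (i, j) = coord x i * coord y j"
  by transfer simp

lemma coord_tensor_prod: "coord (ell2_tensor x y) p = coord x (fst p) * coord y (snd p)"
  by (cases p) simp

lemma ell2_pair_eqI: "(\<And>i j. coord x (i, j) = coord y (i, j)) \<Longrightarrow> x = y"
  by (rule ell2_eqI) auto

lemma swap_swap [simp]: "ell2_swap (ell2_swap z) = z"
  by (rule ell2_pair_eqI) simp

lemma row_linear:
  "ell2_row (x + y) i = ell2_row x i + ell2_row y i"
  "ell2_row (c *\<^sub>C x) i = c *\<^sub>C ell2_row x i"
  "ell2_row (r *\<^sub>R x) i = r *\<^sub>R ell2_row x i"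
  by (auto intro: ell2_eqI)

lemma swap_linear:
  "ell2_swap (x + y) = ell2_swap x + ell2_swap y"
  "ell2_swap (c *\<^sub>C x) = c *\<^sub>C ell2_swap x"
  "ell2_swap (r *\<^sub>R x) = r *\<^sub>R ell2_swap x"
  by (auto intro: ell2_pair_eqI)

lemma cinner_swap: "cinner (ell2_swap x) (ell2_swap y) = cinner x y"
  unfolding cinner_def
  using infsum_reindex_bij_betw[of prod.swap UNIV UNIV "\<lambda>p. cnj (coord x p) * coord y p"]
  by (simp add: prod.swap_def split_beta' flip: coord_swap)

lemma norm_swap [simp]: "norm (ell2_swap x) = norm x"
  by (simp add: norm_eq_sqrt_inner inner_ell2_def cinner_swap)

lemma cinner_rows: "cinner z w = (\<Sum>\<^sub>\<infinity>i. cinner (ell2_row z i) (ell2_row w i))"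
  unfolding cinner_def
  using infsum_Sigma_banach[of "\<lambda>p. cnj (coord z p) * coord w p" UNIV "\<lambda>_. UNIV"] cinner_summable[of z w]
  by simp

lemma norm_rows:
  "(\<lambda>i. (norm (ell2_row z i))\<^sup>2) summable_on UNIV" "(norm z)\<^sup>2 = (\<Sum>\<^sub>\<infinity>i. (norm (ell2_row z i))\<^sup>2)"
proof -
  have "(\<lambda>p. norm ((cmod (coord z p))\<^sup>2)) summable_on UNIV \<times> UNIV"
    using coord_summable[of z] by simp
  then show "(\<lambda>i. (norm (ell2_row z i))\<^sup>2) summable_on UNIV"
    unfolding Infinite_Sum.abs_summable_on_Sigma_iff norm_ell2_square by (simp add: infsum_nonneg)
  show "(norm z)\<^sup>2 = (\<Sum>\<^sub>\<infinity>i. (norm (ell2_row z i))\<^sup>2)"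
    unfolding norm_ell2_square
    using infsum_Sigma_banach[of "\<lambda>p. (cmod (coord z p))\<^sup>2" UNIV "\<lambda>_. UNIV"] coord_summable[of z]
    by simp
qed

lemma bounded_clinearD:
  assumes "bounded_clinear T"
  shows "bounded_linear T" "T (x + y) = T x + T y" "T (c *\<^sub>C x) = c *\<^sub>C T x"
    "T (r *\<^sub>R x) = r *\<^sub>R T x" "norm (T x) \<le> onorm T * norm x" "0 \<le> onorm T"
  using assms onorm_pos_le unfolding bounded_clinear_def
  by (auto simp: linear_simps onorm)

lemma coord_amp_right:
  assumes S: "bounded_clinear S"
  shows "coord (amp_right S z) (i, j) = coord (S (ell2_row z i)) j"
proof -
  define w where "w = (\<lambda>(i, j). (cmod (coord (S (ell2_row z i)) j))\<^sup>2)"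
  have "(\<lambda>i. (norm (S (ell2_row z i)))\<^sup>2) summable_on UNIV"
  proof (rule summable_on_comparison_test)
    show "(\<lambda>i. (onorm S)\<^sup>2 * (norm (ell2_row z i))\<^sup>2) summable_on UNIV"
      by (intro summable_on_cmult_right norm_rows)
    show "(norm (S (ell2_row z i)))\<^sup>2 \<le> (onorm S)\<^sup>2 * (norm (ell2_row z i))\<^sup>2" for i
      using power_mono[OF bounded_clinearD(5)[OF S, of "ell2_row z i"], of 2]
      by (simp add: power_mult_distrib)
  qed simp
  then have "(\<lambda>p. norm (w p)) summable_on UNIV \<times> UNIV"
    unfolding Infinite_Sum.abs_summable_on_Sigma_iff w_def norm_ell2_square
    by (simp add: coord_summable infsum_nonneg)
  then have "(\<lambda>p. (cmod (case p of (i, j) \<Rightarrow> coord (S (ell2_row z i)) j))\<^sup>2) summable_on UNIV"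
    by (simp add: w_def case_prod_beta)
  then show ?thesis unfolding amp_right_def by (subst Abs_ell2_inverse) auto
qed

lemma row_amp_right:
  "bounded_clinear S \<Longrightarrow> ell2_row (amp_right S z) i = S (ell2_row z i)"
  by (rule ell2_eqI) (simp add: coord_amp_right)

lemma norm_amp_right:
  assumes S: "bounded_clinear S"
  shows "norm (amp_right S z) \<le> onorm S * norm z"
proof (rule power2_le_imp_le)
  have "(norm (amp_right S z))\<^sup>2 = (\<Sum>\<^sub>\<infinity>i. (norm (S (ell2_row z i)))\<^sup>2)"
    by (simp add: norm_rows row_amp_right[OF S])
  also have "\<dots> \<le> (\<Sum>\<^sub>\<infinity>i. (onorm S)\<^sup>2 * (norm (ell2_row z i))\<^sup>2)"
  proof (rule infsum_mono)
    show "(\<lambda>i. (norm (S (ell2_row z i)))\<^sup>2) summable_on UNIV"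
      using norm_rows(1)[of "amp_right S z"] by (simp add: row_amp_right[OF S])
    show "(\<lambda>i. (onorm S)\<^sup>2 * (norm (ell2_row z i))\<^sup>2) summable_on UNIV"
      by (intro summable_on_cmult_right norm_rows)
    show "(norm (S (ell2_row z i)))\<^sup>2 \<le> (onorm S)\<^sup>2 * (norm (ell2_row z i))\<^sup>2" for i
      using power_mono[OF bounded_clinearD(5)[OF S, of "ell2_row z i"], of 2]
      by (simp add: power_mult_distrib)
  qed
  also have "\<dots> = (onorm S * norm z)\<^sup>2"
    by (simp add: infsum_cmult_right' norm_rows(2)[of z] power_mult_distrib)
  finally show "(norm (amp_right S z))\<^sup>2 \<le> (onorm S * norm z)\<^sup>2" .
  show "0 \<le> onorm S * norm z" using bounded_clinearD[OF S] by simp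
qed

lemma bounded_clinear_amp_right:
  assumes S: "bounded_clinear S"
  shows "bounded_clinear (amp_right S)"
  unfolding bounded_clinear_def
proof
  show "bounded_linear (amp_right S)"
    by (rule bounded_linear_intro[of _ "onorm S"])
       (auto intro!: ell2_pair_eqI simp: coord_amp_right[OF S] row_linear bounded_clinearD[OF S]
         norm_amp_right[OF S] mult.commute)
  show "\<forall>c x. amp_right S (c *\<^sub>C x) = c *\<^sub>C amp_right S x"
    by (auto intro!: ell2_pair_eqI simp: coord_amp_right[OF S] row_linear bounded_clinearD[OF S])
qed

lemma coord_amp_left:
  "bounded_clinear T \<Longrightarrow> coord (amp_left T z) (i, j) = coord (T (ell2_row (ell2_swap z) j)) i"
  by (simp add: amp_left_def coord_amp_right)

lemma norm_amp_left: "bounded_clinear T \<Longrightarrow> norm (amp_left T z) \<le> onorm T * norm z"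
  using norm_amp_right[of T "ell2_swap z"] by (simp add: amp_left_def)

lemma bounded_clinear_amp_left:
  assumes T: "bounded_clinear T"
  shows "bounded_clinear (amp_left T)"
  unfolding bounded_clinear_def
proof
  note A = bounded_clinearD[OF bounded_clinear_amp_right[OF T]]
  show "bounded_linear (amp_left T)"
    by (rule bounded_linear_intro[of _ "onorm T"])
       (simp_all add: norm_amp_left[OF T] mult.commute, simp_all add: amp_left_def swap_linear A)
  show "\<forall>c x. amp_left T (c *\<^sub>C x) = c *\<^sub>C amp_left T x"
    by (simp add: amp_left_def swap_linear A)
qed

definition adjoint_pair :: "('i ell2 \<Rightarrow> 'i ell2) \<Rightarrow> ('i ell2 \<Rightarrow> 'i ell2) \<Rightarrow> bool" where
  "adjoint_pair T T' \<longleftrightarrow> (\<forall>x y. cinner (T' x) y = cinner x (T y))"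

lemma adjoint_pair_amp_right:
  assumes "bounded_clinear S" "bounded_clinear S'" "adjoint_pair S S'"
  shows "adjoint_pair (amp_right S) (amp_right S')"
  using assms by (simp add: adjoint_pair_def cinner_rows[of "amp_right S' _"] cinner_rows[of _ "amp_right S _"] row_amp_right)

lemma adjoint_pair_amp_left:
  assumes "bounded_clinear T" "bounded_clinear T'" "adjoint_pair T T'"
  shows "adjoint_pair (amp_left T) (amp_left T')"
  using adjoint_pair_amp_right[OF assms] unfolding adjoint_pair_def amp_left_def
  by (metis cinner_swap swap_swap)

lemma amp_commute:
  assumes T: "bounded_clinear T" "adjoint_pair T T'" and S: "bounded_clinear S" "adjoint_pair S S'"
  shows "amp_left T (amp_right S z) = amp_right S (amp_left T z)"
proof (rule ell2_pair_eqI)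
  fix i j
  define t s where "t = T' (ell2_unit i)" and "s = S' (ell2_unit j)"
  have t: "coord (T x) i = cinner t x" for x
    using T(2) unfolding t_def adjoint_pair_def cinner_ell2_unit[symmetric] by simp
  have s: "coord (S x) j = cinner s x" for x
    using S(2) unfolding s_def adjoint_pair_def cinner_ell2_unit[symmetric] by simp
  have "(\<lambda>(k, l). cnj (coord (ell2_tensor t s) (k, l)) * coord z (k, l)) summable_on UNIV \<times> UNIV"
    using cinner_summable[of "ell2_tensor t s" z] by (simp add: case_prod_unfold coord_tensor_prod)
  then have sm: "(\<lambda>(k, l). cnj (coord t k) * (cnj (coord s l) * coord z (k, l))) summable_on UNIV \<times> UNIV"
    by (simp add: mult.assoc)
  have "coord (amp_left T (amp_right S z)) (i, j) =
      (\<Sum>\<^sub>\<infinity>k. \<Sum>\<^sub>\<infinity>l. cnj (coord t k) * (cnj (coord s l) * coord z (k, l)))"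
    by (simp add: coord_amp_left[OF T(1)] t cinner_def coord_amp_right[OF S(1)] s infsum_cmult_right')
  also have "\<dots> = (\<Sum>\<^sub>\<infinity>l. \<Sum>\<^sub>\<infinity>k. cnj (coord t k) * (cnj (coord s l) * coord z (k, l)))"
    by (rule infsum_swap_banach[OF sm])
  also have "\<dots> = (\<Sum>\<^sub>\<infinity>l. cnj (coord s l) * (\<Sum>\<^sub>\<infinity>k. cnj (coord t k) * coord z (k, l)))"
    by (intro infsum_cong, subst infsum_cmult_right'[symmetric]) (simp add: ac_simps)
  also have "\<dots> = coord (amp_right S (amp_left T z)) (i, j)"
    by (simp add: coord_amp_right[OF S(1)] s cinner_def coord_amp_left[OF T(1)] t)
  finally show "coord (amp_left T (amp_right S z)) (i, j) = coord (amp_right S (amp_left T z)) (i, j)" .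
qed

lemma op_tensor_tensor:
  assumes T: "bounded_clinear T" and S: "bounded_clinear S"
  shows "op_tensor T S (ell2_tensor x y) = ell2_tensor (T x) (S y)"
proof (rule ell2_pair_eqI)
  fix i j
  have r: "ell2_row (ell2_tensor x y) k = coord x k *\<^sub>C y" for k by (rule ell2_eqI) simp
  have c: "ell2_row (ell2_swap (amp_right S (ell2_tensor x y))) j = coord (S y) j *\<^sub>C x"
    by (rule ell2_eqI) (simp add: coord_amp_right[OF S] r bounded_clinearD[OF S])
  show "coord (op_tensor T S (ell2_tensor x y)) (i, j) = coord (ell2_tensor (T x) (S y)) (i, j)"
    by (simp add: op_tensor_def coord_amp_left[OF T] c bounded_clinearD[OF T])
qed

section \<open>Representations on square-summable families\<close>

text \<open>Representations need not be unital or nondegenerate.\<close>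

definition star_rep :: "('a::star_algebra \<Rightarrow> 'i ell2 \<Rightarrow> 'i ell2) \<Rightarrow> bool" where
  "star_rep \<pi> \<longleftrightarrow>
     (\<forall>a. bounded_clinear (\<pi> a)) \<and>
     (\<forall>a b x. \<pi> (a + b) x = \<pi> a x + \<pi> b x) \<and> (\<forall>c a x. \<pi> (c *\<^sub>C a) x = c *\<^sub>C \<pi> a x) \<and>
     (\<forall>a b x. \<pi> (a * b) x = \<pi> a (\<pi> b x)) \<and> (\<forall>a. adjoint_pair (\<pi> a) (\<pi> (star a)))"

lemma star_repD:
  assumes "star_rep \<pi>"
  shows "bounded_clinear (\<pi> a)" "bounded_linear (\<pi> a)" "\<pi> (a + b) x = \<pi> a x + \<pi> b x"
    "\<pi> (c *\<^sub>C a) x = c *\<^sub>C \<pi> a x" "\<pi> (a * b) x = \<pi> a (\<pi> b x)" "adjoint_pair (\<pi> a) (\<pi> (star a))"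
    "cinner (\<pi> (star a) x) y = cinner x (\<pi> a y)"
  using assms unfolding star_rep_def by (auto simp: bounded_clinear_def adjoint_pair_def)

lemma star_rep_zero: "star_rep (\<lambda>a x. 0)"
  by (auto simp: star_rep_def bounded_clinear_def adjoint_pair_def cinner_def)

lemma star_rep_seminorm:
  assumes "star_rep \<pi>"
  shows "cstar_seminorm (\<lambda>a. onorm (\<pi> a))"
proof -
  note R = star_repD[OF assms]
  have op: "norm (\<pi> a x) \<le> onorm (\<pi> a) * norm x" for a x by (rule onorm[OF R(2)])
  have pos: "0 \<le> onorm (\<pi> a)" for a by (rule onorm_pos_le[OF R(2)])
  have mult: "onorm (\<pi> (a * b)) \<le> onorm (\<pi> a) * onorm (\<pi> b)" for a b
  proof -
    have "\<pi> (a * b) = \<pi> a \<circ> \<pi> b" by (simp add: fun_eq_iff R(5))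
    then show ?thesis using onorm_compose[OF R(2)[of a] R(2)[of b]] by simp
  qed
  have le: "(onorm (\<pi> a))\<^sup>2 \<le> onorm (\<pi> (star a * a))" for a
  proof -
    have "norm (\<pi> a x) \<le> sqrt (onorm (\<pi> (star a * a))) * norm x" for x
    proof (rule power2_le_imp_le)
      have "(norm (\<pi> a x))\<^sup>2 = Re (cinner (\<pi> (star a * a) x) x)"
        by (simp add: R(5,7) cinner_norm)
      also have "\<dots> \<le> norm (\<pi> (star a * a) x) * norm x" by (rule Re_cinner_le)
      also have "\<dots> \<le> (onorm (\<pi> (star a * a)) * norm x) * norm x"
        by (intro mult_right_mono op) simp
      also have "\<dots> = (sqrt (onorm (\<pi> (star a * a))) * norm x)\<^sup>2"
        by (simp add: power_mult_distrib pos power2_eq_square[of "norm x"])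
      finally show "(norm (\<pi> a x))\<^sup>2 \<le> (sqrt (onorm (\<pi> (star a * a))) * norm x)\<^sup>2" .
    qed (simp add: pos)
    then have "onorm (\<pi> a) \<le> sqrt (onorm (\<pi> (star a * a)))" 
      by (intro onorm_bound) (simp_all add: pos)
    then show ?thesis using pos real_le_rsqrt real_sqrt_le_iff
      by (metis pos power_mono real_sqrt_pow2)
  qed
  have le': "onorm (\<pi> a) \<le> onorm (\<pi> (star a))" for a
  proof (cases "onorm (\<pi> a) = 0")
    case False
    have "onorm (\<pi> a) * onorm (\<pi> a) \<le> onorm (\<pi> (star a)) * onorm (\<pi> a)"
      using le[of a] mult[of "star a" a] by (simp add: power2_eq_square)
    with False pos[of a] show ?thesis by (simp add: mult_le_cancel_right)
  qed (simp add: pos)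
  have eq: "onorm (\<pi> (star a)) = onorm (\<pi> a)" for a using le'[of a] le'[of "star a"] by simp
  show ?thesis
    unfolding cstar_seminorm_def
  proof (intro conjI allI)
    fix a b
    show "onorm (\<pi> (a + b)) \<le> onorm (\<pi> a) + onorm (\<pi> b)"
    proof -
      have "\<pi> (a + b) = (\<lambda>x. \<pi> a x + \<pi> b x)" by (simp add: fun_eq_iff R(3))
      then show ?thesis using onorm_triangle[OF R(2)[of a] R(2)[of b]] by simp
    qed
    show "onorm (\<pi> (a * b)) \<le> onorm (\<pi> a) * onorm (\<pi> b)" by (rule mult)
    show "onorm (\<pi> (star a * a)) = (onorm (\<pi> a))\<^sup>2"
      using le[of a] mult[of "star a" a] by (simp add: eq power2_eq_square)
  next
    fix c a
    have 1: "onorm (\<pi> (c *\<^sub>C a)) \<le> cmod c * onorm (\<pi> a)" for c a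
      by (rule onorm_bound) (simp_all add: pos R(4) norm_scaleC_ell2 mult.assoc mult_left_mono op)
    show "onorm (\<pi> (c *\<^sub>C a)) = cmod c * onorm (\<pi> a)"
    proof (cases "c = 0")
      case True
      then show ?thesis using 1[of 0 a] pos[of "0 *\<^sub>C a"] by simp
    next
      case False
      have "onorm (\<pi> a) \<le> cmod (inverse c) * onorm (\<pi> (c *\<^sub>C a))"
        using 1[of "inverse c" "c *\<^sub>C a"] False by simp
      then have "cmod c * onorm (\<pi> a) \<le> onorm (\<pi> (c *\<^sub>C a))"
        using False by (simp add: norm_inverse norm_divide field_simps)
      with 1[of c a] show ?thesis by simp
    qed
  qed
qed

lemma star_rep_onorm_le:
  "star_rep \<pi> \<Longrightarrow> onorm (\<pi> a) \<le> norm (a::'a::unital_cstar_algebra)"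
  by (rule cstar_seminorm_le_norm[OF star_rep_seminorm])

lemma cstar_seminorm_SUP:
  assumes ne: "Q \<noteq> {}" and Q: "\<And>q. q \<in> Q \<Longrightarrow> cstar_seminorm (n q)"
    and bdd: "\<And>x. bdd_above ((\<lambda>q. n q x) ` Q)"
  shows "cstar_seminorm (\<lambda>x. SUP q\<in>Q. n q x)"
proof -
  define s where "s x = (SUP q\<in>Q. n q x)" for x
  note D = cstar_seminormD[OF Q]
  have up: "n q x \<le> s x" if "q \<in> Q" for q x
    unfolding s_def by (intro cSUP_upper that bdd)
  have least: "s x \<le> u" if "\<And>q. q \<in> Q \<Longrightarrow> n q x \<le> u" for x u
    unfolding s_def by (intro cSUP_least ne that)
  have pos: "0 \<le> s x" for x using ne up D(7) by (metis all_not_in_conv order_trans)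
  have scale: "s (c *\<^sub>C x) \<le> cmod c * s x" for c x
    by (rule least) (simp add: D(2) up mult_left_mono)
  show ?thesis
    unfolding cstar_seminorm_def s_def[symmetric]
  proof (intro conjI allI)
    fix x y c
    show "s (x + y) \<le> s x + s y" by (rule least) (meson D(1) up add_mono order_trans)
    show "s (x * y) \<le> s x * s y"
      by (rule least) (meson D(3,7) up mult_mono order_trans pos)
    show "s (c *\<^sub>C x) = cmod c * s x"
    proof (cases "c = 0")
      case True
      then show ?thesis using scale[of 0 x] pos[of "0 *\<^sub>C x"] by simp
    next
      case False
      have "s x \<le> cmod (inverse c) * s (c *\<^sub>C x)"
        using scale[of "inverse c" "c *\<^sub>C x"] False by simp
      then have "cmod c * s x \<le> s (c *\<^sub>C x)"
        using False by (simp add: norm_inverse norm_divide field_simps)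
      with scale[of c x] show ?thesis by simp
    qed
    show "s (star x * x) = (s x)\<^sup>2"
    proof (rule antisym)
      show "s (star x * x) \<le> (s x)\<^sup>2"
        by (rule least) (simp add: D(4,7) up power_mono)
      have "s x \<le> sqrt (s (star x * x))"
        by (rule least) (metis D(4,7) up real_le_rsqrt)
      then show "(s x)\<^sup>2 \<le> s (star x * x)"
        by (metis pos power_mono real_sqrt_pow2)
    qed
  qed
qed

section \<open>The star-algebra of a monoid with involution\<close>

text \<open>Monoids are written additively because \<open>'m \<Rightarrow>\<^sub>0 'b\<close> carries its convolution product only for
  \<open>'m :: monoid_add\<close>; no commutativity is assumed.\<close>

class star_monoid = monoid_add + involution +
  assumes star_plus: "star (a + b) = star b + star a"

lemma star_zero_monoid [simp]: "star 0 = (0::'a::star_monoid)"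
  by (metis add.left_neutral add.right_neutral star_plus star_star)

lemma inj_star: "inj (star :: 'a::involution \<Rightarrow> 'a)"
  by (metis injI star_star)

instantiation poly_mapping :: (star_monoid, "{star_algebra, ring_1}") star_algebra
begin

lift_definition scaleC_poly_mapping :: "complex \<Rightarrow> ('a \<Rightarrow>\<^sub>0 'b) \<Rightarrow> 'a \<Rightarrow>\<^sub>0 'b"
  is "\<lambda>c f k. c *\<^sub>C f k"
  by (erule finite_subset[rotated]) auto

definition scaleR_poly_mapping :: "real \<Rightarrow> ('a \<Rightarrow>\<^sub>0 'b) \<Rightarrow> 'a \<Rightarrow>\<^sub>0 'b"
  where "scaleR_poly_mapping r f = complex_of_real r *\<^sub>C f"

lift_definition star_poly_mapping :: "('a \<Rightarrow>\<^sub>0 'b) \<Rightarrow> 'a \<Rightarrow>\<^sub>0 'b"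
  is "\<lambda>f k. star (f (star k))"
proof -
  fix f :: "'a \<Rightarrow> 'b" assume "finite {k. f k \<noteq> 0}"
  then have "finite (star ` {k. f k \<noteq> 0})" by simp
  then show "finite {k. star (f (star k)) \<noteq> 0}"
    by (rule finite_subset[rotated]) (force simp: image_iff intro: star_star[symmetric])
qed

lemma lookup_scaleC [simp]: "Poly_Mapping.lookup (c *\<^sub>C f) k = c *\<^sub>C Poly_Mapping.lookup f k" for f :: "'a \<Rightarrow>\<^sub>0 'b"
  by transfer simp

lemma lookup_star [simp]: "Poly_Mapping.lookup (star f) k = star (Poly_Mapping.lookup f (star k))" for f :: "'a \<Rightarrow>\<^sub>0 'b"
  by transfer simp

lemma scaleC_single [simp]:
  "c *\<^sub>C Poly_Mapping.single k b = Poly_Mapping.single (k::'a) (c *\<^sub>C (b::'b))"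
  by (rule poly_mapping_eqI) (simp add: lookup_single when_def)

lemma star_single [simp]:
  "star (Poly_Mapping.single k b) = Poly_Mapping.single (star (k::'a)) (star (b::'b))"
  by (rule poly_mapping_eqI) (auto simp: lookup_single when_def)

lemma poly_mapping_sum_single:
  "f = (\<Sum>k\<in>Poly_Mapping.keys f. Poly_Mapping.single k (Poly_Mapping.lookup f k))" for f :: "'a \<Rightarrow>\<^sub>0 'b"
  by (rule poly_mapping_eqI)
     (simp add: lookup_sum lookup_single when_def sum.delta in_keys_iff)

lemma poly_mapping_additive_induct:
  fixes f :: "'a \<Rightarrow>\<^sub>0 'b"
  assumes "P 0" "\<And>k b. P (Poly_Mapping.single k b)" "\<And>f g. P f \<Longrightarrow> P g \<Longrightarrow> P (f + g)"
  shows "P f"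
proof -
  have "P (\<Sum>k\<in>A. Poly_Mapping.single k (Poly_Mapping.lookup f k))" if "finite A" for A
    using that by (induction A) (simp_all add: assms)
  from this[of "Poly_Mapping.keys f"] show ?thesis by (simp flip: poly_mapping_sum_single)
qed

instance
proof
  fix f g :: "'a \<Rightarrow>\<^sub>0 'b" and c d :: complex and r :: real
  show "c *\<^sub>C (f + g) = c *\<^sub>C f + c *\<^sub>C g" "(c + d) *\<^sub>C f = c *\<^sub>C f + d *\<^sub>C f"
    "c *\<^sub>C d *\<^sub>C f = (c * d) *\<^sub>C f" "1 *\<^sub>C f = f" "star (star f) = f"
    by (rule poly_mapping_eqI, simp add: lookup_add scaleC_add_left scaleC_add_right)+
  show "r *\<^sub>R f = complex_of_real r *\<^sub>C f" by (rule scaleR_poly_mapping_def)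
  have sa: "c *\<^sub>C (f + g) = c *\<^sub>C f + c *\<^sub>C g" for c and f g :: "'a \<Rightarrow>\<^sub>0 'b"
    by (rule poly_mapping_eqI) (simp add: lookup_add scaleC_add_right)
  have sta: "star (f + g) = star f + star g" for f g :: "'a \<Rightarrow>\<^sub>0 'b"
    by (rule poly_mapping_eqI) (simp add: lookup_add star_add)
  have z: "c *\<^sub>C 0 = (0 :: 'a \<Rightarrow>\<^sub>0 'b)" for c by (rule poly_mapping_eqI) simp
  have sz: "star 0 = (0 :: 'a \<Rightarrow>\<^sub>0 'b)" by (rule poly_mapping_eqI) simp
  show "star (f + g) = star f + star g" by (rule sta)
  show "star (c *\<^sub>C f) = cnj c *\<^sub>C star f"
    by (rule poly_mapping_eqI) (simp add: star_scaleC)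
  show "c *\<^sub>C f * g = c *\<^sub>C (f * g)"
  proof (induction f rule: poly_mapping_additive_induct)
    case (2 k b)
    show ?case
      by (induction g rule: poly_mapping_additive_induct) (simp_all add: mult_single distrib_left sa z)
  qed (simp_all add: distrib_right sa z)
  show "f * c *\<^sub>C g = c *\<^sub>C (f * g)"
  proof (induction f rule: poly_mapping_additive_induct)
    case (2 k b)
    show ?case
      by (induction g rule: poly_mapping_additive_induct) (simp_all add: mult_single distrib_left sa z)
  qed (simp_all add: distrib_right sa z)
  show "star (f * g) = star g * star f"
  proof (induction f rule: poly_mapping_additive_induct)
    case (2 k b)
    show ?case
      by (induction g rule: poly_mapping_additive_induct)
         (simp_all add: mult_single distrib_left distrib_right sta sz star_plus star_mult)
  qed (simp_all add: distrib_left distrib_right sta sz)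
qed

end

text \<open>Linear extension of a map defined on the monoid.\<close>

definition lin_ext :: "('m \<Rightarrow> 'v::complex_vector) \<Rightarrow> ('m \<Rightarrow>\<^sub>0 complex) \<Rightarrow> 'v" where
  "lin_ext \<phi> f = (\<Sum>k\<in>Poly_Mapping.keys f. Poly_Mapping.lookup f k *\<^sub>C \<phi> k)"

lemma lin_ext_superset:
  "finite A \<Longrightarrow> Poly_Mapping.keys f \<subseteq> A \<Longrightarrow> lin_ext \<phi> f = (\<Sum>k\<in>A. Poly_Mapping.lookup f k *\<^sub>C \<phi> k)"
  unfolding lin_ext_def by (rule sum.mono_neutral_left) (auto simp: in_keys_iff)

lemma lin_ext_add: "lin_ext \<phi> (f + g) = lin_ext \<phi> f + lin_ext \<phi> g"
  using keys_add[of f g]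
  by (subst (1 2 3) lin_ext_superset[of "Poly_Mapping.keys f \<union> Poly_Mapping.keys g"])
     (auto simp: lookup_add scaleC_add_left sum.distrib)

lemma lin_ext_zero [simp]: "lin_ext \<phi> 0 = 0"
  by (simp add: lin_ext_def)

lemma lin_ext_single [simp]: "lin_ext \<phi> (Poly_Mapping.single k c) = c *\<^sub>C \<phi> k"
  by (cases "c = 0") (simp_all add: lin_ext_def)

lemma lin_ext_scaleC: "lin_ext \<phi> (c *\<^sub>C f) = c *\<^sub>C lin_ext \<phi> (f :: 'm::star_monoid \<Rightarrow>\<^sub>0 complex)"
  by (subst lin_ext_superset[of "Poly_Mapping.keys f"])
     (auto simp: in_keys_iff scaleC_complex_def lin_ext_def scaleC_sum_right)

lemma lin_ext_one: "lin_ext \<phi> (1 :: 'm::star_monoid \<Rightarrow>\<^sub>0 complex) = \<phi> 0"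
  using lin_ext_single[of \<phi> 0 1] by simp

lemma lin_ext_mult:
  fixes \<phi> :: "'m::star_monoid \<Rightarrow> 'a::star_algebra"
  assumes "\<And>k l. \<phi> (k + l) = \<phi> k * \<phi> l"
  shows "lin_ext \<phi> (f * g) = lin_ext \<phi> f * lin_ext \<phi> g"
proof (induction f rule: poly_mapping_additive_induct)
  case (2 k b)
  show ?case
    by (induction g rule: poly_mapping_additive_induct)
       (simp_all add: mult_single distrib_left lin_ext_add assms mult.commute)
qed (simp_all add: distrib_right lin_ext_add)

lemma lin_ext_star:
  fixes \<phi> :: "'m::star_monoid \<Rightarrow> 'a::star_algebra"
  assumes "\<And>k. \<phi> (star k) = star (\<phi> k)"
  shows "lin_ext \<phi> (star f) = star (lin_ext \<phi> f)"
  by (induction f rule: poly_mapping_additive_induct)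
     (simp_all add: lin_ext_add star_add star_scaleC assms star_complex_def)

lemma unital_star_hom_lin_ext:
  fixes \<phi> :: "'m::star_monoid \<Rightarrow> 'a::star_algebra"
  assumes "\<And>k l. \<phi> (k + l) = \<phi> k * \<phi> l" "\<phi> 0 = 1" "\<And>k. \<phi> (star k) = star (\<phi> k)"
  shows "unital_star_hom (lin_ext \<phi>)"
  by (simp add: unital_star_hom_def lin_ext_add lin_ext_scaleC lin_ext_mult lin_ext_one lin_ext_star assms)

lemma monoid_algebra_bound:
  fixes q :: "('m::star_monoid \<Rightarrow>\<^sub>0 complex) \<Rightarrow> real"
  assumes "cstar_seminorm q" "\<And>k. q (Poly_Mapping.single k 1) \<le> B k"
  shows "q f \<le> (\<Sum>k\<in>Poly_Mapping.keys f. cmod (Poly_Mapping.lookup f k) * B k)"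
proof -
  have "q f = q (\<Sum>k\<in>Poly_Mapping.keys f. Poly_Mapping.lookup f k *\<^sub>C Poly_Mapping.single k 1)"
    by (subst poly_mapping_sum_single[of f]) (simp add: scaleC_complex_def)
  also have "\<dots> \<le> (\<Sum>k\<in>Poly_Mapping.keys f. q (Poly_Mapping.lookup f k *\<^sub>C Poly_Mapping.single k 1))"
    by (rule cstar_seminorm_sum[OF assms(1)])
  also have "\<dots> \<le> (\<Sum>k\<in>Poly_Mapping.keys f. cmod (Poly_Mapping.lookup f k) * B k)"
    by (intro sum_mono) (simp only: cstar_seminormD(2)[OF assms(1)] mult_left_mono assms(2) norm_ge_zero)
  finally show ?thesis .
qed

lemma monoid_algebra_separable:
  fixes q :: "('m::star_monoid \<Rightarrow>\<^sub>0 complex) \<Rightarrow> real"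
  assumes q: "cstar_seminorm q" and L: "countable L"
    and d: "\<And>k e. 0 < e \<Longrightarrow> \<exists>l\<in>L. q (Poly_Mapping.single k 1 - Poly_Mapping.single l 1) < e"
  shows "\<exists>K. countable K \<and> (\<forall>f e. 0 < e \<longrightarrow> (\<exists>g\<in>K. q (f - g) < e))"
proof -
  note Q = cstar_seminormD[OF q]
  obtain Z :: "complex set" where Z: "countable Z" "\<And>c e. 0 < e \<Longrightarrow> \<exists>z\<in>Z. dist c z < e"
    using second_countable_dense[where ?'a=complex] by blast
  define K where "K = (\<lambda>ps. \<Sum>(l, c)\<leftarrow>ps. Poly_Mapping.single l c) ` lists (L \<times> Z)"
  have "countable K" unfolding K_def using L Z by auto
  moreover have "\<forall>e>0. \<exists>g\<in>K. q (f - g) < e" for f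
  proof (induction f rule: poly_mapping_additive_induct)
    case 1
    have "0 \<in> K" unfolding K_def by (rule image_eqI[of _ _ "[]"]) auto
    then show ?case using Q(5) by (metis diff_self)
  next
    case (2 k c)
    show ?case
    proof (intro allI impI)
      fix e :: real assume e: "0 < e"
      define M where "M = q (Poly_Mapping.single k 1) + 1"
      have M: "0 < M" using Q(7) by (simp add: M_def add_nonneg_pos)
      obtain z where z: "z \<in> Z" "cmod (c - z) < e / (2 * M)"
        using Z(2)[of "e / (2 * M)" c] e M by (auto simp: dist_norm)
      have "0 < min 1 (e / (2 * (cmod c + 1)))"
        using e by (simp add: add_nonneg_pos)
      then obtain l where l: "l \<in> L"
        "q (Poly_Mapping.single k 1 - Poly_Mapping.single l 1) < min 1 (e / (2 * (cmod c + 1)))"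
        using d by blast
      have "q (Poly_Mapping.single l 1) \<le> M"
        using Q(12)[of "Poly_Mapping.single k 1" "Poly_Mapping.single l 1"] l(2)
        unfolding M_def by linarith
      then have 1: "cmod (c - z) * q (Poly_Mapping.single l 1) \<le> cmod (c - z) * M"
        by (intro mult_left_mono) auto
      have "Poly_Mapping.single k c - Poly_Mapping.single l z =
          c *\<^sub>C (Poly_Mapping.single k 1 - Poly_Mapping.single l 1) + (c - z) *\<^sub>C Poly_Mapping.single l 1"
        by (simp add: scaleC_diff_right scaleC_complex_def single_diff)
      then have "q (Poly_Mapping.single k c - Poly_Mapping.single l z) \<le>
          cmod c * q (Poly_Mapping.single k 1 - Poly_Mapping.single l 1) +
          cmod (c - z) * q (Poly_Mapping.single l 1)"
        using Q(1,2) by metis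
      also have "\<dots> \<le> (cmod c + 1) * q (Poly_Mapping.single k 1 - Poly_Mapping.single l 1) + cmod (c - z) * M"
        by (intro add_mono 1 mult_right_mono Q(7)) simp
      also have "\<dots> < e / 2 + e / 2"
      proof (rule add_strict_mono)
        have "0 < cmod c + 1" by (simp add: add_nonneg_pos)
        then show "(cmod c + 1) * q (Poly_Mapping.single k 1 - Poly_Mapping.single l 1) < e / 2"
          using l(2) by (simp add: field_simps)
        show "cmod (c - z) * M < e / 2" using z(2) M by (simp add: field_simps)
      qed
      finally have "q (Poly_Mapping.single k c - Poly_Mapping.single l z) < e" by simp
      moreover have "Poly_Mapping.single l z \<in> K"
        unfolding K_def by (rule image_eqI[of _ _ "[(l, z)]"]) (use l z in auto)
      ultimately show "\<exists>g\<in>K. q (Poly_Mapping.single k c - g) < e" by blast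
    qed
  next
    case (3 f g)
    show ?case
    proof (intro allI impI)
      fix e :: real assume e: "0 < e"
      then obtain f' g' where f': "f' \<in> K" "q (f - f') < e / 2" and g': "g' \<in> K" "q (g - g') < e / 2"
        using 3 by (meson half_gt_zero)
      have "f' + g' \<in> K"
      proof -
        obtain ps where ps: "ps \<in> lists (L \<times> Z)" "f' = (\<Sum>(l, c)\<leftarrow>ps. Poly_Mapping.single l c)"
          using f' unfolding K_def by blast
        obtain qs where qs: "qs \<in> lists (L \<times> Z)" "g' = (\<Sum>(l, c)\<leftarrow>qs. Poly_Mapping.single l c)"
          using g' unfolding K_def by blast
        show ?thesis unfolding K_def using ps qs by (intro image_eqI[of _ _ "ps @ qs"]) auto
      qed
      moreover have "q (f + g - (f' + g')) < e"
        using Q(1)[of "f - f'" "g - g'"] f' g' by (simp add: algebra_simps)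
      ultimately show "\<exists>h\<in>K. q (f + g - h) < e" by blast
    qed
  qed
  ultimately show ?thesis by blast
qed

section \<open>The minimal tensor product\<close>

text \<open>For separable algebras the cyclic representations act on spaces of countable dimension, so the
  representations on \<open>\<ell>\<^sup>2(\<nat>)\<close> compute the spatial tensor norm; the tensor product below is formed only
  for this class, which is closed under tensor products and free products of finitely many copies.
  Every finitely generated C*-algebra is separable.\<close>

class separable_unital_cstar_algebra = unital_cstar_algebra + second_countable_topology

instance complex :: separable_unital_cstar_algebra ..
instance cstar_completion :: (separable_cstar_seminormed) separable_unital_cstar_algebra ..

datatype ('a, 'b) tpair = TPair (tfst: 'a) (tsnd: 'b)

instantiation tpair :: (star_algebra, star_algebra) star_monoid
begin

definition "0 = TPair 1 1"
definition "p + p' = TPair (tfst p * tfst p') (tsnd p * tsnd p')"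
definition "star p = TPair (star (tfst p)) (star (tsnd p))"

instance
  by standard (auto simp: zero_tpair_def plus_tpair_def star_tpair_def mult.assoc star_mult)

end

text \<open>Formal linear combinations of pairs \<open>(a, b)\<close>, multiplied factorwise. The bilinearity relations
  are not imposed here: they have spatial norm 0 and disappear in the separated completion.\<close>

typedef ('a, 'b) alg_tensor = "UNIV :: (('a, 'b) tpair \<Rightarrow>\<^sub>0 complex) set" ..

setup_lifting type_definition_alg_tensor

instantiation alg_tensor :: (star_algebra, star_algebra) star_algebra
begin

lift_definition zero_alg_tensor :: "('a, 'b) alg_tensor" is 0 .
lift_definition one_alg_tensor :: "('a, 'b) alg_tensor" is 1 .
lift_definition plus_alg_tensor :: "('a, 'b) alg_tensor \<Rightarrow> ('a, 'b) alg_tensor \<Rightarrow> ('a, 'b) alg_tensor" is "(+)" .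
lift_definition minus_alg_tensor :: "('a, 'b) alg_tensor \<Rightarrow> ('a, 'b) alg_tensor \<Rightarrow> ('a, 'b) alg_tensor" is "(-)" .
lift_definition uminus_alg_tensor :: "('a, 'b) alg_tensor \<Rightarrow> ('a, 'b) alg_tensor" is uminus .
lift_definition times_alg_tensor :: "('a, 'b) alg_tensor \<Rightarrow> ('a, 'b) alg_tensor \<Rightarrow> ('a, 'b) alg_tensor" is "(*)" .
lift_definition scaleC_alg_tensor :: "complex \<Rightarrow> ('a, 'b) alg_tensor \<Rightarrow> ('a, 'b) alg_tensor" is scaleC .
lift_definition scaleR_alg_tensor :: "real \<Rightarrow> ('a, 'b) alg_tensor \<Rightarrow> ('a, 'b) alg_tensor" is scaleR .
lift_definition star_alg_tensor :: "('a, 'b) alg_tensor \<Rightarrow> ('a, 'b) alg_tensor" is star .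

instance
  by standard (transfer, simp add: algebra_simps scaleC_add_right scaleC_add_left scaleR_scaleC
      star_add star_scaleC star_mult)+

end

definition tensor_rep ::
  "('a::star_algebra \<Rightarrow> 'i ell2 \<Rightarrow> 'i ell2) \<Rightarrow> ('b::star_algebra \<Rightarrow> 'j ell2 \<Rightarrow> 'j ell2) \<Rightarrow>
   (('a, 'b) tpair \<Rightarrow>\<^sub>0 complex) \<Rightarrow> ('i \<times> 'j) ell2 \<Rightarrow> ('i \<times> 'j) ell2" where
  "tensor_rep \<pi> \<sigma> f z =
     (\<Sum>p\<in>Poly_Mapping.keys f. Poly_Mapping.lookup f p *\<^sub>C op_tensor (\<pi> (tfst p)) (\<sigma> (tsnd p)) z)"

text \<open>\<open>sup \<parallel>(\<pi> \<otimes> \<sigma>)(f)\<parallel>\<close> over all pairs of representations.\<close>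

definition spatial_norm ::
  "(('a::unital_cstar_algebra, 'b::unital_cstar_algebra) tpair \<Rightarrow>\<^sub>0 complex) \<Rightarrow> real" where
  "spatial_norm f =
     (SUP (\<pi>, \<sigma>) \<in> {(\<pi> :: 'a \<Rightarrow> nat ell2 \<Rightarrow> nat ell2, \<sigma> :: 'b \<Rightarrow> nat ell2 \<Rightarrow> nat ell2).
        star_rep \<pi> \<and> star_rep \<sigma>}. onorm (tensor_rep \<pi> \<sigma> f))"

lemma tensor_rep_lin_ext:
  "tensor_rep \<pi> \<sigma> f z = lin_ext (\<lambda>p. op_tensor (\<pi> (tfst p)) (\<sigma> (tsnd p)) z) f"
  by (simp add: tensor_rep_def lin_ext_def)

lemma tensor_rep_simps:
  "tensor_rep \<pi> \<sigma> 0 z = 0"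
  "tensor_rep \<pi> \<sigma> (f + g) z = tensor_rep \<pi> \<sigma> f z + tensor_rep \<pi> \<sigma> g z"
  "tensor_rep \<pi> \<sigma> (c *\<^sub>C f) z = c *\<^sub>C tensor_rep \<pi> \<sigma> f z"
  "tensor_rep \<pi> \<sigma> (Poly_Mapping.single p c) z = c *\<^sub>C op_tensor (\<pi> (tfst p)) (\<sigma> (tsnd p)) z"
  by (simp_all add: tensor_rep_lin_ext lin_ext_add lin_ext_scaleC)

lemma bounded_clinear_comp:
  "bounded_clinear S \<Longrightarrow> bounded_clinear T \<Longrightarrow> bounded_clinear (\<lambda>x. S (T x))"
  unfolding bounded_clinear_def by (auto intro: bounded_linear_compose)

lemma bounded_clinear_add:
  "bounded_clinear S \<Longrightarrow> bounded_clinear T \<Longrightarrow> bounded_clinear (\<lambda>x. S x + T x)"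
  unfolding bounded_clinear_def by (auto intro: bounded_linear_add simp: scaleC_add_right)

lemma bounded_clinear_scaleC:
  assumes "bounded_clinear T"
  shows "bounded_clinear (\<lambda>x. c *\<^sub>C T x)"
  unfolding bounded_clinear_def
proof
  note T = bounded_clinearD[OF assms]
  show "bounded_linear (\<lambda>x. c *\<^sub>C T x)"
    by (rule bounded_linear_intro[of _ "cmod c * onorm T"])
       (simp_all add: T scaleC_add_right scaleR_scaleC norm_scaleC_ell2 mult.commute mult.left_commute,
        metis T(5) mult.commute mult.left_commute mult_left_mono norm_ge_zero)
  show "\<forall>d x. c *\<^sub>C T (d *\<^sub>C x) = d *\<^sub>C c *\<^sub>C T x" by (simp add: T mult.commute)
qed

lemma bounded_clinear_zero: "bounded_clinear (\<lambda>x. 0)"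
  by (simp add: bounded_clinear_def)

lemma bounded_clinear_op_tensor:
  "bounded_clinear T \<Longrightarrow> bounded_clinear S \<Longrightarrow> bounded_clinear (op_tensor T S)"
  using bounded_clinear_comp[OF bounded_clinear_amp_left bounded_clinear_amp_right, of T S]
  by (simp add: op_tensor_def[abs_def])

lemma amp_comp:
  "bounded_clinear S \<Longrightarrow> bounded_clinear T \<Longrightarrow> amp_right (\<lambda>x. S (T x)) z = amp_right S (amp_right T z)"
  "bounded_clinear S \<Longrightarrow> bounded_clinear T \<Longrightarrow> amp_left (\<lambda>x. S (T x)) z' = amp_left S (amp_left T z')"
proof -
  have *: "amp_right (\<lambda>x. S (T x)) z = amp_right S (amp_right T z)"
    if "bounded_clinear S" "bounded_clinear T" for S T :: "'d ell2 \<Rightarrow> 'd ell2" and z :: "('e \<times> 'd) ell2"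
    using that by (auto intro!: ell2_pair_eqI simp: coord_amp_right bounded_clinear_comp row_amp_right)
  show "bounded_clinear S \<Longrightarrow> bounded_clinear T \<Longrightarrow> amp_right (\<lambda>x. S (T x)) z = amp_right S (amp_right T z)"
    by (rule *)
  show "bounded_clinear S \<Longrightarrow> bounded_clinear T \<Longrightarrow> amp_left (\<lambda>x. S (T x)) z' = amp_left S (amp_left T z')"
    by (simp add: amp_left_def *)
qed

lemma amp_linear:
  "bounded_clinear S \<Longrightarrow> bounded_clinear T \<Longrightarrow> amp_right (\<lambda>x. S x + T x) z = amp_right S z + amp_right T z"
  "bounded_clinear T \<Longrightarrow> amp_right (\<lambda>x. c *\<^sub>C T x) z = c *\<^sub>C amp_right T z"
  "bounded_clinear S \<Longrightarrow> bounded_clinear T \<Longrightarrow> amp_left (\<lambda>x. S x + T x) z' = amp_left S z' + amp_left T z'"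
  "bounded_clinear T \<Longrightarrow> amp_left (\<lambda>x. c *\<^sub>C T x) z' = c *\<^sub>C amp_left T z'"
  by (auto intro!: ell2_pair_eqI simp: coord_amp_right coord_amp_left bounded_clinear_add bounded_clinear_scaleC)

lemma op_tensor_mult:
  assumes "star_rep \<pi>" "star_rep \<sigma>"
  shows "op_tensor (\<pi> (a * a')) (\<sigma> (b * b')) z = op_tensor (\<pi> a) (\<sigma> b) (op_tensor (\<pi> a') (\<sigma> b') z)"
proof -
  note P = star_repD[OF assms(1)] and S = star_repD[OF assms(2)]
  have eq: "\<pi> (a * a') = (\<lambda>x. \<pi> a (\<pi> a' x))" "\<sigma> (b * b') = (\<lambda>x. \<sigma> b (\<sigma> b' x))"
    by (simp_all add: fun_eq_iff P S)
  show ?thesis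
    unfolding op_tensor_def eq
    by (simp add: amp_comp P(1) S(1) amp_commute[OF P(1) P(6) S(1) S(6)])
qed

lemma adjoint_op_tensor:
  fixes \<pi> :: "'a::star_algebra \<Rightarrow> 'i ell2 \<Rightarrow> 'i ell2" and \<sigma> :: "'b::star_algebra \<Rightarrow> 'j ell2 \<Rightarrow> 'j ell2"
  assumes "star_rep \<pi>" "star_rep \<sigma>"
  shows "cinner (op_tensor (\<pi> (star a)) (\<sigma> (star b)) z) w = cinner z (op_tensor (\<pi> a) (\<sigma> b) w)"
proof -
  note P = star_repD[OF assms(1)] and S = star_repD[OF assms(2)]
  have 1: "cinner (amp_left (\<pi> (star a)) x) y = cinner x (amp_left (\<pi> a) y)" for x y :: "('i \<times> 'j) ell2"
    using adjoint_pair_amp_left[OF P(1) P(1) P(6)] unfolding adjoint_pair_def by blast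
  have 2: "cinner (amp_right (\<sigma> (star b)) x) y = cinner x (amp_right (\<sigma> b) y)" for x y :: "('i \<times> 'j) ell2"
    using adjoint_pair_amp_right[OF S(1) S(1) S(6)] unfolding adjoint_pair_def by blast
  show ?thesis
    unfolding op_tensor_def amp_commute[OF P(1) P(6) S(1) S(6)]
    by (simp add: 1 2 amp_commute[OF P(1) P(6) S(1) S(6), symmetric])
qed

lemma star_rep_tensor_rep:
  fixes \<pi> :: "'a::star_algebra \<Rightarrow> 'i ell2 \<Rightarrow> 'i ell2" and \<sigma> :: "'b::star_algebra \<Rightarrow> 'j ell2 \<Rightarrow> 'j ell2"
  assumes "star_rep \<pi>" "star_rep \<sigma>"
  shows "star_rep (tensor_rep \<pi> \<sigma>)"
  unfolding star_rep_def
proof (intro conjI allI)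
  note P = star_repD[OF assms(1)] and S = star_repD[OF assms(2)]
  have ot: "bounded_clinear (op_tensor (\<pi> a) (\<sigma> b))" for a b
    by (intro bounded_clinear_op_tensor P S)
  fix f g :: "('a, 'b) tpair \<Rightarrow>\<^sub>0 complex" and c x
  have eqs: "tensor_rep \<pi> \<sigma> 0 = (\<lambda>z. 0)"
    "tensor_rep \<pi> \<sigma> (f + g) = (\<lambda>z. tensor_rep \<pi> \<sigma> f z + tensor_rep \<pi> \<sigma> g z)"
    "tensor_rep \<pi> \<sigma> (Poly_Mapping.single p c) = (\<lambda>z. c *\<^sub>C op_tensor (\<pi> (tfst p)) (\<sigma> (tsnd p)) z)" for f g p c
    by (simp_all add: fun_eq_iff tensor_rep_simps)
  have bd: "bounded_clinear (tensor_rep \<pi> \<sigma> f)" for f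
    by (induction f rule: poly_mapping_additive_induct)
       (simp_all add: eqs bounded_clinear_zero bounded_clinear_add bounded_clinear_scaleC ot)
  show "bounded_clinear (tensor_rep \<pi> \<sigma> f)" by (rule bd)
  show "tensor_rep \<pi> \<sigma> (f + g) x = tensor_rep \<pi> \<sigma> f x + tensor_rep \<pi> \<sigma> g x"
    "tensor_rep \<pi> \<sigma> (c *\<^sub>C f) x = c *\<^sub>C tensor_rep \<pi> \<sigma> f x"
    by (simp_all add: tensor_rep_simps)
  have s0: "op_tensor (\<pi> a) (\<sigma> b) 0 = 0" for a b
    using bounded_clinearD(3)[OF ot[of a b], of 0 0] by simp
  show "tensor_rep \<pi> \<sigma> (f * g) x = tensor_rep \<pi> \<sigma> f (tensor_rep \<pi> \<sigma> g x)"
  proof (induction f rule: poly_mapping_additive_induct)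
    case (2 k b)
    show ?case
      by (induction g rule: poly_mapping_additive_induct)
         (simp_all add: mult_single distrib_left tensor_rep_simps plus_tpair_def s0 scaleC_add_right
           bounded_clinearD[OF ot] op_tensor_mult[OF assms])
  qed (simp_all add: distrib_right tensor_rep_simps)
  have "cinner (tensor_rep \<pi> \<sigma> (star f) x) y = cinner x (tensor_rep \<pi> \<sigma> f y)" for x y
  proof (induction f rule: poly_mapping_additive_induct)
    case 1
    then show ?case by (simp add: tensor_rep_simps cinner_def)
  qed (simp_all add: star_add tensor_rep_simps cinner_add_left cinner_add_right star_tpair_def
      cinner_scaleC_left cinner_scaleC_right star_complex_def adjoint_op_tensor[OF assms])
  then show "adjoint_pair (tensor_rep \<pi> \<sigma> f) (tensor_rep \<pi> \<sigma> (star f))"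
    by (simp add: adjoint_pair_def)
qed

lemma onorm_op_tensor_le:
  assumes T: "bounded_clinear T" and S: "bounded_clinear S"
  shows "onorm (op_tensor T S) \<le> onorm T * onorm S"
proof (rule onorm_bound)
  fix z :: "('a \<times> 'b) ell2"
  have "norm (op_tensor T S z) \<le> onorm T * norm (amp_right S z)"
    unfolding op_tensor_def by (rule norm_amp_left[OF T])
  also have "\<dots> \<le> onorm T * (onorm S * norm z)"
    by (intro mult_left_mono norm_amp_right[OF S] bounded_clinearD(6)[OF T])
  finally show "norm (op_tensor T S z) \<le> onorm T * onorm S * norm z" by (simp add: mult.assoc)
qed (simp add: bounded_clinearD(6) T S)

lemma onorm_tensor_rep_single:
  fixes a :: "'a::unital_cstar_algebra" and b :: "'b::unital_cstar_algebra"
  assumes "star_rep \<pi>" "star_rep \<sigma>"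
  shows "onorm (tensor_rep \<pi> \<sigma> (Poly_Mapping.single (TPair a b) 1)) \<le> norm a * norm b"
proof -
  note P = star_repD[OF assms(1)] and S = star_repD[OF assms(2)]
  have "tensor_rep \<pi> \<sigma> (Poly_Mapping.single (TPair a b) 1) = op_tensor (\<pi> a) (\<sigma> b)"
    by (simp add: fun_eq_iff tensor_rep_simps)
  then have "onorm (tensor_rep \<pi> \<sigma> (Poly_Mapping.single (TPair a b) 1)) \<le> onorm (\<pi> a) * onorm (\<sigma> b)"
    using onorm_op_tensor_le[OF P(1)[of a] S(1)[of b]] by simp
  also have "\<dots> \<le> norm a * norm b"
    by (intro mult_mono star_rep_onorm_le assms onorm_pos_le S) simp
  finally show ?thesis .
qed

lemma tensor_rep_bdd:
  fixes f :: "('a::unital_cstar_algebra, 'b::unital_cstar_algebra) tpair \<Rightarrow>\<^sub>0 complex"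
  assumes "star_rep \<pi>" "star_rep \<sigma>"
  shows "onorm (tensor_rep \<pi> \<sigma> f) \<le>
    (\<Sum>p\<in>Poly_Mapping.keys f. cmod (Poly_Mapping.lookup f p) * (norm (tfst p) * norm (tsnd p)))"
  by (rule monoid_algebra_bound[OF star_rep_seminorm[OF star_rep_tensor_rep[OF assms]]])
     (metis onorm_tensor_rep_single[OF assms] tpair.collapse)

lemma spatial_norm_bdd:
  fixes f :: "('a::unital_cstar_algebra, 'b::unital_cstar_algebra) tpair \<Rightarrow>\<^sub>0 complex"
  shows "bdd_above ((\<lambda>(\<pi>, \<sigma>). onorm (tensor_rep \<pi> \<sigma> f)) `
    {(\<pi> :: 'a \<Rightarrow> nat ell2 \<Rightarrow> nat ell2, \<sigma> :: 'b \<Rightarrow> nat ell2 \<Rightarrow> nat ell2). star_rep \<pi> \<and> star_rep \<sigma>})"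
  by (rule bdd_aboveI2) (auto intro: tensor_rep_bdd)

lemma spatial_norm_upper:
  fixes \<pi> :: "'a::unital_cstar_algebra \<Rightarrow> nat ell2 \<Rightarrow> nat ell2"
    and \<sigma> :: "'b::unital_cstar_algebra \<Rightarrow> nat ell2 \<Rightarrow> nat ell2"
  assumes "star_rep \<pi>" "star_rep \<sigma>"
  shows "onorm (tensor_rep \<pi> \<sigma> f) \<le> spatial_norm f"
  unfolding spatial_norm_def
  using cSUP_upper[OF _ spatial_norm_bdd, of "(\<pi>, \<sigma>)" f] assms by simp

lemma spatial_norm_least:
  fixes f :: "('a::unital_cstar_algebra, 'b::unital_cstar_algebra) tpair \<Rightarrow>\<^sub>0 complex"
  assumes "\<And>(\<pi> :: 'a \<Rightarrow> nat ell2 \<Rightarrow> nat ell2) (\<sigma> :: 'b \<Rightarrow> nat ell2 \<Rightarrow> nat ell2).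
     star_rep \<pi> \<Longrightarrow> star_rep \<sigma> \<Longrightarrow> onorm (tensor_rep \<pi> \<sigma> f) \<le> u"
  shows "spatial_norm f \<le> u"
  unfolding spatial_norm_def
proof (rule cSUP_least)
  show "{(\<pi> :: 'a \<Rightarrow> nat ell2 \<Rightarrow> nat ell2, \<sigma> :: 'b \<Rightarrow> nat ell2 \<Rightarrow> nat ell2). star_rep \<pi> \<and> star_rep \<sigma>} \<noteq> {}"
    proof -
    have "(\<lambda>a x. 0, \<lambda>a x. 0) \<in> {(\<pi> :: 'a \<Rightarrow> nat ell2 \<Rightarrow> nat ell2, \<sigma> :: 'b \<Rightarrow> nat ell2 \<Rightarrow> nat ell2). star_rep \<pi> \<and> star_rep \<sigma>}"
      by (simp add: star_rep_zero)
    then show ?thesis by blast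
  qed
qed (use assms in auto)

lemma cstar_seminorm_spatial_norm:
  "cstar_seminorm (spatial_norm :: (('a::unital_cstar_algebra, 'b::unital_cstar_algebra) tpair \<Rightarrow>\<^sub>0 complex) \<Rightarrow> real)"
proof -
  have "cstar_seminorm (\<lambda>f. SUP q \<in> {(\<pi> :: 'a \<Rightarrow> nat ell2 \<Rightarrow> nat ell2, \<sigma> :: 'b \<Rightarrow> nat ell2 \<Rightarrow> nat ell2).
      star_rep \<pi> \<and> star_rep \<sigma>}. (\<lambda>(\<pi>, \<sigma>). onorm (tensor_rep \<pi> \<sigma> f)) q)"
  proof (rule cstar_seminorm_SUP)
    show "{(\<pi> :: 'a \<Rightarrow> nat ell2 \<Rightarrow> nat ell2, \<sigma> :: 'b \<Rightarrow> nat ell2 \<Rightarrow> nat ell2). star_rep \<pi> \<and> star_rep \<sigma>} \<noteq> {}"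
      proof -
    have "(\<lambda>a x. 0, \<lambda>a x. 0) \<in> {(\<pi> :: 'a \<Rightarrow> nat ell2 \<Rightarrow> nat ell2, \<sigma> :: 'b \<Rightarrow> nat ell2 \<Rightarrow> nat ell2). star_rep \<pi> \<and> star_rep \<sigma>}"
      by (simp add: star_rep_zero)
    then show ?thesis by blast
  qed
  qed (use star_rep_seminorm star_rep_tensor_rep spatial_norm_bdd in auto)
  then show ?thesis by (simp add: spatial_norm_def[abs_def])
qed

lemma spatial_norm_elementary:
  "spatial_norm (Poly_Mapping.single (TPair a b) 1) \<le> norm a * norm b"
  by (rule spatial_norm_least) (rule onorm_tensor_rep_single)

lemma amp_linear_rep:
  assumes "star_rep \<pi>" "star_rep \<sigma>"
  shows "op_tensor (\<pi> (a + a')) (\<sigma> b) z = op_tensor (\<pi> a) (\<sigma> b) z + op_tensor (\<pi> a') (\<sigma> b) z"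
    "op_tensor (\<pi> a) (\<sigma> (b + b')) z = op_tensor (\<pi> a) (\<sigma> b) z + op_tensor (\<pi> a) (\<sigma> b') z"
    "op_tensor (\<pi> (c *\<^sub>C a)) (\<sigma> b) z = c *\<^sub>C op_tensor (\<pi> a) (\<sigma> b) z"
    "op_tensor (\<pi> a) (\<sigma> (c *\<^sub>C b)) z = c *\<^sub>C op_tensor (\<pi> a) (\<sigma> b) z"
proof -
  note P = star_repD[OF assms(1)] and S = star_repD[OF assms(2)]
  have eq: "\<pi> (a + a') = (\<lambda>x. \<pi> a x + \<pi> a' x)" "\<pi> (c *\<^sub>C a) = (\<lambda>x. c *\<^sub>C \<pi> a x)"
    "\<sigma> (b + b') = (\<lambda>x. \<sigma> b x + \<sigma> b' x)" "\<sigma> (c *\<^sub>C b) = (\<lambda>x. c *\<^sub>C \<sigma> b x)"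
    by (simp_all add: fun_eq_iff P S)
  note L = bounded_clinearD[OF bounded_clinear_amp_left[OF P(1)]]
  show "op_tensor (\<pi> (a + a')) (\<sigma> b) z = op_tensor (\<pi> a) (\<sigma> b) z + op_tensor (\<pi> a') (\<sigma> b) z"
    "op_tensor (\<pi> a) (\<sigma> (b + b')) z = op_tensor (\<pi> a) (\<sigma> b) z + op_tensor (\<pi> a) (\<sigma> b') z"
    "op_tensor (\<pi> (c *\<^sub>C a)) (\<sigma> b) z = c *\<^sub>C op_tensor (\<pi> a) (\<sigma> b) z"
    "op_tensor (\<pi> a) (\<sigma> (c *\<^sub>C b)) z = c *\<^sub>C op_tensor (\<pi> a) (\<sigma> b) z"
    unfolding op_tensor_def eq by (simp_all add: amp_linear P(1) S(1) L)
qed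

lemma spatial_norm_bilinear:
  fixes a a' :: "'a::unital_cstar_algebra" and b b' :: "'b::unital_cstar_algebra"
  shows "spatial_norm (Poly_Mapping.single (TPair (a + a') b) 1 - Poly_Mapping.single (TPair a b) 1 -
      Poly_Mapping.single (TPair a' b) 1) = 0" (is "spatial_norm ?f1 = 0")
    "spatial_norm (Poly_Mapping.single (TPair a (b + b')) 1 - Poly_Mapping.single (TPair a b) 1 -
      Poly_Mapping.single (TPair a b') 1) = 0" (is "spatial_norm ?f2 = 0")
    "spatial_norm (Poly_Mapping.single (TPair (c *\<^sub>C a) b) 1 - c *\<^sub>C Poly_Mapping.single (TPair a b) 1) = 0"
       (is "spatial_norm ?f3 = 0")
    "spatial_norm (Poly_Mapping.single (TPair a (c *\<^sub>C b)) 1 - c *\<^sub>C Poly_Mapping.single (TPair a b) 1) = 0"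
       (is "spatial_norm ?f4 = 0")
proof -
  have z: "spatial_norm f = 0" if "\<And>(\<pi> :: 'a \<Rightarrow> nat ell2 \<Rightarrow> nat ell2) (\<sigma> :: 'b \<Rightarrow> nat ell2 \<Rightarrow> nat ell2) z.
     star_rep \<pi> \<Longrightarrow> star_rep \<sigma> \<Longrightarrow> tensor_rep \<pi> \<sigma> f z = 0" for f
  proof (rule antisym)
    show "spatial_norm f \<le> 0"
    proof (rule spatial_norm_least)
      fix \<pi> :: "'a \<Rightarrow> nat ell2 \<Rightarrow> nat ell2" and \<sigma> :: "'b \<Rightarrow> nat ell2 \<Rightarrow> nat ell2"
      assume "star_rep \<pi>" "star_rep \<sigma>"
      then have "tensor_rep \<pi> \<sigma> f = (\<lambda>z. 0)" using that by blast
      then show "onorm (tensor_rep \<pi> \<sigma> f) \<le> 0" by (simp add: onorm_zero)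
    qed
    show "0 \<le> spatial_norm f" by (rule cstar_seminormD(7)[OF cstar_seminorm_spatial_norm])
  qed
  have m: "tensor_rep \<pi> \<sigma> (f - g) z = tensor_rep \<pi> \<sigma> f z - tensor_rep \<pi> \<sigma> g z"
    for f g z and \<pi> :: "'a \<Rightarrow> nat ell2 \<Rightarrow> nat ell2" and \<sigma> :: "'b \<Rightarrow> nat ell2 \<Rightarrow> nat ell2"
    using tensor_rep_simps(2)[of \<pi> \<sigma> "f - g" g z] by simp
  show "spatial_norm ?f1 = 0" "spatial_norm ?f2 = 0" "spatial_norm ?f3 = 0" "spatial_norm ?f4 = 0"
    by (rule z, simp add: m tensor_rep_simps amp_linear_rep scaleC_complex_def)+
qed

instantiation alg_tensor :: (separable_unital_cstar_algebra, separable_unital_cstar_algebra)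
  separable_cstar_seminormed
begin

lift_definition snorm_alg_tensor :: "('a, 'b) alg_tensor \<Rightarrow> real" is spatial_norm .

instance
proof
  note Q = cstar_seminormD[OF cstar_seminorm_spatial_norm]
  fix x y :: "('a, 'b) alg_tensor" and c :: complex
  show "snorm (x + y) \<le> snorm x + snorm y" by transfer (rule Q)
  show "snorm (c *\<^sub>C x) = cmod c * snorm x" by transfer (rule Q)
  show "snorm (x * y) \<le> snorm x * snorm y" by transfer (rule Q)
  show "snorm (star x * x) = (snorm x)\<^sup>2" by transfer (rule Q)
  obtain D :: "'a set" where D: "countable D" "\<And>x e. 0 < e \<Longrightarrow> \<exists>k\<in>D. dist x k < e"
    using second_countable_dense[where ?'a='a] by blast
  obtain E :: "'b set" where E: "countable E" "\<And>x e. 0 < e \<Longrightarrow> \<exists>k\<in>E. dist x k < e"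
    using second_countable_dense[where ?'a='b] by blast
  define L where "L = (\<lambda>(a, b). TPair a b) ` (D \<times> E)"
  have "\<exists>K. countable K \<and> (\<forall>f e. 0 < e \<longrightarrow>
      (\<exists>g\<in>K. spatial_norm (f - g :: ('a, 'b) tpair \<Rightarrow>\<^sub>0 complex) < e))"
  proof (rule monoid_algebra_separable[OF cstar_seminorm_spatial_norm])
    show "countable L" unfolding L_def using D E by simp
    fix k :: "('a, 'b) tpair" and e :: real assume e: "0 < e"
    obtain a b where k: "k = TPair a b" by (cases k)
    have "0 < min 1 (e / (2 * (norm b + 1)))" using e by (simp add: add_nonneg_pos)
    then obtain a' where a': "a' \<in> D" "norm (a - a') < min 1 (e / (2 * (norm b + 1)))"
      using D(2) unfolding dist_norm by blast
    have "0 < e / (2 * (norm a + 1))" using e by (simp add: add_nonneg_pos)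
    then obtain b' where b': "b' \<in> E" "norm (b - b') < e / (2 * (norm a + 1))"
      using E(2) unfolding dist_norm by blast
    let ?s = "\<lambda>a b. Poly_Mapping.single (TPair a b) (1::complex)"
    have r1: "spatial_norm (?s a b - ?s (a - a') b - ?s a' b) = 0"
      using spatial_norm_bilinear(1)[of "a - a'" a' b] by simp
    have r2: "spatial_norm (?s a' b - ?s a' (b - b') - ?s a' b') = 0"
      using spatial_norm_bilinear(2)[of a' "b - b'" b'] by simp
    have "?s a b - ?s a' b' = (?s a b - ?s (a - a') b - ?s a' b) +
      ((?s a' b - ?s a' (b - b') - ?s a' b') + (?s (a - a') b + ?s a' (b - b')))" by simp
    then have "spatial_norm (?s a b - ?s a' b') \<le> 0 + (0 + (spatial_norm (?s (a - a') b) + spatial_norm (?s a' (b - b'))))"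
      using Q(1) r1 r2 by (smt (verit))
    also have "\<dots> \<le> norm (a - a') * norm b + norm a' * norm (b - b')"
      by (simp add: add_mono spatial_norm_elementary)
    also have "\<dots> \<le> norm (a - a') * (norm b + 1) + (norm a + 1) * norm (b - b')"
    proof (intro add_mono mult_left_mono mult_right_mono)
      show "norm a' \<le> norm a + 1" using norm_triangle_ineq2[of a' a] a' by (simp add: norm_minus_commute)
    qed auto
    also have "\<dots> < e / 2 + e / 2"
    proof (rule add_strict_mono)
      have "0 < norm b + 1" "0 < norm a + 1" by (simp_all add: add_nonneg_pos)
      then show "norm (a - a') * (norm b + 1) < e / 2" "(norm a + 1) * norm (b - b') < e / 2"
        using a' b' by (simp_all add: field_simps)
    qed
    finally show "\<exists>l\<in>L. spatial_norm (Poly_Mapping.single k 1 - Poly_Mapping.single l 1) < e"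
      using a' b' unfolding L_def k by (auto intro!: bexI[of _ "TPair a' b'"])
  qed
  then obtain K where K: "countable K" "\<And>f e. 0 < e \<Longrightarrow> \<exists>g\<in>K. spatial_norm (f - g :: ('a, 'b) tpair \<Rightarrow>\<^sub>0 complex) < e"
    by blast
  show "\<exists>K::('a, 'b) alg_tensor set. countable K \<and> (\<forall>x e. 0 < e \<longrightarrow> (\<exists>k\<in>K. snorm (x - k) < e))"
  proof (intro exI[of _ "Abs_alg_tensor ` K"] conjI allI impI)
    show "countable (Abs_alg_tensor ` K)" using K by simp
    fix x :: "('a, 'b) alg_tensor" and e :: real assume "0 < e"
    then obtain g where "g \<in> K" "spatial_norm (Rep_alg_tensor x - g) < e" using K by blast
    then show "\<exists>k\<in>Abs_alg_tensor ` K. snorm (x - k) < e"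
      by (intro bexI[of _ "Abs_alg_tensor g"])
         (simp_all add: snorm_alg_tensor.rep_eq minus_alg_tensor.rep_eq Abs_alg_tensor_inverse)
  qed
qed

end

type_synonym ('a, 'b) min_tensor = "('a, 'b) alg_tensor cstar_completion"

lift_definition alg_tensor_of :: "'a \<Rightarrow> 'b \<Rightarrow> ('a, 'b) alg_tensor"
  is "\<lambda>a b. Poly_Mapping.single (TPair a b) 1" .

definition tensor :: "'a::separable_unital_cstar_algebra \<Rightarrow> 'b::separable_unital_cstar_algebra \<Rightarrow>
    ('a, 'b) min_tensor" (infixr "\<otimes>" 75) where
  "a \<otimes> b = compl_embed (alg_tensor_of a b)"

subsection \<open>Homomorphisms out of a completion\<close>

lemma unital_star_hom_compl_embed: "unital_star_hom compl_embed"
  by (simp add: unital_star_hom_def)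

lemma compl_embed_eqI: "snorm (x - y) = 0 \<Longrightarrow> compl_embed x = compl_embed y"
  by (metis compl_embed_diff eq_iff_diff_eq_0 norm_compl_embed norm_eq_zero)

lemma completion_hom_unique:
  fixes F G :: "'r::cstar_seminormed cstar_completion \<Rightarrow> 'd::unital_cstar_algebra"
  assumes "unital_star_hom F" "unital_star_hom G" "\<And>x. F (compl_embed x) = G (compl_embed x)"
  shows "F = G"
proof
  fix z
  have "norm (F z - G z) \<le> 0 + e" if e: "0 < e" for e
  proof -
    obtain x where x: "norm (z - compl_embed x) < e / 2" using compl_embed_dense[of "e / 2" z] e by auto
    have "F z - G z = F (z - compl_embed x) - G (z - compl_embed x)"
      by (simp add: unital_star_homD[OF assms(1)] unital_star_homD[OF assms(2)] assms(3))
    also have "norm \<dots> \<le> norm (F (z - compl_embed x)) + norm (G (z - compl_embed x))"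
      by (rule norm_triangle_ineq4)
    also have "\<dots> \<le> norm (z - compl_embed x) + norm (z - compl_embed x)"
      by (intro add_mono unital_star_hom_contractive assms)
    finally show ?thesis using x by simp
  qed
  then have "norm (F z - G z) \<le> 0" by (rule field_le_epsilon)
  then show "F z = G z" by simp
qed

lemma completion_extend:
  fixes \<phi> :: "'r::cstar_seminormed \<Rightarrow> 'd::unital_cstar_algebra"
  assumes \<phi>: "unital_star_hom \<phi>" and le: "\<And>x. norm (\<phi> x) \<le> snorm x"
  shows "\<exists>F. unital_star_hom F \<and> (\<forall>x. F (compl_embed x) = \<phi> x)"
proof -
  note H = unital_star_homD[OF \<phi>]
  have ex: "\<exists>X. (\<lambda>n. compl_embed (X n :: 'r)) \<longlonglongrightarrow> z" for z
  proof -
    have "\<forall>n. \<exists>x::'r. norm (z - compl_embed x) < 1 / Suc n" by (intro allI compl_embed_dense) simp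
    then obtain X :: "nat \<Rightarrow> 'r" where X: "\<And>n. norm (z - compl_embed (X n)) < 1 / Suc n" by metis
    have "(\<lambda>n. z - compl_embed (X n)) \<longlonglongrightarrow> 0"
      by (rule Lim_null_comparison[OF _ LIMSEQ_Suc[OF lim_const_over_n[of 1]]])
         (use X in \<open>auto intro!: always_eventually less_imp_le simp: divide_inverse\<close>)
    from tendsto_diff[OF tendsto_const[of z] this] show ?thesis by auto
  qed
  define S where "S z = (SOME X. (\<lambda>n. compl_embed (X n :: 'r)) \<longlonglongrightarrow> z)" for z
  have S: "(\<lambda>n. compl_embed (S z n)) \<longlonglongrightarrow> z" for z
    unfolding S_def by (rule someI_ex[OF ex])
  have zero: "(\<lambda>n. \<phi> (X n)) \<longlonglongrightarrow> 0" if "(\<lambda>n. compl_embed (X n)) \<longlonglongrightarrow> 0" for X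
    by (rule Lim_null_comparison[of _ "\<lambda>n. snorm (X n)"])
       (use tendsto_norm_zero[OF that] le in simp_all)
  have cau: "Cauchy (\<lambda>n. \<phi> (X n))" if X: "(\<lambda>n. compl_embed (X n)) \<longlonglongrightarrow> z" for X z
  proof (rule metric_CauchyI)
    fix e :: real assume "0 < e"
    then obtain N where N: "\<And>m n. m \<ge> N \<Longrightarrow> n \<ge> N \<Longrightarrow> dist (compl_embed (X m)) (compl_embed (X n)) < e"
      using LIMSEQ_imp_Cauchy[OF X] unfolding Cauchy_def by meson
    have "dist (\<phi> (X m)) (\<phi> (X n)) \<le> dist (compl_embed (X m)) (compl_embed (X n))" for m n
      using le[of "X m - X n"] by (simp add: dist_norm H flip: norm_compl_embed)
    then show "\<exists>N. \<forall>m\<ge>N. \<forall>n\<ge>N. dist (\<phi> (X m)) (\<phi> (X n)) < e"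
      using N by (meson le_less_trans)
  qed
  define F where "F z = lim (\<lambda>n. \<phi> (S z n))" for z
  have FS: "(\<lambda>n. \<phi> (S z n)) \<longlonglongrightarrow> F z" for z
    using Cauchy_convergent[OF cau[OF S]] unfolding F_def by (simp add: convergent_LIMSEQ_iff)
  have F: "F z = l" if X: "(\<lambda>n. compl_embed (X n)) \<longlonglongrightarrow> z" and l: "(\<lambda>n. \<phi> (X n)) \<longlonglongrightarrow> l" for X z l
  proof -
    have "(\<lambda>n. compl_embed (X n - S z n)) \<longlonglongrightarrow> 0" using tendsto_diff[OF X S[of z]] by simp
    from zero[OF this] have d: "(\<lambda>n. \<phi> (X n) - \<phi> (S z n)) \<longlonglongrightarrow> 0" by (simp add: H)
    have "(\<lambda>n. \<phi> (X n)) \<longlonglongrightarrow> F z" using tendsto_add[OF d FS[of z]] by simp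
    then show ?thesis using l LIMSEQ_unique by blast
  qed
  have "unital_star_hom F"
    unfolding unital_star_hom_def
  proof (intro conjI allI)
    fix x y c
    show "F (x + y) = F x + F y"
      by (rule F[of "\<lambda>n. S x n + S y n"]) (simp_all add: H tendsto_add S FS)
    show "F (x * y) = F x * F y"
      by (rule F[of "\<lambda>n. S x n * S y n"]) (simp_all add: H tendsto_mult S FS)
    have bl: "bounded_linear (\<lambda>x. c *\<^sub>C x :: 'e::unital_cstar_algebra)" for c
      by (rule bounded_linear_intro[of _ "cmod c"])
         (simp_all add: scaleC_add_right scaleR_scaleC norm_scaleC mult.commute)
    show "F (c *\<^sub>C x) = c *\<^sub>C F x"
      by (rule F[of "\<lambda>n. c *\<^sub>C S x n"]) (simp_all add: H bounded_linear.tendsto[OF bl] S FS)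
    show "F (star x) = star (F x)"
      by (rule F[of "\<lambda>n. star (S x n)"]) (simp_all add: H bounded_linear.tendsto[OF bounded_linear_star] S FS)
    show "F 1 = 1"
      by (rule F[of "\<lambda>n. 1"]) (simp_all add: H)
  qed
  moreover have "F (compl_embed x) = \<phi> x" for x
    by (rule F[of "\<lambda>n. x"]) simp_all
  ultimately show ?thesis by blast
qed

subsection \<open>Elementary tensors and tensor products of homomorphisms\<close>

lemma alg_tensor_null:
  "spatial_norm (Rep_alg_tensor x - Rep_alg_tensor y) = 0 \<Longrightarrow> compl_embed x = compl_embed y"
  by (rule compl_embed_eqI) (simp add: snorm_alg_tensor.rep_eq minus_alg_tensor.rep_eq)

lemma tensor_simps:
  fixes a a' :: "'a::separable_unital_cstar_algebra" and b b' :: "'b::separable_unital_cstar_algebra"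
  shows
  "(a + a') \<otimes> b = a \<otimes> b + a' \<otimes> b" "a \<otimes> (b + b') = a \<otimes> b + a \<otimes> b'"
  "(c *\<^sub>C a) \<otimes> b = c *\<^sub>C (a \<otimes> b)" "a \<otimes> (c *\<^sub>C b) = c *\<^sub>C (a \<otimes> b)"
  "(a \<otimes> b) * (a' \<otimes> b') = (a * a') \<otimes> (b * b')" "star (a \<otimes> b) = star a \<otimes> star b"
  "(1::'a) \<otimes> (1::'b) = 1"
proof -
  note R = plus_alg_tensor.rep_eq alg_tensor_of.rep_eq scaleC_alg_tensor.rep_eq diff_diff_eq[symmetric]
  show "(a + a') \<otimes> b = a \<otimes> b + a' \<otimes> b" "a \<otimes> (b + b') = a \<otimes> b + a \<otimes> b'"
    unfolding tensor_def compl_embed_simps(1)[symmetric]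
    by (rule alg_tensor_null, simp only: R spatial_norm_bilinear)+
  show "(c *\<^sub>C a) \<otimes> b = c *\<^sub>C (a \<otimes> b)" "a \<otimes> (c *\<^sub>C b) = c *\<^sub>C (a \<otimes> b)"
    unfolding tensor_def compl_embed_simps(3)[symmetric]
    by (rule alg_tensor_null, simp only: R spatial_norm_bilinear)+
  have "alg_tensor_of a b * alg_tensor_of a' b' = alg_tensor_of (a * a') (b * b')"
    by transfer (simp add: mult_single plus_tpair_def)
  then show "(a \<otimes> b) * (a' \<otimes> b') = (a * a') \<otimes> (b * b')"
    unfolding tensor_def by (metis compl_embed_simps(2))
  have "star (alg_tensor_of a b) = alg_tensor_of (star a) (star b)"
    by transfer (simp add: star_tpair_def star_complex_def)
  then show "star (a \<otimes> b) = star a \<otimes> star b"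
    unfolding tensor_def by (metis compl_embed_simps(4))
  have "alg_tensor_of 1 1 = (1 :: ('a, 'b) alg_tensor)"
    by transfer (simp add: zero_tpair_def[symmetric])
  then show "(1::'a) \<otimes> (1::'b) = 1" unfolding tensor_def by simp
qed

lemma alg_tensor_additive_induct:
  fixes x :: "('a::separable_unital_cstar_algebra, 'b::separable_unital_cstar_algebra) alg_tensor"
  assumes "P 0" "\<And>c a b. P (c *\<^sub>C alg_tensor_of a b)" "\<And>x y. P x \<Longrightarrow> P y \<Longrightarrow> P (x + y)"
  shows "P x"
proof -
  have "P (Abs_alg_tensor f)" for f
  proof (induction f rule: poly_mapping_additive_induct)
    case 1
    show ?case using assms(1) unfolding zero_alg_tensor_def .
  next
    case (2 p c)
    have "Abs_alg_tensor (Poly_Mapping.single p c) = c *\<^sub>C alg_tensor_of (tfst p) (tsnd p)"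
      by (simp add: alg_tensor_of_def scaleC_alg_tensor.abs_eq eq_onp_def scaleC_complex_def)
    then show ?case using assms(2) by simp
  next
    case (3 f g)
    have "Abs_alg_tensor (f + g) = Abs_alg_tensor f + Abs_alg_tensor g"
      by (simp add: plus_alg_tensor.abs_eq)
    then show ?case using assms(3)[OF 3] by metis
  qed
  from this[of "Rep_alg_tensor x"] show ?thesis by (simp only: Rep_alg_tensor_inverse)
qed

lemma min_tensor_hom_unique:
  fixes F G :: "('a::separable_unital_cstar_algebra, 'b::separable_unital_cstar_algebra) min_tensor \<Rightarrow> 'd::unital_cstar_algebra"
  assumes "unital_star_hom F" "unital_star_hom G" "\<And>a b. F (a \<otimes> b) = G (a \<otimes> b)"
  shows "F = G"
proof (rule completion_hom_unique[OF assms(1,2)])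
  fix x
  show "F (compl_embed x) = G (compl_embed x)"
  proof (induction x rule: alg_tensor_additive_induct)
    case 1
    show ?case by (simp add: unital_star_homD[OF assms(1)] unital_star_homD[OF assms(2)])
  next
    case (2 c a b)
    show ?case
      using assms(3)[of a b]
      by (simp add: tensor_def unital_star_homD[OF assms(1)] unital_star_homD[OF assms(2)])
  next
    case (3 x y)
    then show ?case by (simp add: unital_star_homD[OF assms(1)] unital_star_homD[OF assms(2)])
  qed
qed

lemma star_rep_comp:
  "star_rep \<pi> \<Longrightarrow> unital_star_hom f \<Longrightarrow> star_rep (\<lambda>a. \<pi> (f a))"
  by (simp add: star_rep_def unital_star_homD)

lemma tensor_map_ex1:
  fixes f :: "'a::separable_unital_cstar_algebra \<Rightarrow> 'c::separable_unital_cstar_algebra"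
    and g :: "'b::separable_unital_cstar_algebra \<Rightarrow> 'd::separable_unital_cstar_algebra"
  assumes f: "unital_star_hom f" and g: "unital_star_hom g"
  shows "\<exists>!h. unital_star_hom h \<and> (\<forall>a b. h (a \<otimes> b) = f a \<otimes> g b)"
proof -
  note Hf = unital_star_homD[OF f] and Hg = unital_star_homD[OF g]
  define m where "m p = Poly_Mapping.single (TPair (f (tfst p)) (g (tsnd p))) (1::complex)"
    for p :: "('a, 'b) tpair"
  have m: "unital_star_hom (lin_ext m)"
    by (rule unital_star_hom_lin_ext)
       (simp_all add: m_def plus_tpair_def star_tpair_def mult_single Hf Hg zero_tpair_def star_complex_def,
        simp add: zero_tpair_def[symmetric])
  define \<phi> where "\<phi> x = compl_embed (Abs_alg_tensor (lin_ext m (Rep_alg_tensor x)))"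
    for x :: "('a, 'b) alg_tensor"
  have \<phi>: "unital_star_hom \<phi>"
  proof -
    have "unital_star_hom (\<lambda>x :: ('a, 'b) alg_tensor. Abs_alg_tensor (lin_ext m (Rep_alg_tensor x)))"
      unfolding unital_star_hom_def
      by (simp add: plus_alg_tensor.rep_eq times_alg_tensor.rep_eq scaleC_alg_tensor.rep_eq
          one_alg_tensor.rep_eq star_alg_tensor.rep_eq unital_star_homD[OF m]
          plus_alg_tensor.abs_eq times_alg_tensor.abs_eq scaleC_alg_tensor.abs_eq
          star_alg_tensor.abs_eq one_alg_tensor_def eq_onp_def Abs_alg_tensor_inverse)
    from unital_star_hom_comp[OF unital_star_hom_compl_embed this]
    show ?thesis by (simp add: \<phi>_def[abs_def] o_def)
  qed
  have le: "spatial_norm (lin_ext m f') \<le> spatial_norm f'" for f'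
  proof (rule spatial_norm_least)
    fix \<pi> :: "'c \<Rightarrow> nat ell2 \<Rightarrow> nat ell2" and \<sigma> :: "'d \<Rightarrow> nat ell2 \<Rightarrow> nat ell2"
    assume r: "star_rep \<pi>" "star_rep \<sigma>"
    have "tensor_rep \<pi> \<sigma> (lin_ext m f') z = tensor_rep (\<lambda>a. \<pi> (f a)) (\<lambda>b. \<sigma> (g b)) f' z" for z
      by (induction f' rule: poly_mapping_additive_induct)
         (simp_all add: tensor_rep_simps lin_ext_add m_def scaleC_complex_def)
    then have "tensor_rep \<pi> \<sigma> (lin_ext m f') = tensor_rep (\<lambda>a. \<pi> (f a)) (\<lambda>b. \<sigma> (g b)) f'"
      by (rule ext)
    then have "onorm (tensor_rep \<pi> \<sigma> (lin_ext m f')) = onorm (tensor_rep (\<lambda>a. \<pi> (f a)) (\<lambda>b. \<sigma> (g b)) f')"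
      by (rule arg_cong)
    also have "\<dots> \<le> spatial_norm f'"
      by (rule spatial_norm_upper[OF star_rep_comp[OF r(1) f] star_rep_comp[OF r(2) g]])
    finally show "onorm (tensor_rep \<pi> \<sigma> (lin_ext m f')) \<le> spatial_norm f'" .
  qed
  have "norm (\<phi> x) \<le> snorm x" for x
    by (simp add: \<phi>_def snorm_alg_tensor.rep_eq Abs_alg_tensor_inverse le)
  then obtain F where F: "unital_star_hom F" "\<And>x. F (compl_embed x) = \<phi> x"
    using completion_extend[OF \<phi>] by blast
  have "F (a \<otimes> b) = f a \<otimes> g b" for a b
    by (simp add: tensor_def F \<phi>_def alg_tensor_of.rep_eq m_def alg_tensor_of_def
        Abs_alg_tensor_inverse)
  with F(1) show ?thesis
    by (intro ex1I[of _ F]) (auto intro: min_tensor_hom_unique)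
qed

section \<open>The unital free product of copies of an algebra\<close>

datatype ('n, 'a) fword = FWord (letters: "('n \<times> 'a) list")

instantiation fword :: (type, star_algebra) star_monoid
begin

definition "0 = FWord []"
definition "v + w = FWord (letters v @ letters w)"
definition "star w = FWord (rev (map (map_prod id star) (letters w)))"

instance
  by standard (auto simp: zero_fword_def plus_fword_def star_fword_def rev_map
      o_def map_prod_def case_prod_beta)

end

text \<open>The free unital star-algebra on the letters \<open>(k, a)\<close>, where \<open>(k, a)\<close> stands for the element \<open>a\<close> of
  the \<open>k\<close>-th copy and \<open>(k, a)\<^sup>* = (k, a\<^sup>*)\<close>. The norm is the largest C*-seminorm for which every
  \<open>a \<mapsto> (k, a)\<close> becomes a homomorphism, with the units of all copies identified with the empty word;
  the separated completion is the full free product amalgamated over the unit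
  (\<open>free_power_universal\<close> below).\<close>

typedef ('n, 'a) alg_free_power = "UNIV :: (('n, 'a) fword \<Rightarrow>\<^sub>0 complex) set" ..

setup_lifting type_definition_alg_free_power

instantiation alg_free_power :: (type, star_algebra) star_algebra
begin

lift_definition zero_alg_free_power :: "('a, 'b) alg_free_power" is 0 .
lift_definition one_alg_free_power :: "('a, 'b) alg_free_power" is 1 .
lift_definition plus_alg_free_power :: "('a, 'b) alg_free_power \<Rightarrow> ('a, 'b) alg_free_power \<Rightarrow> ('a, 'b) alg_free_power" is "(+)" .
lift_definition minus_alg_free_power :: "('a, 'b) alg_free_power \<Rightarrow> ('a, 'b) alg_free_power \<Rightarrow> ('a, 'b) alg_free_power" is "(-)" .
lift_definition uminus_alg_free_power :: "('a, 'b) alg_free_power \<Rightarrow> ('a, 'b) alg_free_power" is uminus .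
lift_definition times_alg_free_power :: "('a, 'b) alg_free_power \<Rightarrow> ('a, 'b) alg_free_power \<Rightarrow> ('a, 'b) alg_free_power" is "(*)" .
lift_definition scaleC_alg_free_power :: "complex \<Rightarrow> ('a, 'b) alg_free_power \<Rightarrow> ('a, 'b) alg_free_power" is scaleC .
lift_definition scaleR_alg_free_power :: "real \<Rightarrow> ('a, 'b) alg_free_power \<Rightarrow> ('a, 'b) alg_free_power" is scaleR .
lift_definition star_alg_free_power :: "('a, 'b) alg_free_power \<Rightarrow> ('a, 'b) alg_free_power" is star .

instance
  by standard (transfer, simp add: algebra_simps scaleC_add_right scaleC_add_left scaleR_scaleC
      star_add star_scaleC star_mult)+

end

definition letter :: "'n \<Rightarrow> 'a \<Rightarrow> ('n, 'a::star_algebra) fword \<Rightarrow>\<^sub>0 complex" where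
  "letter k a = Poly_Mapping.single (FWord [(k, a)]) 1"

definition free_relations :: "((('n, 'a::star_algebra) fword \<Rightarrow>\<^sub>0 complex) \<Rightarrow> real) \<Rightarrow> bool" where
  "free_relations q \<longleftrightarrow>
     (\<forall>k a b. q (letter k (a + b) - (letter k a + letter k b)) = 0) \<and>
     (\<forall>k c a. q (letter k (c *\<^sub>C a) - c *\<^sub>C letter k a) = 0) \<and>
     (\<forall>k a b. q (letter k (a * b) - letter k a * letter k b) = 0) \<and>
     (\<forall>k. q (letter k 1 - 1) = 0)"

definition free_norm :: "(('n, 'a::star_algebra) fword \<Rightarrow>\<^sub>0 complex) \<Rightarrow> real" where
  "free_norm f = (SUP q \<in> {q. cstar_seminorm q \<and> free_relations q}. q f)"

lemma star_letter: "star (letter k a) = letter k (star a)"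
  by (simp add: letter_def star_fword_def star_complex_def)

lemma cstar_seminorm_eqI:
  "cstar_seminorm q \<Longrightarrow> q (x - y) = 0 \<Longrightarrow> q x = q y"
  using cstar_seminormD(12)[of q x y] by simp

lemma letter_seminorm:
  assumes q: "cstar_seminorm q" "free_relations q"
  shows "cstar_seminorm (\<lambda>a. q (letter k a))"
proof -
  note Q = cstar_seminormD[OF q(1)]
  have 1: "q (letter k (a + b)) = q (letter k a + letter k b)" for a b
    using q by (intro cstar_seminorm_eqI) (auto simp: free_relations_def)
  have 2: "q (letter k (c *\<^sub>C a)) = q (c *\<^sub>C letter k a)" for a c
    using q by (intro cstar_seminorm_eqI) (auto simp: free_relations_def)
  have 3: "q (letter k (a * b)) = q (letter k a * letter k b)" for a b
    using q by (intro cstar_seminorm_eqI) (auto simp: free_relations_def)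
  show ?thesis
    unfolding cstar_seminorm_def 1 2 3 by (simp add: Q star_letter[symmetric])
qed

lemma free_letter_le:
  assumes "cstar_seminorm q" "free_relations q"
  shows "q (letter k a) \<le> norm (a::'a::unital_cstar_algebra)"
  by (rule cstar_seminorm_le_norm[OF letter_seminorm[OF assms]])

lemma free_word_le:
  assumes q: "cstar_seminorm q" "free_relations q"
  shows "q (Poly_Mapping.single (FWord w) 1) \<le> (\<Prod>(k, a)\<leftarrow>w. norm (a::'a::unital_cstar_algebra))"
proof (induction w)
  case Nil
  then show ?case using cstar_seminormD(11)[OF q(1)] by (simp flip: zero_fword_def)
next
  case (Cons p w)
  obtain k a where p: "p = (k, a)" by (cases p)
  have "Poly_Mapping.single (FWord (p # w)) 1 = letter k a * Poly_Mapping.single (FWord w) 1"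
    by (simp add: letter_def mult_single plus_fword_def p)
  then have "q (Poly_Mapping.single (FWord (p # w)) 1) \<le> q (letter k a) * q (Poly_Mapping.single (FWord w) 1)"
    by (simp add: cstar_seminormD[OF q(1)])
  also have "\<dots> \<le> norm a * (\<Prod>(k, a)\<leftarrow>w. norm a)"
    by (rule mult_mono[OF free_letter_le[OF q] Cons.IH]) (simp_all add: cstar_seminormD[OF q(1)])
  finally show ?case by (simp add: p)
qed

lemma free_norm_bdd:
  fixes f :: "('n, 'a::unital_cstar_algebra) fword \<Rightarrow>\<^sub>0 complex"
  shows "bdd_above ((\<lambda>q. q f) ` {q. cstar_seminorm q \<and> free_relations q})"
proof (rule bdd_aboveI2)
  fix q :: "(('n, 'a) fword \<Rightarrow>\<^sub>0 complex) \<Rightarrow> real"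
  assume "q \<in> {q. cstar_seminorm q \<and> free_relations q}"
  then have q: "cstar_seminorm q" "free_relations q" by auto
  show "q f \<le> (\<Sum>w\<in>Poly_Mapping.keys f. cmod (Poly_Mapping.lookup f w) *
      (\<Prod>(k, a)\<leftarrow>letters w. norm a))"
    by (rule monoid_algebra_bound[OF q(1)]) (metis free_word_le[OF q] fword.collapse)
qed

lemma free_norm_upper:
  "cstar_seminorm q \<Longrightarrow> free_relations q \<Longrightarrow> q f \<le> free_norm (f :: ('n, 'a::unital_cstar_algebra) fword \<Rightarrow>\<^sub>0 complex)"
  unfolding free_norm_def by (rule cSUP_upper[OF _ free_norm_bdd]) simp

lemma free_seminorms_nonempty: "{q. cstar_seminorm q \<and> free_relations q} \<noteq> {}"
proof -
  have "(\<lambda>x. 0) \<in> {q. cstar_seminorm q \<and> free_relations q}"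
    by (simp add: cstar_seminorm_def free_relations_def)
  then show ?thesis by blast
qed

lemma free_norm_least:
  "(\<And>q. cstar_seminorm q \<Longrightarrow> free_relations q \<Longrightarrow> q f \<le> u) \<Longrightarrow> free_norm f \<le> u"
  unfolding free_norm_def by (rule cSUP_least[OF free_seminorms_nonempty]) simp

lemma cstar_seminorm_free_norm:
  "cstar_seminorm (free_norm :: (('n, 'a::unital_cstar_algebra) fword \<Rightarrow>\<^sub>0 complex) \<Rightarrow> real)"
  unfolding free_norm_def[abs_def]
  by (rule cstar_seminorm_SUP[OF free_seminorms_nonempty _ free_norm_bdd]) simp

lemma free_relations_free_norm:
  "free_relations (free_norm :: (('n, 'a::unital_cstar_algebra) fword \<Rightarrow>\<^sub>0 complex) \<Rightarrow> real)"
proof -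
  have z: "free_norm f = 0" if "\<And>q. cstar_seminorm q \<Longrightarrow> free_relations q \<Longrightarrow> q f = 0"
    for f :: "('n, 'a) fword \<Rightarrow>\<^sub>0 complex"
    by (rule antisym[OF free_norm_least cstar_seminormD(7)[OF cstar_seminorm_free_norm]]) (simp add: that)
  show ?thesis
    unfolding free_relations_def by (intro conjI allI; rule z; simp add: free_relations_def)
qed

instantiation alg_free_power :: (finite, separable_unital_cstar_algebra) separable_cstar_seminormed
begin

lift_definition snorm_alg_free_power :: "('a, 'b) alg_free_power \<Rightarrow> real" is free_norm .

instance
proof
  note Q = cstar_seminormD[OF cstar_seminorm_free_norm]
  note rel = free_relations_free_norm[unfolded free_relations_def]
  fix x y :: "('a, 'b) alg_free_power" and c :: complex
  show "snorm (x + y) \<le> snorm x + snorm y" by transfer (rule Q)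
  show "snorm (c *\<^sub>C x) = cmod c * snorm x" by transfer (rule Q)
  show "snorm (x * y) \<le> snorm x * snorm y" by transfer (rule Q)
  show "snorm (star x * x) = (snorm x)\<^sup>2" by transfer (rule Q)
  obtain D :: "'b set" where D: "countable D" "\<And>x e. 0 < e \<Longrightarrow> \<exists>k\<in>D. dist x k < e"
    using second_countable_dense[where ?'a='b] by blast
  define L where "L = (FWord :: ('a \<times> 'b) list \<Rightarrow> _) ` lists (UNIV \<times> D)"
  have "\<exists>K. countable K \<and> (\<forall>f e. 0 < e \<longrightarrow>
      (\<exists>g\<in>K. free_norm (f - g :: ('a, 'b) fword \<Rightarrow>\<^sub>0 complex) < e))"
  proof (rule monoid_algebra_separable[OF cstar_seminorm_free_norm])
    show "countable L" unfolding L_def using D by (intro countable_image countable_lists countable_SIGMA) auto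
    let ?s = "\<lambda>w :: ('a \<times> 'b) list. Poly_Mapping.single (FWord w) (1::complex)"
    have "\<forall>e>0. \<exists>v\<in>lists (UNIV \<times> D). free_norm (?s w - ?s v) < e" for w
    proof (induction w)
      case Nil
      show ?case by (auto intro!: bexI[of _ "[]"] simp: Q)
    next
      case (Cons p w)
      obtain k a where p: "p = (k, a)" by (cases p)
      show ?case
      proof (intro allI impI)
        fix e :: real assume e: "0 < e"
        define M where "M = free_norm (?s w) + 1"
        have M: "0 < M" "free_norm (?s w) < M" using Q(7)[of "?s w"] by (simp_all add: M_def)
        have "0 < min 1 (e / (2 * M))" using e M by simp
        then obtain a' where a': "a' \<in> D" "norm (a - a') < min 1 (e / (2 * M))"
          using D(2) unfolding dist_norm by blast
        have "0 < e / (2 * (norm a + 1))" using e by (simp add: add_nonneg_pos)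
        then obtain v where v: "v \<in> lists (UNIV \<times> D)" "free_norm (?s w - ?s v) < e / (2 * (norm a + 1))"
          using Cons.IH by blast
        have s: "?s ((k, b) # u) = letter k b * ?s u" for b u
          by (simp add: letter_def mult_single plus_fword_def)
        have l1: "free_norm (letter k a - letter k a') \<le> norm (a - a')"
        proof -
          have "free_norm (letter k ((a - a') + a') - (letter k (a - a') + letter k a')) = 0"
            by (rule rel[THEN conjunct1, rule_format])
          then have "free_norm ((letter k a - letter k a') - letter k (a - a')) = 0"
            by (simp add: algebra_simps)
          then have "free_norm (letter k a - letter k a') = free_norm (letter k (a - a'))"
            by (rule cstar_seminorm_eqI[OF cstar_seminorm_free_norm])
          then show ?thesis
            using free_letter_le[OF cstar_seminorm_free_norm free_relations_free_norm] by metis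
        qed
        have l2: "free_norm (letter k a') \<le> norm a + 1"
        proof -
          have "free_norm (letter k a') \<le> norm a'"
            by (rule free_letter_le[OF cstar_seminorm_free_norm free_relations_free_norm])
          also have "\<dots> \<le> norm a + 1"
            using norm_triangle_ineq2[of a' a] a' by (simp add: norm_minus_commute)
          finally show ?thesis .
        qed
        have "?s (p # w) - ?s ((k, a') # v) = (letter k a - letter k a') * ?s w + letter k a' * (?s w - ?s v)"
          unfolding p s by (simp add: algebra_simps)
        then have "free_norm (?s (p # w) - ?s ((k, a') # v)) \<le>
            free_norm ((letter k a - letter k a') * ?s w) + free_norm (letter k a' * (?s w - ?s v))"
          by (metis Q(1))
        also have "\<dots> \<le> free_norm (letter k a - letter k a') * free_norm (?s w) +
            free_norm (letter k a') * free_norm (?s w - ?s v)"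
          by (intro add_mono Q(3))
        also have "\<dots> \<le> norm (a - a') * M + (norm a + 1) * free_norm (?s w - ?s v)"
          using M by (intro add_mono mult_mono l1 l2 Q(7)) auto
        also have "\<dots> < e / 2 + e / 2"
        proof (rule add_strict_mono)
          have "0 < norm a + 1" by (simp add: add_nonneg_pos)
          then show "norm (a - a') * M < e / 2" "(norm a + 1) * free_norm (?s w - ?s v) < e / 2"
            using a' v M by (simp_all add: field_simps)
        qed
        finally show "\<exists>v\<in>lists (UNIV \<times> D). free_norm (?s (p # w) - ?s v) < e"
          using a' v by (intro bexI[of _ "(k, a') # v"]) auto
      qed
    qed
    then show "\<exists>l\<in>L. free_norm (Poly_Mapping.single k 1 - Poly_Mapping.single l 1) < e"
      if "0 < e" for k :: "('a, 'b) fword" and e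
      using that unfolding L_def by (cases k) blast
  qed
  then obtain K where K: "countable K" "\<And>f e. 0 < e \<Longrightarrow> \<exists>g\<in>K. free_norm (f - g :: ('a, 'b) fword \<Rightarrow>\<^sub>0 complex) < e"
    by blast
  show "\<exists>K::('a, 'b) alg_free_power set. countable K \<and> (\<forall>x e. 0 < e \<longrightarrow> (\<exists>k\<in>K. snorm (x - k) < e))"
  proof (intro exI[of _ "Abs_alg_free_power ` K"] conjI allI impI)
    show "countable (Abs_alg_free_power ` K)" using K by simp
    fix x :: "('a, 'b) alg_free_power" and e :: real assume "0 < e"
    then obtain g where "g \<in> K" "free_norm (Rep_alg_free_power x - g) < e" using K by blast
    then show "\<exists>k\<in>Abs_alg_free_power ` K. snorm (x - k) < e"
      by (intro bexI[of _ "Abs_alg_free_power g"])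
         (simp_all add: snorm_alg_free_power.rep_eq minus_alg_free_power.rep_eq Abs_alg_free_power_inverse)
  qed
qed

end

type_synonym ('n, 'a) free_power = "('n, 'a) alg_free_power cstar_completion"

lift_definition alg_free_incl :: "'n \<Rightarrow> 'a \<Rightarrow> ('n, 'a::star_algebra) alg_free_power" is letter .

definition free_incl :: "'n::finite \<Rightarrow> 'a::separable_unital_cstar_algebra \<Rightarrow> ('n, 'a) free_power" where
  "free_incl k a = compl_embed (alg_free_incl k a)"

lemma alg_free_null:
  "free_norm (Rep_alg_free_power x - Rep_alg_free_power y) = 0 \<Longrightarrow> compl_embed x = compl_embed y"
  by (rule compl_embed_eqI) (simp add: snorm_alg_free_power.rep_eq minus_alg_free_power.rep_eq)

lemma unital_star_hom_free_incl:
  fixes k :: "'n::finite"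
  shows "unital_star_hom (free_incl k :: 'a::separable_unital_cstar_algebra \<Rightarrow> ('n, 'a) free_power)"
proof -
  note R = plus_alg_free_power.rep_eq alg_free_incl.rep_eq scaleC_alg_free_power.rep_eq
    times_alg_free_power.rep_eq one_alg_free_power.rep_eq
  note rel = free_relations_free_norm[unfolded free_relations_def]
  have s: "alg_free_incl k (star a) = star (alg_free_incl k a)" for a :: 'a
    by transfer (simp add: star_letter)
  then show ?thesis
    unfolding unital_star_hom_def free_incl_def compl_embed_simps[symmetric]
    by (intro conjI allI alg_free_null; 
        simp only: R rel s diff_self cstar_seminormD(5)[OF cstar_seminorm_free_norm])
qed

theorem free_power_universal:
  fixes \<psi> :: "'n::finite \<Rightarrow> 'a::separable_unital_cstar_algebra \<Rightarrow> 'd::unital_cstar_algebra"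
  assumes \<psi>: "\<And>k. unital_star_hom (\<psi> k)"
  shows "\<exists>!\<Lambda>. unital_star_hom \<Lambda> \<and> (\<forall>k a. \<Lambda> (free_incl k a) = \<psi> k a)"
proof -
  note H = unital_star_homD[OF \<psi>]
  define m where "m w = prod_list (map (\<lambda>(k, a). \<psi> k a) (letters w))" for w
  have st: "m (star w) = star (m w)" for w
  proof -
    have "prod_list (map (\<lambda>(k, a). \<psi> k a) (rev (map (map_prod id star) ws))) =
        star (prod_list (map (\<lambda>(k, a). \<psi> k a) ws))" for ws
      by (induction ws) (auto simp: star_mult H)
    then show ?thesis by (simp add: m_def star_fword_def)
  qed
  have m: "unital_star_hom (lin_ext m)"
    by (rule unital_star_hom_lin_ext) (simp_all add: st, simp_all add: m_def plus_fword_def zero_fword_def)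
  have ml: "lin_ext m (letter k a) = \<psi> k a" for k a by (simp add: letter_def m_def)
  define q where "q f = norm (lin_ext m f)" for f
  have q: "cstar_seminorm q"
    unfolding q_def by (rule cstar_seminorm_pullback[OF m cstar_seminorm_norm])
  have "free_relations q"
    unfolding free_relations_def q_def by (simp add: unital_star_homD[OF m] ml H)
  with q have le: "q f \<le> free_norm f" for f by (rule free_norm_upper)
  define \<phi> where "\<phi> x = lin_ext m (Rep_alg_free_power x)" for x
  have \<phi>: "unital_star_hom \<phi>"
    unfolding unital_star_hom_def \<phi>_def
    by (simp add: plus_alg_free_power.rep_eq times_alg_free_power.rep_eq scaleC_alg_free_power.rep_eq
        one_alg_free_power.rep_eq star_alg_free_power.rep_eq unital_star_homD[OF m])
  have "norm (\<phi> x) \<le> snorm x" for x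
    using le[of "Rep_alg_free_power x"] by (simp add: \<phi>_def q_def snorm_alg_free_power.rep_eq)
  then obtain F where F: "unital_star_hom F" "\<And>x. F (compl_embed x) = \<phi> x"
    using completion_extend[OF \<phi>] by blast
  have Fi: "F (free_incl k a) = \<psi> k a" for k a
    by (simp add: free_incl_def F \<phi>_def alg_free_incl.rep_eq ml)
  have uniq: "G = F" if G: "unital_star_hom G" "\<And>k a. G (free_incl k a) = \<psi> k a" for G
  proof (rule completion_hom_unique[OF G(1) F(1)])
    fix x
    have w: "G (compl_embed (Abs_alg_free_power (Poly_Mapping.single (FWord ws) 1))) =
        F (compl_embed (Abs_alg_free_power (Poly_Mapping.single (FWord ws) 1)))" for ws
    proof (induction ws)
      case Nil
      have "Abs_alg_free_power (Poly_Mapping.single (FWord []) 1) = (1 :: ('n, 'a) alg_free_power)"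
        by (simp add: one_alg_free_power_def flip: zero_fword_def)
      then show ?case by (simp add: unital_star_homD[OF G(1)] unital_star_homD[OF F(1)])
    next
      case (Cons p ws)
      obtain k a where p: "p = (k, a)" by (cases p)
      have "Abs_alg_free_power (Poly_Mapping.single (FWord (p # ws)) 1) =
          alg_free_incl k a * Abs_alg_free_power (Poly_Mapping.single (FWord ws) 1)"
        by (simp add: alg_free_incl_def times_alg_free_power.abs_eq eq_onp_def letter_def mult_single plus_fword_def p)
      then have "compl_embed (Abs_alg_free_power (Poly_Mapping.single (FWord (p # ws)) 1)) =
          free_incl k a * compl_embed (Abs_alg_free_power (Poly_Mapping.single (FWord ws) 1))"
        by (simp add: free_incl_def)
      then show ?case
        by (simp add: unital_star_homD[OF G(1)] unital_star_homD[OF F(1)] G(2) Fi Cons.IH)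
    qed
    have "G (compl_embed (Abs_alg_free_power f)) = F (compl_embed (Abs_alg_free_power f))" for f
    proof (induction f rule: poly_mapping_additive_induct)
      case 1
      have "Abs_alg_free_power 0 = (0 :: ('n, 'a) alg_free_power)" by (simp add: zero_alg_free_power_def)
      then show ?case by (simp add: unital_star_homD[OF G(1)] unital_star_homD[OF F(1)])
    next
      case (2 v c)
      have "Abs_alg_free_power (Poly_Mapping.single v c) = c *\<^sub>C Abs_alg_free_power (Poly_Mapping.single (FWord (letters v)) 1)"
        by (simp add: scaleC_alg_free_power.abs_eq eq_onp_def scaleC_complex_def)
      then show ?case using w[of "letters v"]
        by (simp add: unital_star_homD[OF G(1)] unital_star_homD[OF F(1)])
    next
      case (3 f g)
      have "Abs_alg_free_power (f + g) = Abs_alg_free_power f + (Abs_alg_free_power g :: ('n, 'a) alg_free_power)"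
        by (simp add: plus_alg_free_power.abs_eq eq_onp_def)
      then show ?case using 3 by (simp add: unital_star_homD[OF G(1)] unital_star_homD[OF F(1)])
    qed
    from this[of "Rep_alg_free_power x"] show "G (compl_embed x) = F (compl_embed x)"
      by (simp add: Rep_alg_free_power_inverse)
  qed
  show ?thesis
  proof (rule ex1I[of _ F])
    show "unital_star_hom F \<and> (\<forall>k a. F (free_incl k a) = \<psi> k a)" using F(1) Fi by blast
    fix G assume "unital_star_hom G \<and> (\<forall>k a. G (free_incl k a) = \<psi> k a)"
    then show "G = F" using uniq by blast
  qed
qed

section \<open>Compact quantum semigroups and groups\<close>

text \<open>Meaningful for unital star-homomorphisms \<open>f\<close> and \<open>g\<close>; see \<open>tensor_map_ex1\<close>.\<close>

definition tensor_map ::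
  "('a::separable_unital_cstar_algebra \<Rightarrow> 'c::separable_unital_cstar_algebra) \<Rightarrow>
   ('b::separable_unital_cstar_algebra \<Rightarrow> 'd::separable_unital_cstar_algebra) \<Rightarrow>
   ('a, 'b) min_tensor \<Rightarrow> ('c, 'd) min_tensor" where
  "tensor_map f g = (THE h. unital_star_hom h \<and> (\<forall>a b. h (a \<otimes> b) = f a \<otimes> g b))"

lemma tensor_map:
  assumes "unital_star_hom f" "unital_star_hom g"
  shows "unital_star_hom (tensor_map f g)" "tensor_map f g (a \<otimes> b) = f a \<otimes> g b"
  using theI'[OF tensor_map_ex1[OF assms]] unfolding tensor_map_def by blast+

instantiation prod :: (complex_vector, complex_vector) complex_vector
begin

definition "c *\<^sub>C p = (c *\<^sub>C fst p, c *\<^sub>C snd p)"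

instance
  by standard (auto simp: scaleC_prod_def scaleC_add_right scaleC_add_left scaleR_scaleC scaleR_prod_def)

end

definition cspan :: "'a::complex_vector set \<Rightarrow> 'a set" where
  "cspan S = {(\<Sum>x\<in>F. c x *\<^sub>C x) | F c. finite F \<and> F \<subseteq> S}"

text \<open>The canonical isomorphism \<open>(A \<otimes> A) \<otimes> A \<cong> A \<otimes> (A \<otimes> A)\<close>, implicit in the usual statement of
  coassociativity, is the continuous extension of \<open>(a \<otimes> b) \<otimes> c \<mapsto> a \<otimes> (b \<otimes> c)\<close>. It is given here by its
  graph, the closure of the graph of the algebraic associator.\<close>

definition assoc_graph ::
  "((('a::separable_unital_cstar_algebra, 'a) min_tensor, 'a) min_tensor \<times>
    ('a, ('a, 'a) min_tensor) min_tensor) set" where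
  "assoc_graph = closure (cspan {((a \<otimes> b) \<otimes> c, a \<otimes> (b \<otimes> c)) | a b c. True})"

definition coassociative ::
  "('a::separable_unital_cstar_algebra \<Rightarrow> ('a, 'a) min_tensor) \<Rightarrow> bool" where
  "coassociative \<Delta> \<longleftrightarrow>
     (\<forall>a. (tensor_map \<Delta> id (\<Delta> a), tensor_map id \<Delta> (\<Delta> a)) \<in> assoc_graph)"

definition compact_quantum_semigroup ::
  "('a::separable_unital_cstar_algebra \<Rightarrow> ('a, 'a) min_tensor) \<Rightarrow> bool" where
  "compact_quantum_semigroup \<Delta> \<longleftrightarrow> unital_star_hom \<Delta> \<and> coassociative \<Delta>"

definition compact_quantum_group ::
  "('a::separable_unital_cstar_algebra \<Rightarrow> ('a, 'a) min_tensor) \<Rightarrow> bool" where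
  "compact_quantum_group \<Delta> \<longleftrightarrow>
     compact_quantum_semigroup \<Delta> \<and>
     closure (cspan {\<Delta> a * (1 \<otimes> b) | a b. True}) = UNIV \<and>
     closure (cspan {\<Delta> a * (b \<otimes> 1) | a b. True}) = UNIV"

text \<open>\<open>\<complex> \<otimes> A\<close> and \<open>A \<otimes> \<complex>\<close> are identified with \<open>A\<close> by \<open>a \<mapsto> 1 \<otimes> a\<close> and \<open>a \<mapsto> a \<otimes> 1\<close>.\<close>

definition continuous_counit ::
  "('a::separable_unital_cstar_algebra \<Rightarrow> ('a, 'a) min_tensor) \<Rightarrow> ('a \<Rightarrow> complex) \<Rightarrow> bool" where
  "continuous_counit \<Delta> \<epsilon> \<longleftrightarrow>
     unital_star_hom \<epsilon> \<and>
     (\<forall>a. tensor_map \<epsilon> id (\<Delta> a) = 1 \<otimes> a) \<and> (\<forall>a. tensor_map id \<epsilon> (\<Delta> a) = a \<otimes> 1)"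

text \<open>The only closed unital star-subalgebra containing \<open>G\<close> is the whole algebra.\<close>

definition cstar_generates :: "'a::unital_cstar_algebra set \<Rightarrow> bool" where
  "cstar_generates G \<longleftrightarrow>
     (\<forall>S. G \<subseteq> S \<and> closed S \<and> 1 \<in> S \<and> (\<forall>x\<in>S. \<forall>y\<in>S. x + y \<in> S \<and> x * y \<in> S) \<and>
        (\<forall>x\<in>S. star x \<in> S \<and> (\<forall>c. c *\<^sub>C x \<in> S)) \<longrightarrow> S = UNIV)"

end

theory Submission
  imports Defs
begin

text \<open>Write \<open>\<iota>\<^sub>k : A \<rightarrow> C\<close> for the canonical inclusions. Two features of the free power carry the proof.

  First, the folding homomorphism \<open>\<rho> : C \<rightarrow> A\<close> with \<open>\<rho> \<circ> \<iota>\<^sub>k = id\<close> for every \<open>k\<close> satisfies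
  \<open>(\<rho> \<otimes> \<rho>) \<circ> \<Delta> = \<Delta>\<^sub>A \<circ> \<rho>\<close>, because both sides are homomorphisms that agree on the copies of \<open>A\<close>.
  Hence \<open>A\<close> is a quotient of \<open>C\<close> compatibly with the comultiplications, and at the same time each
  \<open>\<iota>\<^sub>k\<close> embeds \<open>A\<close> compatibly into \<open>C\<close>. Properties of \<open>C\<close> therefore descend to \<open>A\<close>: the density
  conditions are pushed forward along \<open>\<rho> \<otimes> \<rho>\<close>, and a counit \<open>\<epsilon>\<close> of \<open>C\<close> restricts to the counit
  \<open>\<epsilon> \<circ> \<iota>\<^sub>k\<close> of \<open>A\<close>, the map \<open>id \<otimes> \<rho>\<close> being used to undo \<open>id \<otimes> \<iota>\<^sub>k\<close>.

  Second, the copies of \<open>A\<close> generate \<open>C\<close> (\<open>free_power_generated\<close>), so a property passes from \<open>A\<close> to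
  \<open>C\<close> as soon as the elements having it form a closed subalgebra. For counits this is the
  uniqueness in the universal property. For coassociativity it holds because the closed graph of the
  associator is a subalgebra (\<open>assoc_graph_mult\<close>). For the density conditions the point is
  \<open>podles_span_extend\<close>: let \<open>V\<close> be the closed span of \<open>\<Delta>(C)(1 \<otimes> C)\<close>. Then
  \<open>{c. c \<otimes> 1 \<in> V}\<close> is multiplicatively closed, since \<open>1 \<otimes> C\<close> commutes with \<open>C \<otimes> 1\<close>:
  \<open>\<Delta>(x)(1 \<otimes> y)(c \<otimes> 1) = \<Delta>(x)(c \<otimes> 1)(1 \<otimes> y)\<close>, and \<open>V\<close> is stable under \<open>\<Delta>(x)\<close> from the left and under
  \<open>1 \<otimes> y\<close> from the right.\<close>

section \<open>Closed complex subspaces\<close>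

definition closed_csubspace :: "'a::{complex_vector, topological_space} set \<Rightarrow> bool" where
  "closed_csubspace V \<longleftrightarrow> closed V \<and> 0 \<in> V \<and> (\<forall>x\<in>V. \<forall>y\<in>V. x + y \<in> V) \<and> (\<forall>c. \<forall>x\<in>V. c *\<^sub>C x \<in> V)"

lemma closed_csubspaceD:
  assumes "closed_csubspace V"
  shows "closed V" "0 \<in> V" "x \<in> V \<Longrightarrow> y \<in> V \<Longrightarrow> x + y \<in> V" "x \<in> V \<Longrightarrow> c *\<^sub>C x \<in> V"
  using assms by (auto simp: closed_csubspace_def)

lemma closed_csubspace_preimage:
  assumes V: "closed_csubspace V" and g: "continuous_on UNIV g"
    "\<And>x y. g (x + y) = g x + g y" "\<And>c x. g (c *\<^sub>C x) = c *\<^sub>C g x"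
  shows "closed_csubspace {x. g x \<in> V}"
proof -
  have "closed {x. g x \<in> V}"
    using closed_vimage[OF closed_csubspaceD(1)[OF V] g(1)] by (simp add: vimage_def)
  moreover have "g 0 = 0" using g(3)[of 0 0] by simp
  ultimately show ?thesis
    using closed_csubspaceD[OF V] by (simp add: closed_csubspace_def g(2,3))
qed

lemma cspan_superset: "x \<in> S \<Longrightarrow> x \<in> cspan S"
  unfolding cspan_def by (rule CollectI, rule exI[of _ "{x}"], rule exI[of _ "\<lambda>_. 1"]) simp

lemma cspan_zero: "0 \<in> cspan S"
  unfolding cspan_def by (rule CollectI, rule exI[of _ "{}"]) simp

lemma cspan_scaleC:
  assumes "x \<in> cspan S"
  shows "d *\<^sub>C x \<in> cspan S"
proof -
  obtain F c where F: "finite F" "F \<subseteq> S" "x = (\<Sum>x\<in>F. c x *\<^sub>C x)"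
    using assms unfolding cspan_def by blast
  then have "d *\<^sub>C x = (\<Sum>x\<in>F. (d * c x) *\<^sub>C x)" by (simp add: scaleC_sum_right)
  with F show ?thesis unfolding cspan_def by (intro CollectI exI[of _ F]) auto
qed

lemma cspan_add:
  assumes "x \<in> cspan S" "y \<in> cspan S"
  shows "x + y \<in> cspan S"
proof -
  obtain F c where F: "finite F" "F \<subseteq> S" "x = (\<Sum>x\<in>F. c x *\<^sub>C x)"
    using assms(1) unfolding cspan_def by blast
  obtain G d where G: "finite G" "G \<subseteq> S" "y = (\<Sum>x\<in>G. d x *\<^sub>C x)"
    using assms(2) unfolding cspan_def by blast
  have "x = (\<Sum>x\<in>F \<union> G. (if x \<in> F then c x else 0) *\<^sub>C x)"
    unfolding F(3) by (rule sum.mono_neutral_cong_left) (use F G in auto)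
  moreover have "y = (\<Sum>x\<in>F \<union> G. (if x \<in> G then d x else 0) *\<^sub>C x)"
    unfolding G(3) by (rule sum.mono_neutral_cong_left) (use F G in auto)
  ultimately have "x + y =
      (\<Sum>x\<in>F \<union> G. ((if x \<in> F then c x else 0) + (if x \<in> G then d x else 0)) *\<^sub>C x)"
    by (simp only: scaleC_add_left sum.distrib)
  then show ?thesis
    using F G unfolding cspan_def by (intro CollectI exI[of _ "F \<union> G"]) auto
qed

lemma closure_cspan_minimal:
  assumes V: "closed_csubspace V" and S: "S \<subseteq> V"
  shows "closure (cspan S) \<subseteq> V"
proof (rule closure_minimal)
  note V = closed_csubspaceD[OF V]
  have "(\<Sum>x\<in>F. c x *\<^sub>C x) \<in> V" if "finite F" "F \<subseteq> S" for F c
    using that by (induction F) (use V S in auto)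
  then show "cspan S \<subseteq> V" unfolding cspan_def by blast
  show "closed V" by (rule V)
qed

lemma closed_csubspace_closure_cspan:
  fixes S :: "'a::{complex_vector, real_normed_vector} set"
  assumes cont: "\<And>c. continuous_on UNIV ((*\<^sub>C) c :: 'a \<Rightarrow> 'a)"
  shows "closed_csubspace (closure (cspan S))"
  unfolding closed_csubspace_def
proof (intro conjI ballI allI)
  show "0 \<in> closure (cspan S)" using cspan_zero closure_subset by blast
next
  fix x y assume "x \<in> closure (cspan S)" "y \<in> closure (cspan S)"
  then obtain X Y where X: "\<And>n. X n \<in> cspan S" "X \<longlonglongrightarrow> x" and Y: "\<And>n. Y n \<in> cspan S" "Y \<longlonglongrightarrow> y"
    unfolding closure_sequential by blast
  have "(\<lambda>n. X n + Y n) \<longlonglongrightarrow> x + y" by (intro tendsto_add X Y)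
  then show "x + y \<in> closure (cspan S)"
    unfolding closure_sequential
    using cspan_add[OF X(1) Y(1)] by (intro exI[of _ "\<lambda>n. X n + Y n"]) simp
next
  fix x c assume "x \<in> closure (cspan S)"
  moreover have "(*\<^sub>C) c ` closure (cspan S) \<subseteq> closure (cspan S)"
    by (rule image_closure_subset[OF continuous_on_subset[OF cont]])
       (auto intro!: cspan_scaleC subsetD[OF closure_subset])
  ultimately show "c *\<^sub>C x \<in> closure (cspan S)" by blast
qed simp

lemma continuous_scaleC [continuous_intros]:
  fixes f :: "_ \<Rightarrow> 'a::unital_cstar_algebra"
  assumes "continuous_on T f"
  shows "continuous_on T (\<lambda>x. c *\<^sub>C f x)"
proof -
  have "bounded_linear (\<lambda>x::'a. c *\<^sub>C x)"
    by (rule bounded_linear_intro[of _ "cmod c"])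
       (simp_all add: scaleC_add_right scaleR_scaleC norm_scaleC mult.commute)
  then show ?thesis using assms by (rule bounded_linear.continuous_on)
qed

lemmas closed_csubspace_closure_cspan_cstar =
  closed_csubspace_closure_cspan[OF continuous_scaleC[OF continuous_on_id]]

lemma unital_star_hom_continuous:
  fixes f :: "'a::unital_cstar_algebra \<Rightarrow> 'b::unital_cstar_algebra"
  shows "unital_star_hom f \<Longrightarrow> continuous_on T f"
  by (rule linear_continuous_on[OF unital_star_hom_bounded_linear])

lemma unital_star_hom_compose:
  "unital_star_hom g \<Longrightarrow> unital_star_hom f \<Longrightarrow> unital_star_hom (\<lambda>x. g (f x))"
  using unital_star_hom_comp[of g f] by (simp add: comp_def)

section \<open>Generators of tensor products and free powers\<close>

lemma closed_csubspace_completion_UNIV: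
  assumes "closed_csubspace V" "\<And>x. compl_embed x \<in> V"
  shows "z \<in> V"
proof -
  have "z \<in> closure V"
    unfolding closure_approachable
    using compl_embed_dense[of _ z] assms(2) by (metis dist_commute dist_norm)
  then show ?thesis using closed_csubspaceD(1)[OF assms(1)] by simp
qed

lemma min_tensor_spanned:
  fixes V :: "('a::separable_unital_cstar_algebra, 'b::separable_unital_cstar_algebra) min_tensor set"
  assumes V: "closed_csubspace V" and e: "\<And>a b. a \<otimes> b \<in> V"
  shows "z \<in> V"
proof (rule closed_csubspace_completion_UNIV[OF V])
  note V = closed_csubspaceD[OF V]
  show "compl_embed x \<in> V" for x
    by (induction x rule: alg_tensor_additive_induct) (use V e in \<open>auto simp flip: tensor_def\<close>)
qed

text \<open>The copies of the base algebra are closed under \<open>star\<close>, so the products of their elements already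
  span the algebraic free product, which is dense.\<close>

lemma free_power_generated:
  fixes V :: "('n::finite, 'a::separable_unital_cstar_algebra) free_power set"
  assumes V: "closed_csubspace V" and 1: "1 \<in> V" and mult: "\<And>x y. x \<in> V \<Longrightarrow> y \<in> V \<Longrightarrow> x * y \<in> V"
    and gen: "\<And>k a. free_incl k a \<in> V"
  shows "c \<in> V"
proof (rule closed_csubspace_completion_UNIV[OF V])
  note V = closed_csubspaceD[OF V]
  let ?w = "\<lambda>ws. Abs_alg_free_power (Poly_Mapping.single (FWord ws) 1) :: ('n, 'a) alg_free_power"
  have w: "compl_embed (?w ws) \<in> V" for ws
  proof (induction ws)
    case Nil
    have "?w [] = 1" by (simp add: one_alg_free_power_def flip: zero_fword_def)
    then show ?case using 1 by simp
  next
    case (Cons p ws)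
    obtain k a where p: "p = (k, a)" by (cases p)
    have "?w (p # ws) = alg_free_incl k a * ?w ws"
      by (simp add: alg_free_incl_def times_alg_free_power.abs_eq eq_onp_def letter_def mult_single
          plus_fword_def p)
    then have "compl_embed (?w (p # ws)) = free_incl k a * compl_embed (?w ws)"
      by (simp add: free_incl_def)
    then show ?case using mult[OF gen Cons.IH] by simp
  qed
  have "compl_embed (Abs_alg_free_power f :: ('n, 'a) alg_free_power) \<in> V" for f
  proof (induction f rule: poly_mapping_additive_induct)
    case 1
    have "Abs_alg_free_power 0 = (0 :: ('n, 'a) alg_free_power)" by (simp add: zero_alg_free_power_def)
    then show ?case by (simp add: V)
  next
    case (2 v c)
    have "Abs_alg_free_power (Poly_Mapping.single v c) = c *\<^sub>C ?w (letters v)"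
      by (simp add: scaleC_alg_free_power.abs_eq eq_onp_def scaleC_complex_def)
    then show ?case using w[of "letters v"] V(4) by simp
  next
    case (3 f g)
    have "Abs_alg_free_power (f + g) = Abs_alg_free_power f + (Abs_alg_free_power g :: ('n, 'a) alg_free_power)"
      by (simp add: plus_alg_free_power.abs_eq eq_onp_def)
    then show ?case using 3 V(3) by simp
  qed
  from this[of "Rep_alg_free_power x" for x] show "compl_embed x \<in> V" for x
    by (simp add: Rep_alg_free_power_inverse)
qed

lemma free_power_hom_eqI:
  fixes F G :: "('n::finite, 'a::separable_unital_cstar_algebra) free_power \<Rightarrow> 'd::unital_cstar_algebra"
  assumes F: "unital_star_hom F" and G: "unital_star_hom G"
    and eq: "\<And>k a. F (free_incl k a) = G (free_incl k a)"
  shows "F c = G c"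
proof -
  have "\<exists>!\<Lambda>. unital_star_hom \<Lambda> \<and> (\<forall>k a. \<Lambda> (free_incl k a) = F (free_incl k a))"
    using free_power_universal[of "\<lambda>k a. F (free_incl k a)"]
      unital_star_hom_compose[OF F unital_star_hom_free_incl] by blast
  then show ?thesis using F G eq by metis
qed

section \<open>Tensor products of homomorphisms\<close>

lemma tensor_map_comp:
  assumes "unital_star_hom f" "unital_star_hom g" "unital_star_hom f'" "unital_star_hom g'"
  shows "tensor_map f g (tensor_map f' g' x) = tensor_map (\<lambda>a. f (f' a)) (\<lambda>b. g (g' b)) x"
proof -
  have h: "unital_star_hom (\<lambda>a. f (f' a))" "unital_star_hom (\<lambda>b. g (g' b))"
    using unital_star_hom_compose[OF assms(1,3)] unital_star_hom_compose[OF assms(2,4)] by blast+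
  have "tensor_map f g \<circ> tensor_map f' g' = tensor_map (\<lambda>a. f (f' a)) (\<lambda>b. g (g' b))"
    by (rule min_tensor_hom_unique) (simp_all add: unital_star_hom_comp tensor_map assms h)
  then show ?thesis by (simp add: fun_eq_iff)
qed

lemma tensor_map_id:
  fixes z :: "('a::separable_unital_cstar_algebra, 'b::separable_unital_cstar_algebra) min_tensor"
  shows "tensor_map (\<lambda>x. x) (\<lambda>x. x) z = z"
proof -
  have "tensor_map (\<lambda>x. x) (\<lambda>x. x) = (\<lambda>z :: ('a, 'b) min_tensor. z)"
    by (rule min_tensor_hom_unique) (simp_all add: tensor_map unital_star_hom_id)
  then show ?thesis by simp
qed

lemma unital_star_hom_tensor_left: "unital_star_hom (\<lambda>a. a \<otimes> 1)"
  by (simp add: unital_star_hom_def tensor_simps)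

lemma unital_star_hom_tensor_right: "unital_star_hom (\<lambda>b. 1 \<otimes> b)"
  by (simp add: unital_star_hom_def tensor_simps)

section \<open>The graph of the associator is a subalgebra\<close>

lemma closed_csubspace_assoc_graph: "closed_csubspace assoc_graph"
  unfolding assoc_graph_def
  by (rule closed_csubspace_closure_cspan) (simp add: scaleC_prod_def[abs_def], intro continuous_intros)

lemma assoc_graph_elementary: "((a \<otimes> b) \<otimes> c, a \<otimes> (b \<otimes> c)) \<in> assoc_graph"
  unfolding assoc_graph_def by (intro subsetD[OF closure_subset] cspan_superset) blast

lemma assoc_graph_minimal:
  assumes "closed_csubspace V" "\<And>a b c. ((a \<otimes> b) \<otimes> c, a \<otimes> (b \<otimes> c)) \<in> V" "p \<in> assoc_graph"
  shows "p \<in> V"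
  using closure_cspan_minimal[OF assms(1), of "{((a \<otimes> b) \<otimes> c, a \<otimes> (b \<otimes> c)) | a b c. True}"] assms(2,3)
  unfolding assoc_graph_def by blast

text \<open>The algebraic associator is multiplicative, and multiplication is separately continuous, so the
  two factors can be moved from elementary tensors to the closure one after the other.\<close>

lemma assoc_graph_mult:
  assumes p: "p \<in> assoc_graph" and q: "q \<in> assoc_graph"
  shows "(fst p * fst q, snd p * snd q) \<in> assoc_graph"
proof -
  have left: "(fst p * ((a \<otimes> b) \<otimes> c), snd p * (a \<otimes> (b \<otimes> c))) \<in> assoc_graph" for a b c
  proof -
    have "p \<in> {p. (fst p * ((a \<otimes> b) \<otimes> c), snd p * (a \<otimes> (b \<otimes> c))) \<in> assoc_graph}"
    proof (rule assoc_graph_minimal[OF closed_csubspace_preimage[OF closed_csubspace_assoc_graph] _ p])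
      show "continuous_on UNIV (\<lambda>p. (fst p * ((a \<otimes> b) \<otimes> c), snd p * (a \<otimes> (b \<otimes> c))))"
        by (intro continuous_intros)
    qed (simp_all add: tensor_simps(5) assoc_graph_elementary distrib_right scaleC_prod_def)
    then show ?thesis by simp
  qed
  have "q \<in> {q. (fst p * fst q, snd p * snd q) \<in> assoc_graph}"
  proof (rule assoc_graph_minimal[OF closed_csubspace_preimage[OF closed_csubspace_assoc_graph] _ q])
    show "continuous_on UNIV (\<lambda>q. (fst p * fst q, snd p * snd q))"
      by (intro continuous_intros)
  qed (simp_all add: left distrib_left scaleC_prod_def)
  then show ?thesis by simp
qed

lemma assoc_graph_map:
  assumes f: "unital_star_hom f" and p: "(x, y) \<in> assoc_graph"
  shows "(tensor_map (tensor_map f f) f x, tensor_map f (tensor_map f f) y) \<in> assoc_graph"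
proof -
  let ?L = "tensor_map (tensor_map f f) f" and ?R = "tensor_map f (tensor_map f f)"
  have LR: "unital_star_hom ?L" "unital_star_hom ?R" by (simp_all add: tensor_map f)
  have "(x, y) \<in> {p. (?L (fst p), ?R (snd p)) \<in> assoc_graph}"
  proof (rule assoc_graph_minimal[OF closed_csubspace_preimage[OF closed_csubspace_assoc_graph] _ p])
    show "continuous_on UNIV (\<lambda>p. (?L (fst p), ?R (snd p)))"
      using continuous_on_compose2[OF unital_star_hom_continuous[OF LR(1)] continuous_on_fst[OF continuous_on_id]]
        continuous_on_compose2[OF unital_star_hom_continuous[OF LR(2)] continuous_on_snd[OF continuous_on_id]]
      by (intro continuous_on_Pair) auto
  qed (simp_all add: tensor_map f assoc_graph_elementary unital_star_homD(1,2)[OF LR(1)]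
      unital_star_homD(1,2)[OF LR(2)] scaleC_prod_def)
  then show ?thesis by simp
qed

section \<open>Density conditions\<close>

text \<open>With \<open>f b = 1 \<otimes> b\<close> or \<open>f b = b \<otimes> 1\<close> this is the closed span in one of the two density conditions
  of a compact quantum group, so that both are handled at once.\<close>

definition podles_span :: "('c \<Rightarrow> 'm) \<Rightarrow> ('c \<Rightarrow> 'm) \<Rightarrow> 'm::unital_cstar_algebra set" where
  "podles_span \<Delta> f = closure (cspan {\<Delta> a * f b | a b. True})"

lemma closed_csubspace_podles_span: "closed_csubspace (podles_span \<Delta> f)"
  unfolding podles_span_def by (rule closed_csubspace_closure_cspan_cstar)

lemma podles_span_base: "\<Delta> a * f b \<in> podles_span \<Delta> f"
  unfolding podles_span_def by (intro subsetD[OF closure_subset] cspan_superset) blast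

lemma podles_span_minimal:
  assumes "closed_csubspace V" "\<And>a b. \<Delta> a * f b \<in> V" "x \<in> podles_span \<Delta> f"
  shows "x \<in> V"
  using closure_cspan_minimal[OF assms(1), of "{\<Delta> a * f b | a b. True}"] assms(2,3)
  unfolding podles_span_def by blast

lemma podles_span_map:
  fixes F :: "'m::unital_cstar_algebra \<Rightarrow> 'k::unital_cstar_algebra"
  assumes F: "unital_star_hom F" and "\<And>a. F (\<Delta> a) = \<Delta>' (\<phi> a)" "\<And>b. F (f b) = f' (\<phi> b)"
    and x: "x \<in> podles_span \<Delta> f"
  shows "F x \<in> podles_span \<Delta>' f'"
proof -
  have "x \<in> {x. F x \<in> podles_span \<Delta>' f'}"
    by (rule podles_span_minimal[OF closed_csubspace_preimage[OF closed_csubspace_podles_span] _ x])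
       (simp_all add: unital_star_hom_continuous[OF F] unital_star_homD[OF F] assms podles_span_base)
  then show ?thesis by simp
qed

lemma podles_span_left:
  assumes \<Delta>: "unital_star_hom \<Delta>" and x: "x \<in> podles_span \<Delta> f"
  shows "\<Delta> c * x \<in> podles_span \<Delta> f"
proof -
  have "x \<in> {x. \<Delta> c * x \<in> podles_span \<Delta> f}"
  proof (rule podles_span_minimal[OF closed_csubspace_preimage[OF closed_csubspace_podles_span] _ x])
    show "\<Delta> a * f b \<in> {x. \<Delta> c * x \<in> podles_span \<Delta> f}" for a b
      using podles_span_base[of \<Delta> "c * a" f b] by (simp add: unital_star_homD[OF \<Delta>] mult.assoc)
  qed (simp_all add: distrib_left continuous_intros)
  then show ?thesis by simp
qed

lemma podles_span_right:
  assumes f: "unital_star_hom f" and x: "x \<in> podles_span \<Delta> f"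
  shows "x * f d \<in> podles_span \<Delta> f"
proof -
  have "x \<in> {x. x * f d \<in> podles_span \<Delta> f}"
  proof (rule podles_span_minimal[OF closed_csubspace_preimage[OF closed_csubspace_podles_span] _ x])
    show "\<Delta> a * f b \<in> {x. x * f d \<in> podles_span \<Delta> f}" for a b
      using podles_span_base[of \<Delta> a f "b * d"] by (simp add: unital_star_homD[OF f] mult.assoc)
  qed (simp_all add: distrib_right continuous_intros)
  then show ?thesis by simp
qed

text \<open>Only the left factor \<open>x\<close> is approximated by sums of products \<open>\<Delta> a * f b\<close>: in \<open>\<Delta> a * f b * y\<close> the
  factor \<open>y\<close> moves past \<open>f b\<close>. Approximating \<open>y\<close> as well would require commuting \<open>f b\<close> with \<open>\<Delta>\<close>, which
  is false in general.\<close>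

lemma podles_span_mult:
  assumes \<Delta>: "unital_star_hom \<Delta>" and f: "unital_star_hom f"
    and comm: "\<And>b. f b * y = y * f b"
    and x: "x \<in> podles_span \<Delta> f" and y: "y \<in> podles_span \<Delta> f"
  shows "x * y \<in> podles_span \<Delta> f"
proof -
  have "x \<in> {x. x * y \<in> podles_span \<Delta> f}"
  proof (rule podles_span_minimal[OF closed_csubspace_preimage[OF closed_csubspace_podles_span] _ x])
    show "\<Delta> a * f b \<in> {x. x * y \<in> podles_span \<Delta> f}" for a b
      using podles_span_left[OF \<Delta> podles_span_right[OF f y]] by (simp add: mult.assoc comm)
  qed (simp_all add: distrib_right continuous_intros)
  then show ?thesis by simp
qed

text \<open>The multiplicativity of \<open>podles_span\<close> on the commutant of \<open>f\<close> turns a condition on the copies of the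
  base algebra into one on the whole free power.\<close>

lemma podles_span_extend:
  fixes \<Delta> e f :: "('n::finite, 'a::separable_unital_cstar_algebra) free_power \<Rightarrow> 'm::unital_cstar_algebra"
  assumes \<Delta>: "unital_star_hom \<Delta>" and e: "unital_star_hom e" and f: "unital_star_hom f"
    and comm: "\<And>c d. f d * e c = e c * f d"
    and gen: "\<And>k a. e (free_incl k a) \<in> podles_span \<Delta> f"
  shows "e c * f d \<in> podles_span \<Delta> f"
proof -
  have "c \<in> {c. e c \<in> podles_span \<Delta> f}"
  proof (rule free_power_generated[OF closed_csubspace_preimage[OF closed_csubspace_podles_span]])
    show "1 \<in> {c. e c \<in> podles_span \<Delta> f}"
      using podles_span_base[of \<Delta> 1 f 1] by (simp add: unital_star_homD[OF e] unital_star_homD[OF f] unital_star_homD[OF \<Delta>])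
    show "x * y \<in> {c. e c \<in> podles_span \<Delta> f}"
      if "x \<in> {c. e c \<in> podles_span \<Delta> f}" "y \<in> {c. e c \<in> podles_span \<Delta> f}" for x y
      using that by (simp add: unital_star_homD[OF e] podles_span_mult[OF \<Delta> f comm])
  qed (simp_all add: unital_star_hom_continuous[OF e] unital_star_homD[OF e] gen)
  then show ?thesis by (simp add: podles_span_right[OF f])
qed

section \<open>The comultiplication of the free power\<close>

locale free_power_comultiplication =
  fixes \<Delta>\<^sub>A :: "'a::separable_unital_cstar_algebra \<Rightarrow> ('a, 'a) min_tensor"
    and \<Delta> :: "('n::finite, 'a) free_power \<Rightarrow> (('n, 'a) free_power, ('n, 'a) free_power) min_tensor"
  assumes \<Delta>\<^sub>A: "unital_star_hom \<Delta>\<^sub>A" and \<Delta>: "unital_star_hom \<Delta>"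
    and \<Delta>_incl: "\<Delta> (free_incl k a) = tensor_map (free_incl k) (free_incl k) (\<Delta>\<^sub>A a)"
begin

lemmas incl = unital_star_hom_free_incl[where ?'n='n and ?'a='a]
lemmas ids = unital_star_hom_id

definition fold_map :: "('n, 'a) free_power \<Rightarrow> 'a" where
  "fold_map = (THE \<Lambda>. unital_star_hom \<Lambda> \<and> (\<forall>k a. \<Lambda> (free_incl k a) = a))"

lemma fold_map: "unital_star_hom fold_map" "fold_map (free_incl k a) = a"
  using theI'[OF free_power_universal[of "\<lambda>(k::'n) (a::'a). a", OF unital_star_hom_id(2)]]
  unfolding fold_map_def by blast+

lemma fold_map_\<Delta>: "tensor_map fold_map fold_map (\<Delta> c) = \<Delta>\<^sub>A (fold_map c)"
  by (rule free_power_hom_eqI[where F = "\<lambda>c. tensor_map fold_map fold_map (\<Delta> c)"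
        and G = "\<lambda>c. \<Delta>\<^sub>A (fold_map c)"])
     (simp_all add: unital_star_hom_compose[OF tensor_map(1)[OF fold_map(1) fold_map(1)] \<Delta>]
       unital_star_hom_compose[OF \<Delta>\<^sub>A fold_map(1)] fold_map \<Delta>\<^sub>A \<Delta>_incl tensor_map_comp incl
       tensor_map_id)

text \<open>Both iterated comultiplications are homomorphisms and the graph of the associator is a closed
  subalgebra, so the elements at which they correspond form a closed subalgebra; on the \<open>k\<close>-th copy the
  correspondence is the image of that for \<open>\<Delta>\<^sub>A\<close> under \<open>\<iota>\<^sub>k \<otimes> \<iota>\<^sub>k \<otimes> \<iota>\<^sub>k\<close>.\<close>

lemma coassociative:
  assumes "coassociative \<Delta>\<^sub>A"
  shows "coassociative \<Delta>"
  unfolding coassociative_def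
proof
  let ?L = "\<lambda>c. tensor_map \<Delta> id (\<Delta> c)" and ?R = "\<lambda>c. tensor_map id \<Delta> (\<Delta> c)"
  have LR: "unital_star_hom ?L" "unital_star_hom ?R"
    using unital_star_hom_compose[OF tensor_map(1)[OF \<Delta> ids(1)] \<Delta>]
      unital_star_hom_compose[OF tensor_map(1)[OF ids(1) \<Delta>] \<Delta>] by blast+
  fix c
  have "c \<in> {c. (?L c, ?R c) \<in> assoc_graph}"
  proof (rule free_power_generated[OF closed_csubspace_preimage[OF closed_csubspace_assoc_graph]])
    show "continuous_on UNIV (\<lambda>c. (?L c, ?R c))"
      by (intro continuous_on_Pair unital_star_hom_continuous LR)
    show "1 \<in> {c. (?L c, ?R c) \<in> assoc_graph}"
      using assoc_graph_elementary[of 1 1 1]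
      by (simp add: unital_star_homD(4)[OF LR(1)] unital_star_homD(4)[OF LR(2)] tensor_simps(7))
    show "x * y \<in> {c. (?L c, ?R c) \<in> assoc_graph}"
      if "x \<in> {c. (?L c, ?R c) \<in> assoc_graph}" "y \<in> {c. (?L c, ?R c) \<in> assoc_graph}" for x y
      using that assoc_graph_mult[of "(?L x, ?R x)" "(?L y, ?R y)"]
      by (simp add: unital_star_homD(3)[OF LR(1)] unital_star_homD(3)[OF LR(2)])
    show "free_incl k a \<in> {c. (?L c, ?R c) \<in> assoc_graph}" for k a
    proof -
      let ?i = "free_incl k :: 'a \<Rightarrow> ('n, 'a) free_power"
      have "?L (?i a) = tensor_map (tensor_map ?i ?i) ?i (tensor_map \<Delta>\<^sub>A id (\<Delta>\<^sub>A a))"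
        "?R (?i a) = tensor_map ?i (tensor_map ?i ?i) (tensor_map id \<Delta>\<^sub>A (\<Delta>\<^sub>A a))"
        by (simp_all add: \<Delta>_incl tensor_map_comp tensor_map \<Delta> \<Delta>\<^sub>A incl ids)
      then show ?thesis
        using assms assoc_graph_map[OF incl] by (simp add: coassociative_def)
    qed
  qed (simp_all add: unital_star_homD[OF LR(1)] unital_star_homD[OF LR(2)] scaleC_prod_def)
  then show "(?L c, ?R c) \<in> assoc_graph" by simp
qed

lemma compact_quantum_group_free_power:
  assumes A: "compact_quantum_group \<Delta>\<^sub>A"
  shows "compact_quantum_group \<Delta>"
proof -
  have dense: "podles_span \<Delta>\<^sub>A (\<lambda>b. 1 \<otimes> b) = UNIV" "podles_span \<Delta>\<^sub>A (\<lambda>b. b \<otimes> 1) = UNIV"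
    using A by (simp_all add: compact_quantum_group_def podles_span_def)
  have push1: "tensor_map (free_incl k) (free_incl k) x \<in> podles_span \<Delta> (\<lambda>b. 1 \<otimes> b)" for k x
    by (rule podles_span_map[where \<phi> = "free_incl k" and \<Delta> = \<Delta>\<^sub>A and f = "\<lambda>b. 1 \<otimes> b"])
       (simp_all add: tensor_map incl \<Delta>_incl unital_star_homD(4)[OF incl] dense)
  have push2: "tensor_map (free_incl k) (free_incl k) x \<in> podles_span \<Delta> (\<lambda>b. b \<otimes> 1)" for k x
    by (rule podles_span_map[where \<phi> = "free_incl k" and \<Delta> = \<Delta>\<^sub>A and f = "\<lambda>b. b \<otimes> 1"])
       (simp_all add: tensor_map incl \<Delta>_incl unital_star_homD(4)[OF incl] dense)
  have gen: "free_incl k a \<otimes> 1 \<in> podles_span \<Delta> (\<lambda>b. 1 \<otimes> b)"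
    "1 \<otimes> free_incl k a \<in> podles_span \<Delta> (\<lambda>b. b \<otimes> 1)" for k a
    using push1[of k "a \<otimes> 1"] push2[of k "1 \<otimes> a"]
    by (simp_all add: tensor_map incl unital_star_homD(4)[OF incl])
  have "z \<in> podles_span \<Delta> (\<lambda>b. 1 \<otimes> b)" for z
  proof (rule min_tensor_spanned[OF closed_csubspace_podles_span])
    show "c \<otimes> d \<in> podles_span \<Delta> (\<lambda>b. 1 \<otimes> b)" for c d
      using podles_span_extend[OF \<Delta> unital_star_hom_tensor_left unital_star_hom_tensor_right _ gen(1), of c d]
      by (simp add: tensor_simps(5))
  qed
  moreover have "z \<in> podles_span \<Delta> (\<lambda>b. b \<otimes> 1)" for z
  proof (rule min_tensor_spanned[OF closed_csubspace_podles_span])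
    show "c \<otimes> d \<in> podles_span \<Delta> (\<lambda>b. b \<otimes> 1)" for c d
      using podles_span_extend[OF \<Delta> unital_star_hom_tensor_right unital_star_hom_tensor_left _ gen(2), of d c]
      by (simp add: tensor_simps(5))
  qed
  ultimately show ?thesis
    using A coassociative \<Delta>
    by (auto simp: compact_quantum_group_def compact_quantum_semigroup_def podles_span_def)
qed

lemma compact_quantum_group_base:
  assumes C: "compact_quantum_group \<Delta>" and A: "compact_quantum_semigroup \<Delta>\<^sub>A"
  shows "compact_quantum_group \<Delta>\<^sub>A"
proof -
  have dense: "podles_span \<Delta> (\<lambda>b. 1 \<otimes> b) = UNIV" "podles_span \<Delta> (\<lambda>b. b \<otimes> 1) = UNIV"
    using C by (simp_all add: compact_quantum_group_def podles_span_def)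
  have "tensor_map fold_map fold_map z \<in> podles_span \<Delta>\<^sub>A (\<lambda>b. 1 \<otimes> b)" for z
    by (rule podles_span_map[where \<phi> = fold_map and \<Delta> = \<Delta> and f = "\<lambda>b. 1 \<otimes> b"])
       (simp_all add: tensor_map fold_map fold_map_\<Delta> unital_star_homD(4)[OF fold_map(1)] dense)
  moreover have "tensor_map fold_map fold_map z \<in> podles_span \<Delta>\<^sub>A (\<lambda>b. b \<otimes> 1)" for z
    by (rule podles_span_map[where \<phi> = fold_map and \<Delta> = \<Delta> and f = "\<lambda>b. b \<otimes> 1"])
       (simp_all add: tensor_map fold_map fold_map_\<Delta> unital_star_homD(4)[OF fold_map(1)] dense)
  \<comment> \<open>Any index will do; one exists because types are nonempty.\<close>
  moreover have "z = tensor_map fold_map fold_map (tensor_map (free_incl undefined) (free_incl undefined) z)" for z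
    by (simp add: tensor_map_comp fold_map incl tensor_map_id)
  ultimately have "z \<in> podles_span \<Delta>\<^sub>A (\<lambda>b. 1 \<otimes> b)" "z \<in> podles_span \<Delta>\<^sub>A (\<lambda>b. b \<otimes> 1)" for z
    by metis+
  then show ?thesis using A by (auto simp: compact_quantum_group_def podles_span_def)
qed

lemma continuous_counit_free_power:
  assumes \<epsilon>: "continuous_counit \<Delta>\<^sub>A \<epsilon>"
  shows "\<exists>\<epsilon>'. continuous_counit \<Delta> \<epsilon>'"
proof -
  have h: "unital_star_hom \<epsilon>" and l: "tensor_map \<epsilon> id (\<Delta>\<^sub>A a) = 1 \<otimes> a" and r: "tensor_map id \<epsilon> (\<Delta>\<^sub>A a) = a \<otimes> 1" for a
    using \<epsilon> by (auto simp: continuous_counit_def)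
  obtain E :: "('n, 'a) free_power \<Rightarrow> complex" where E: "unital_star_hom E" "\<And>k a. E (free_incl k a) = \<epsilon> a"
    using free_power_universal[of "\<lambda>(k::'n). \<epsilon>", OF h] by blast
  have "tensor_map \<epsilon> (free_incl k) (\<Delta>\<^sub>A a) = tensor_map id (free_incl k) (tensor_map \<epsilon> id (\<Delta>\<^sub>A a))"
    "tensor_map (free_incl k) \<epsilon> (\<Delta>\<^sub>A a) = tensor_map (free_incl k) id (tensor_map id \<epsilon> (\<Delta>\<^sub>A a))" for k :: 'n and a
    by (simp_all add: tensor_map_comp h ids incl)
  then have gen: "tensor_map \<epsilon> (free_incl k) (\<Delta>\<^sub>A a) = 1 \<otimes> free_incl k a"
    "tensor_map (free_incl k) \<epsilon> (\<Delta>\<^sub>A a) = free_incl k a \<otimes> 1" for k :: 'n and a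
    by (simp_all add: l r tensor_map ids incl)
  have "tensor_map E id (\<Delta> c) = 1 \<otimes> c" for c
    by (rule free_power_hom_eqI[where F = "\<lambda>c. tensor_map E id (\<Delta> c)" and G = "\<lambda>c. 1 \<otimes> c"])
       (simp_all add: unital_star_hom_compose[OF tensor_map(1)[OF E(1) ids(1)] \<Delta>]
         unital_star_hom_tensor_right tensor_map E ids \<Delta> \<Delta>_incl
         tensor_map_comp incl gen)
  moreover have "tensor_map id E (\<Delta> c) = c \<otimes> 1" for c
    by (rule free_power_hom_eqI[where F = "\<lambda>c. tensor_map id E (\<Delta> c)" and G = "\<lambda>c. c \<otimes> 1"])
       (simp_all add: unital_star_hom_compose[OF tensor_map(1)[OF ids(1) E(1)] \<Delta>]
         unital_star_hom_tensor_left tensor_map E ids \<Delta> \<Delta>_incl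
         tensor_map_comp incl gen)
  ultimately show ?thesis using E(1) by (auto simp: continuous_counit_def)
qed

text \<open>Evaluating the counit identity at \<open>\<iota>\<^sub>k a\<close> gives the identity for \<open>\<epsilon> \<circ> \<iota>\<^sub>k\<close> with \<open>\<iota>\<^sub>k\<close> applied to
  the other leg; folding that leg removes \<open>\<iota>\<^sub>k\<close>.\<close>

lemma continuous_counit_base:
  assumes \<epsilon>: "continuous_counit \<Delta> \<epsilon>"
  shows "continuous_counit \<Delta>\<^sub>A (\<lambda>a. \<epsilon> (free_incl k a))"
proof -
  have h: "unital_star_hom \<epsilon>" and l: "tensor_map \<epsilon> id (\<Delta> c) = 1 \<otimes> c" and r: "tensor_map id \<epsilon> (\<Delta> c) = c \<otimes> 1" for c
    using \<epsilon> by (auto simp: continuous_counit_def)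
  let ?\<epsilon> = "\<lambda>a. \<epsilon> (free_incl k a)"
  have h': "unital_star_hom ?\<epsilon>"
    using unital_star_hom_comp[OF h incl] by (simp add: o_def)
  have "tensor_map ?\<epsilon> id (\<Delta>\<^sub>A a) = tensor_map id fold_map (tensor_map \<epsilon> id (\<Delta> (free_incl k a)))"
    "tensor_map id ?\<epsilon> (\<Delta>\<^sub>A a) = tensor_map fold_map id (tensor_map id \<epsilon> (\<Delta> (free_incl k a)))" for a
    by (simp_all add: \<Delta>_incl tensor_map_comp tensor_map h h' ids incl fold_map id_def)
  then show ?thesis
    by (simp add: continuous_counit_def h' l r tensor_map ids fold_map)
qed

end

theorem mainTheorem4:
  fixes \<Delta>\<^sub>A :: "'a::separable_unital_cstar_algebra \<Rightarrow> ('a, 'a) min_tensor"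
    and \<Delta> :: "('n::finite, 'a) free_power \<Rightarrow> (('n, 'a) free_power, ('n, 'a) free_power) min_tensor"
  assumes "\<exists>G :: 'a set. finite G \<and> cstar_generates G"
    and "compact_quantum_semigroup \<Delta>\<^sub>A"
    and "unital_star_hom \<Delta>"
    and "\<And>k a. \<Delta> (free_incl k a) = tensor_map (free_incl k) (free_incl k) (\<Delta>\<^sub>A a)"
  shows "(compact_quantum_group \<Delta>\<^sub>A \<longrightarrow> compact_quantum_group \<Delta>) \<and>
    ((\<exists>\<epsilon>. continuous_counit \<Delta>\<^sub>A \<epsilon>) \<longrightarrow> (\<exists>\<epsilon>. continuous_counit \<Delta> \<epsilon>)) \<and>
    ((\<exists>\<epsilon>. continuous_counit \<Delta> \<epsilon>) \<longrightarrow> (\<exists>\<epsilon>. continuous_counit \<Delta>\<^sub>A \<epsilon>)) \<and>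
    (compact_quantum_group \<Delta> \<longrightarrow> compact_quantum_group \<Delta>\<^sub>A)"
proof -
  have A: "compact_quantum_semigroup \<Delta>\<^sub>A" by (rule assms)
  interpret free_power_comultiplication \<Delta>\<^sub>A \<Delta>
    using assms(2-4) by unfold_locales (simp_all add: compact_quantum_semigroup_def)
  show ?thesis
    using compact_quantum_group_free_power continuous_counit_free_power continuous_counit_base
      compact_quantum_group_base[OF _ A] by blast
qed

end
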